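(* Let $s\in(0,1)$, $a_1,\dots,a_{m-1},a>0$ and $$L_*:=\sum_{i=1}^{m-1}a_i(-\Delta_{X_i})^{s}-a\,\partial^2_{x_n}.$$ If $s<1/2$ let $\gamma:=2s$; if $s\ge1/2$ let $\epsilon\in(0,1)$ be arbitrary and $\gamma:=1-\epsilon$. Then there exists a constant $C>0$, depending only on $a_1,\dots,a_{m-1},a$, $s$, $N_1,\dots,N_{m-1}$ (and also on $\epsilon$ when $s\ge1/2$), such that the following holds. Let $f\in L^\infty(\mathbb{R}^n)$ be Lipschitz continuous in $B_1$ with respect to the variable $x_n$, and let $u:\mathbb{R}^n\to\mathbb{R}$ be a solution of $L_*u=f$ in $B_1^{n-1}\times\mathbb{R}$. Then $$\|u\|_{C^\gamma(B_{1/2})}\le C\,\big(\|f\|_{L^\infty(\mathbb{R}^n)}+\|\partial_{x_n}f\|_{L^\infty(B_1)}+\|u\|_{L^\infty(\mathbb{R}^n)}\big).$$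
   Context: Setting. $\{e_1,\dots,e_n\}$ is the Euclidean basis of $\mathbb{R}^n$; $B_r$ is the open ball of $\mathbb{R}^n$, and $B^{N}_r$ the open ball of $\mathbb{R}^N$, centered at the origin with radius $r$. Let $m\in\mathbb{N}$ and $N_1,\dots,N_{m-1}\in\mathbb{N}$ (positive integers) with $N_1+\dots+N_{m-1}=n-1$. Put $N_i':=N_1+\dots+N_i$ and $N_0':=0$. The first $n-1$ coordinates of $x=(x_1,\dots,x_n)\in\mathbb{R}^n$ are split into groups $X_i:=(x_{N_{i-1}'+1},\dots,x_{N_i'})\in\mathbb{R}^{N_i}$ for $i\in\{1,\dots,m-1\}$. For $y=(y_1,\dots,y_{N_i})\in\mathbb{R}^{N_i}$ let $y^{(i)}:=y_1e_{N_{i-1}'+1}+\dots+y_{N_i}e_{N_i'}\in\mathbb{R}^n$. For $s\in(0,1)$, $$(-\Delta_{X_i})^{s}u(x):=c_{N_i,s}\int_{\mathbb{R}^{N_i}}\frac{2u(x)-u(x+y^{(i)})-u(x-y^{(i)})}{|y^{(i)}|^{N_i+2s}}\,dy,\qquad c_{N,s}:=\frac{2^{2s-1}\,\Gamma(s+\frac N2)}{\pi^{N/2}\,|\Gamma(-s)|}.$$ Solutions are classical: "$u:\mathbb{R}^n\to\mathbb{R}$ is a solution of $L_*u=f$ in $\Omega$" means that $u$ is continuous and smooth enough for $L_*u(x)$ to be computed pointwise at every $x\in\Omega$, and $L_*u(x)=f(x)$ there. $C^\gamma$ denotes the usual Hölder space (here $\gamma\in(0,1)$). The right-hand side of the estimate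 is understood in $[0,+\infty]$. *)

theory Defs
  imports "HOL-Analysis.Analysis" "HOL-Probability.Essential_Supremum"
begin

text \<open>
  Throughout, \<open>e 1, \<dots>, e n\<close> enumerates the Euclidean basis of \<open>'a\<close> with \<open>n = DIM('a)\<close>, and
  \<open>N 1, \<dots>, N (m - 1)\<close> are the sizes of the groups of coordinates.  Points of \<open>R^N\<close>, for a group
  size \<open>N\<close>, are functions on \<open>{1..N}\<close>, integrated against the product of Lebesgue measures.
\<close>

definition group_end :: "(nat \<Rightarrow> nat) \<Rightarrow> nat \<Rightarrow> nat" where
  "group_end N i = (\<Sum>j = 1..i. N j)"

definition group_vec ::
  "(nat \<Rightarrow> 'a::euclidean_space) \<Rightarrow> (nat \<Rightarrow> nat) \<Rightarrow> nat \<Rightarrow> (nat \<Rightarrow> real) \<Rightarrow> 'a" where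
  "group_vec e N i y = (\<Sum>k = 1..N i. y k *\<^sub>R e (group_end N (i - 1) + k))"

definition frac_const :: "nat \<Rightarrow> real \<Rightarrow> real" where
  "frac_const N s =
     2 powr (2 * s - 1) * Gamma (s + real N / 2) / (pi powr (real N / 2) * \<bar>Gamma (- s)\<bar>)"

definition frac_integrand ::
  "(nat \<Rightarrow> 'a::euclidean_space) \<Rightarrow> (nat \<Rightarrow> nat) \<Rightarrow> nat \<Rightarrow> real \<Rightarrow> ('a \<Rightarrow> real) \<Rightarrow> 'a
    \<Rightarrow> (nat \<Rightarrow> real) \<Rightarrow> real" where
  "frac_integrand e N i s u x y =
     (2 * u x - u (x + group_vec e N i y) - u (x - group_vec e N i y))
       / norm (group_vec e N i y) powr (real (N i) + 2 * s)"

definition frac_laplacian ::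
  "(nat \<Rightarrow> 'a::euclidean_space) \<Rightarrow> (nat \<Rightarrow> nat) \<Rightarrow> nat \<Rightarrow> real \<Rightarrow> ('a \<Rightarrow> real) \<Rightarrow> 'a \<Rightarrow> real" where
  "frac_laplacian e N i s u x =
     frac_const (N i) s * (LINT y|Pi\<^sub>M {1..N i} (\<lambda>_. lborel). frac_integrand e N i s u x y)"

definition partial_deriv :: "'a::real_normed_vector \<Rightarrow> ('a \<Rightarrow> real) \<Rightarrow> 'a \<Rightarrow> real" where
  "partial_deriv v u x = deriv (\<lambda>t. u (x + t *\<^sub>R v)) 0"

definition twice_partially_differentiable_at ::
  "'a::real_normed_vector \<Rightarrow> ('a \<Rightarrow> real) \<Rightarrow> 'a \<Rightarrow> bool" where
  "twice_partially_differentiable_at v u x \<longleftrightarrow>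
     (\<forall>\<^sub>F t in nhds 0. (\<lambda>r. u (x + r *\<^sub>R v)) differentiable (at t)) \<and>
     (\<lambda>t. partial_deriv v u (x + t *\<^sub>R v)) differentiable (at 0)"

text \<open>The coefficients are \<open>a 1, \<dots>, a (m - 1)\<close> for the groups and \<open>b\<close> for the last variable.\<close>

definition aniso_op ::
  "(nat \<Rightarrow> 'a::euclidean_space) \<Rightarrow> nat \<Rightarrow> (nat \<Rightarrow> nat) \<Rightarrow> (nat \<Rightarrow> real) \<Rightarrow> real \<Rightarrow> real
    \<Rightarrow> ('a \<Rightarrow> real) \<Rightarrow> 'a \<Rightarrow> real" where
  "aniso_op e m N a b s u x =
     (\<Sum>i = 1..m - 1. a i * frac_laplacian e N i s u x)
       - b * partial_deriv (e DIM('a)) (partial_deriv (e DIM('a)) u) x"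

text \<open>
  The regularity required of a classical solution is only what gives each term of the operator a
  meaning at the point: absolute convergence of the integrals (the Bochner integral would otherwise
  be \<open>0\<close> by convention) and existence of the second derivative in the last variable.
\<close>

definition aniso_computable_at ::
  "(nat \<Rightarrow> 'a::euclidean_space) \<Rightarrow> nat \<Rightarrow> (nat \<Rightarrow> nat) \<Rightarrow> real \<Rightarrow> ('a \<Rightarrow> real) \<Rightarrow> 'a \<Rightarrow> bool" where
  "aniso_computable_at e m N s u x \<longleftrightarrow>
     (\<forall>i\<in>{1..m - 1}. integrable (Pi\<^sub>M {1..N i} (\<lambda>_. lborel)) (frac_integrand e N i s u x)) \<and>
     twice_partially_differentiable_at (e DIM('a)) u x"

definition classical_solution ::
  "(nat \<Rightarrow> 'a::euclidean_space) \<Rightarrow> nat \<Rightarrow> (nat \<Rightarrow> nat) \<Rightarrow> (nat \<Rightarrow> real) \<Rightarrow> real \<Rightarrow> real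
    \<Rightarrow> ('a \<Rightarrow> real) \<Rightarrow> ('a \<Rightarrow> real) \<Rightarrow> 'a set \<Rightarrow> bool" where
  "classical_solution e m N a b s f u \<Omega> \<longleftrightarrow>
     continuous_on UNIV u \<and>
     (\<forall>x\<in>\<Omega>. aniso_computable_at e m N s u x \<and> aniso_op e m N a b s u x = f x)"

definition unit_cylinder :: "(nat \<Rightarrow> 'a::euclidean_space) \<Rightarrow> 'a set" where
  "unit_cylinder e = {x. sqrt (\<Sum>k = 1..DIM('a) - 1. (x \<bullet> e k)\<^sup>2) < 1}"

definition Linfty_norm_on :: "'a::euclidean_space set \<Rightarrow> ('a \<Rightarrow> real) \<Rightarrow> ennreal" where
  "Linfty_norm_on A g = esssup (lebesgue_on A) (\<lambda>x. ennreal \<bar>g x\<bar>)"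

definition in_Linfty :: "('a::euclidean_space \<Rightarrow> real) \<Rightarrow> bool" where
  "in_Linfty g \<longleftrightarrow> g \<in> borel_measurable lebesgue \<and> Linfty_norm_on UNIV g < \<infinity>"

definition Holder_norm_on :: "real \<Rightarrow> 'a::euclidean_space set \<Rightarrow> ('a \<Rightarrow> real) \<Rightarrow> ennreal" where
  "Holder_norm_on \<gamma> A g =
     (SUP x\<in>A. ennreal \<bar>g x\<bar>) +
     (SUP x\<in>A. SUP y\<in>A - {x}. ennreal (\<bar>g x - g y\<bar> / dist x y powr \<gamma>))"

definition Lipschitz_along :: "'a::real_normed_vector \<Rightarrow> 'a set \<Rightarrow> ('a \<Rightarrow> real) \<Rightarrow> bool" where
  "Lipschitz_along v A g \<longleftrightarrow>
     (\<exists>L. \<forall>x t. x \<in> A \<longrightarrow> x + t *\<^sub>R v \<in> A \<longrightarrow> \<bar>g (x + t *\<^sub>R v) - g x\<bar> \<le> L * \<bar>t\<bar>)"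

end

theory Submission
  imports Defs
begin

text \<open>
  The Hoelder bound comes from the maximum principle for the doubled function
  \<open>u x - u y - A * (\<Sum>k. \<bar>x\<^sub>k - y\<^sub>k\<bar> powr \<gamma>)\<close>, localized near a point of the half ball.  Suppose it has a
  positive maximum, and let \<open>r\<close> be the size of a nonzero coordinate difference there.  The jumps at the
  two points are coupled: short ones are reflected in that coordinate, all others are parallel.
  Parallel jumps do not see the penalization, and by strict concavity of \<open>\<bar>z\<bar> powr \<gamma>\<close> the reflected ones
  make the difference of the two operators at least \<open>c * A * r powr (\<gamma> - 2 * s)\<close>, up to an error from
  the localization that is bounded by a multiple of the bound for \<open>u\<close>; for the last variable the
  exponent is \<open>\<gamma> - 2\<close>.  As \<open>\<gamma> \<le> 2 * s\<close> and \<open>\<gamma> < 1\<close>, this contradicts the equation once \<open>A\<close> is a large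
  multiple of the bounds for \<open>f\<close> and \<open>u\<close> (\<open>doubling_estimate\<close>).  The operator is evaluated on \<open>u\<close> itself,
  at the maximum point, so continuity and pointwise computability are the regularity that enters.

  The maximum point may belong to the null set where \<open>\<bar>f\<bar>\<close> exceeds its essential supremum \<open>M\<close>.  Therefore
  \<open>u\<close> is first corrected by arbitrarily small functions \<open>v\<close> of the first variables, called barriers,
  such that the nonlocal part of the operator, applied to \<open>v\<close>, is at least \<open>f - M - \<eta>\<close> at every
  point of a ball slightly larger than the half ball (\<open>barrier_above\<close>).  They exist for the following reasons.

  \<^item> \<open>f\<close> is Lipschitz in the last variable.  So it exceeds \<open>M\<close> on a whole vertical segment around each
    point where it exceeds \<open>M + \<eta>\<close>; such points lie in a null set that is a union of vertical lines,
    and \<open>f\<close> may be replaced by a function of the first variables.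

  \<^item> On a closed null cylinder where \<open>f\<close> is bounded, an approximate solution of \<open>v + NL v = g\<close> serves, where
    \<open>g\<close> is a bump with small mass.  The doubling argument gives a modulus of continuity for \<open>v\<close> that
    depends only on the bound for \<open>g\<close>, so small mass makes \<open>v\<close> uniformly small (\<open>barrier_on_null_set\<close>).

  \<^item> \<open>f\<close> is a pointwise limit of continuous functions, because the operator is a limit of truncated
    operators.  By Baire's theorem each closed set has a portion where \<open>f\<close> is almost constant, so that
    either \<open>f \<le> M + \<eta>\<close> there or the portion is a null set with bounded \<open>f\<close>.  Barriers off the closed set
    are glued along shells around it, so small near the set that the sum still has a finite operator
    on it (\<open>dominated_shells\<close>).  Hence no closed set of bad points remains
    (\<open>dominated_Baire_one\<close>).
\<close>

(* The index ranges {1..d} should not be rewritten to {Suc 0..d}. *)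
declare One_nat_def [simp del]

section \<open>The jump kernels\<close>

abbreviation coord_measure :: "nat \<Rightarrow> (nat \<Rightarrow> real) measure" where
  "coord_measure d \<equiv> Pi\<^sub>M {1..d} (\<lambda>_. lborel)"

abbreviation rad :: "nat \<Rightarrow> (nat \<Rightarrow> real) \<Rightarrow> real" where
  "rad d y \<equiv> L2_set y {1..d}"

text \<open>
  The exponent \<open>1 + s\<^sup>2\<close> lies strictly between \<open>2 * s\<close> and \<open>2\<close>.  Second differences of this order
  at the origin are integrable against the kernel of \<open>(-\<Delta>)\<^sup>s\<close>; they appear as products of a
  Lipschitz increment with an increment of Hoelder order \<open>s\<^sup>2\<close>, the order that interpolation between
  the orders \<open>s\<close> and \<open>0\<close> produces.
\<close>

definition jump_weight :: "nat \<Rightarrow> real \<Rightarrow> (nat \<Rightarrow> real) \<Rightarrow> real" where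
  "jump_weight d s y = min 1 (rad d y powr (1 + s\<^sup>2)) / rad d y powr (real d + 2 * s)"

lemma jump_weight_nonneg: "jump_weight d s y \<ge> 0"
  by (simp add: jump_weight_def)

lemma rad_measurable [measurable]: "rad d \<in> borel_measurable (coord_measure d)"
  unfolding L2_set_def by measurable

lemma jump_weight_measurable [measurable]: "jump_weight d s \<in> borel_measurable (coord_measure d)"
  unfolding jump_weight_def by measurable

lemma abs_le_rad: "k \<in> {1..d} \<Longrightarrow> \<bar>y k\<bar> \<le> rad d y"
  using member_le_L2_set[of "{1..d}" k "\<lambda>k. \<bar>y k\<bar>"] by (simp add: L2_set_def)

lemma emeasure_rad_le:
  assumes "t > 0"
  shows "emeasure (coord_measure d) {y \<in> space (coord_measure d). rad d y \<le> t} \<le> ennreal ((2 * t) ^ d)"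
proof -
  interpret product_sigma_finite "\<lambda>_::nat. lborel :: real measure" ..
  have "emeasure (coord_measure d) {y \<in> space (coord_measure d). rad d y \<le> t}
      \<le> emeasure (coord_measure d) (Pi\<^sub>E {1..d} (\<lambda>_. {-t..t}))"
  proof (rule emeasure_mono)
    show "{y \<in> space (coord_measure d). rad d y \<le> t} \<subseteq> Pi\<^sub>E {1..d} (\<lambda>_. {-t..t})"
    proof
      fix y assume "y \<in> {y \<in> space (coord_measure d). rad d y \<le> t}"
      then have y: "y \<in> extensional {1..d}" "rad d y \<le> t"
        by (auto simp: space_PiM PiE_def)
      have "\<bar>y k\<bar> \<le> t" if "k \<in> {1..d}" for k
        using abs_le_rad[OF that, of y] y by simp
      then have "y k \<in> {-t..t}" if "k \<in> {1..d}" for k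
        using that by (meson abs_le_D1 abs_le_D2 atLeastAtMost_iff minus_le_iff)
      then show "y \<in> Pi\<^sub>E {1..d} (\<lambda>_. {-t..t})"
        using y(1) by (intro PiE_I) (auto simp: extensional_def)
    qed
    show "Pi\<^sub>E {1..d} (\<lambda>_. {-t..t}) \<in> sets (coord_measure d)"
      by (rule sets_PiM_I_finite) auto
  qed
  also have "\<dots> = (\<Prod>k\<in>{1..d}. emeasure lborel {-t..t})"
    by (rule emeasure_PiM) auto
  also have "\<dots> = ennreal ((2 * t) ^ d)"
    using assms by (simp add: ennreal_power)
  finally show ?thesis .
qed

text \<open>
  Near the origin the weight is summed over the dyadic shells, where it is at most
  \<open>2 powr (\<alpha> * (j + 1))\<close> on a set of measure \<open>2 powr (d - d * j)\<close> with \<open>\<alpha> < d\<close> because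
  \<open>1 + s\<^sup>2 > 2 * s\<close>; at infinity the exponent \<open>2 * s > 0\<close> makes the dyadic sum converge.
\<close>

lemma integrable_jump_weight:
  assumes d: "d \<ge> 1" and s: "0 < s" "s < 1"
  shows "integrable (coord_measure d) (jump_weight d s)"
proof -
  define \<alpha> where "\<alpha> = real d + 2 * s - (1 + s\<^sup>2)"
  have "(1 - s)\<^sup>2 > 0" "(1 - s)\<^sup>2 < 1"
    using s by (simp_all add: power_less_one_iff)
  then have \<alpha>: "\<alpha> < real d" "\<alpha> > 0"
    using d by (auto simp: \<alpha>_def power2_eq_square algebra_simps)
  define c1 t1 c2 t2 :: "nat \<Rightarrow> real" where
    "c1 j = 2 powr (\<alpha> * (real j + 1))" and "t1 j = 2 powr (- real j)" and
    "c2 j = 2 powr (- (real d + 2 * s) * real j)" and "t2 j = 2 powr (real j + 1)" for j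
  define I :: "real \<Rightarrow> (nat \<Rightarrow> real) \<Rightarrow> ennreal" where
    "I t y = indicator {y \<in> space (coord_measure d). rad d y \<le> t} y" for t y
  have Im [measurable]: "I t \<in> borel_measurable (coord_measure d)" for t
    unfolding I_def by measurable
  have bound: "ennreal (jump_weight d s y) \<le> (\<Sum>j. ennreal (c1 j) * I (t1 j) y) + (\<Sum>j. ennreal (c2 j) * I (t2 j) y)"
    if y: "y \<in> space (coord_measure d)" for y
  proof -
    define r where "r = rad d y"
    consider "r = 0" | "0 < r" "r \<le> 1" | "r > 1"
      using L2_set_nonneg[of y "{1..d}"] unfolding r_def by linarith
    then show ?thesis
    proof cases
      case 1
      then show ?thesis unfolding jump_weight_def r_def by simp
    next
      case 2
      define j where "j = nat \<lfloor>log 2 (1 / r)\<rfloor>"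
      have "log 2 (1 / r) \<ge> 0" using 2 by (simp add: log_divide)
      then have j: "real j \<le> log 2 (1 / r)" "log 2 (1 / r) < real j + 1"
        unfolding j_def by linarith+
      then have rj: "r \<le> t1 j" "2 powr - (real j + 1) < r"
        using 2 by (auto simp: t1_def log_divide le_powr_iff powr_less_iff)
      have "jump_weight d s y = r powr (1 + s\<^sup>2) / r powr (real d + 2 * s)"
        using 2 powr_le1[of "1 + s\<^sup>2" r] unfolding jump_weight_def r_def[symmetric] by (simp add: min_def)
      also have "\<dots> = r powr (- \<alpha>)"
        by (simp add: \<alpha>_def powr_diff[symmetric])
      also have "\<dots> \<le> (2 powr - (real j + 1)) powr (- \<alpha>)"
        using rj 2 \<alpha> by (intro powr_mono2') auto
      also have "\<dots> = c1 j"
        by (simp add: c1_def powr_powr algebra_simps)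
      finally have "ennreal (jump_weight d s y) \<le> ennreal (c1 j) * I (t1 j) y"
        using rj y unfolding I_def r_def by (simp add: ennreal_leI)
      also have "\<dots> \<le> (\<Sum>j. ennreal (c1 j) * I (t1 j) y)"
        using sum_le_suminf[of "\<lambda>j. ennreal (c1 j) * I (t1 j) y" "{j}"] by simp
      finally show ?thesis
        by (simp add: add_increasing2)
    next
      case 3
      define j where "j = nat \<lfloor>log 2 r\<rfloor>"
      have "log 2 r \<ge> 0" using 3 by simp
      then have j: "real j \<le> log 2 r" "log 2 r < real j + 1"
        unfolding j_def by linarith+
      then have rj: "r \<le> t2 j" "2 powr (real j) \<le> r"
        using 3 by (auto simp: t2_def log_le_iff less_log_iff le_log_iff log_less_iff less_imp_le)
      have "jump_weight d s y = 1 / r powr (real d + 2 * s)"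
        using 3 s ge_one_powr_ge_zero[of r "1 + s\<^sup>2"]
        unfolding jump_weight_def r_def[symmetric] by (simp add: min_def)
      also have "\<dots> = r powr (- (real d + 2 * s))"
        by (simp only: powr_minus_divide)
      also have "\<dots> \<le> (2 powr (real j)) powr (- (real d + 2 * s))"
        using rj 3 s by (intro powr_mono2') auto
      also have "\<dots> = c2 j"
        by (simp add: c2_def powr_powr algebra_simps)
      finally have "ennreal (jump_weight d s y) \<le> ennreal (c2 j) * I (t2 j) y"
        using rj y unfolding I_def r_def by (simp add: ennreal_leI)
      also have "\<dots> \<le> (\<Sum>j. ennreal (c2 j) * I (t2 j) y)"
        using sum_le_suminf[of "\<lambda>j. ennreal (c2 j) * I (t2 j) y" "{j}"] by simp
      finally show ?thesis
        by (simp add: add_increasing)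
    qed
  qed
  have shell: "(\<integral>\<^sup>+y. (\<Sum>j. ennreal (c j) * I (t j) y) \<partial>coord_measure d) < \<infinity>"
    if c: "\<And>j. c j \<ge> 0" and t: "\<And>j. t j > 0" and
      geo: "\<And>j. c j * (2 * t j) ^ d = A * q ^ j" "0 \<le> q" "q < 1" for c t :: "nat \<Rightarrow> real" and A q
  proof -
    have "(\<integral>\<^sup>+y. (\<Sum>j. ennreal (c j) * I (t j) y) \<partial>coord_measure d)
        = (\<Sum>j. \<integral>\<^sup>+y. ennreal (c j) * I (t j) y \<partial>coord_measure d)"
      by (rule nn_integral_suminf) auto
    also have "\<dots> \<le> (\<Sum>j. ennreal (A * q ^ j))"
    proof (intro suminf_le summableI)
      fix j
      have "(\<integral>\<^sup>+y. ennreal (c j) * I (t j) y \<partial>coord_measure d)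
         = ennreal (c j) * emeasure (coord_measure d) {y \<in> space (coord_measure d). rad d y \<le> t j}"
        unfolding I_def by (subst nn_integral_cmult_indicator) auto
      also have "\<dots> \<le> ennreal (c j) * ennreal ((2 * t j) ^ d)"
        using emeasure_rad_le[OF t] by (intro mult_left_mono) auto
      also have "\<dots> = ennreal (A * q ^ j)"
        unfolding geo(1)[symmetric] using c t[of j] by (simp add: ennreal_mult[symmetric] less_imp_le)
      finally show "(\<integral>\<^sup>+y. ennreal (c j) * I (t j) y \<partial>coord_measure d) \<le> ennreal (A * q ^ j)" .
    qed
    also have "\<dots> < \<infinity>"
    proof -
      have "A * q ^ j \<ge> 0" for j
        unfolding geo(1)[of j, symmetric] using c[of j] t[of j] by (simp add: less_imp_le)
      then have "(\<Sum>j. ennreal (A * q ^ j)) = ennreal (\<Sum>j. A * q ^ j)"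
        using geo by (intro suminf_ennreal2 summable_mult summable_geometric) auto
      then show ?thesis by simp
    qed
    finally show ?thesis .
  qed
  have pw: "(2 * 2 powr x) ^ d = 2 powr (real d + real d * x)" for x :: real
    by (simp add: power_mult_distrib powr_add powr_realpow powr_powr powr_power mult.commute)
  have "(\<integral>\<^sup>+y. ennreal (jump_weight d s y) \<partial>coord_measure d)
      \<le> (\<integral>\<^sup>+y. (\<Sum>j. ennreal (c1 j) * I (t1 j) y) + (\<Sum>j. ennreal (c2 j) * I (t2 j) y) \<partial>coord_measure d)"
    by (intro nn_integral_mono bound)
  also have "\<dots> = (\<integral>\<^sup>+y. (\<Sum>j. ennreal (c1 j) * I (t1 j) y) \<partial>coord_measure d)
        + (\<integral>\<^sup>+y. (\<Sum>j. ennreal (c2 j) * I (t2 j) y) \<partial>coord_measure d)"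
    by (rule nn_integral_add) auto
  also have "\<dots> < \<infinity>"
  proof -
    have "c1 j * (2 * t1 j) ^ d = 2 powr (\<alpha> + real d) * (2 powr (\<alpha> - real d)) ^ j" for j
      unfolding c1_def t1_def pw by (simp add: powr_power powr_add[symmetric] algebra_simps)
    moreover have "2 powr (\<alpha> - real d) < 1"
      using \<alpha> by (simp add: powr_less_one)
    ultimately have "(\<integral>\<^sup>+y. (\<Sum>j. ennreal (c1 j) * I (t1 j) y) \<partial>coord_measure d) < \<infinity>"
      by (intro shell) (auto simp: c1_def t1_def)
    moreover have "c2 j * (2 * t2 j) ^ d = 2 powr (2 * real d) * (2 powr (- 2 * s)) ^ j" for j
      unfolding c2_def t2_def pw by (simp add: powr_power powr_add[symmetric] algebra_simps)
    moreover have "2 powr (- 2 * s) < 1"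
      using s by (simp add: powr_less_one)
    ultimately show ?thesis
      using shell[of c2 t2 "2 powr (2 * real d)" "2 powr (- 2 * s)"]
      by (auto simp: c2_def t2_def)
  qed
  finally show ?thesis
    by (intro integrableI_nonneg) (auto simp: jump_weight_nonneg)
qed

lemma lborel_distr_add: "distr lborel borel (\<lambda>z. z + h) = (lborel :: 'a::euclidean_space measure)"
proof -
  have "(\<lambda>z. z + h) = (+) h" by (auto simp: add.commute)
  then show ?thesis using lborel_distr_plus[of h] by simp
qed

lemma null_sets_lborel_shift:
  fixes c :: "'a::euclidean_space"
  assumes "Z \<in> null_sets lborel"
  shows "(\<lambda>x. x + c) -` Z \<in> null_sets lborel"
proof -
  have Z: "Z \<in> sets borel" using assms by (simp add: null_sets_def)
  have "emeasure lborel ((\<lambda>x. x + c) -` Z) = emeasure (distr lborel borel (\<lambda>z. z + c)) Z"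
    using Z by (subst emeasure_distr) auto
  also have "\<dots> = 0" using assms by (simp add: lborel_distr_add null_sets_def)
  finally show ?thesis
    using Z measurable_sets[of "\<lambda>x. x + c" borel borel Z] by (simp add: null_sets_def)
qed

lemma frac_const_pos:
  assumes "0 < s" "s < 1"
  shows "frac_const d s > 0"
proof -
  have "- s \<notin> \<int>\<^sub>\<le>\<^sub>0"
  proof
    assume "- s \<in> \<int>\<^sub>\<le>\<^sub>0"
    then obtain k :: int where "- s = of_int k" by (auto simp: nonpos_Ints_def)
    then have "- 1 < k" "k < 0" using assms by linarith+
    then show False by simp
  qed
  then have "Gamma (- s) \<noteq> 0"
    by (simp add: Gamma_eq_zero_iff)
  moreover have "Gamma (s + real d / 2) > 0"
    using assms by (intro Gamma_real_pos) auto
  ultimately show ?thesis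
    unfolding frac_const_def by (intro divide_pos_pos mult_pos_pos) auto
qed

lemma group_end_Suc: "i \<ge> 1 \<Longrightarrow> group_end N i = group_end N (i - 1) + N i"
  by (cases i) (auto simp: group_end_def)

lemma group_end_mono: "i \<le> j \<Longrightarrow> group_end N i \<le> group_end N j"
  unfolding group_end_def by (rule sum_mono2) auto

lemma group_index_exists:
  assumes "l \<in> {1..group_end N M}"
  shows "\<exists>i\<in>{1..M}. \<exists>k\<in>{1..N i}. l = group_end N (i - 1) + k"
  using assms
proof (induction M)
  case 0
  then show ?case by (simp add: group_end_def)
next
  case (Suc M)
  show ?case
  proof (cases "l \<le> group_end N M")
    case True
    with Suc obtain i k where "i \<in> {1..M}" "k \<in> {1..N i}" "l = group_end N (i - 1) + k"
      by auto
    then show ?thesis by (intro bexI[of _ i] bexI[of _ k]) auto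
  next
    case False
    then have "l - group_end N M \<in> {1..N (Suc M)}" "l = group_end N (Suc M - 1) + (l - group_end N M)"
      using Suc.prems group_end_Suc[of "Suc M" N] by auto
    then show ?thesis by (intro bexI[of _ "Suc M"] bexI[of _ "l - group_end N M"]) auto
  qed
qed

section \<open>Coordinates and the nonlocal part of the operator\<close>

locale anisotropic =
  fixes e :: "nat \<Rightarrow> 'a::euclidean_space" and m :: nat and N :: "nat \<Rightarrow> nat"
    and a :: "nat \<Rightarrow> real" and b s :: real
  assumes bij_e: "bij_betw e {1..DIM('a)} Basis"
    and N_pos: "\<And>i. i \<in> {1..m - 1} \<Longrightarrow> N i \<ge> 1"
    and sum_N: "(\<Sum>i = 1..m - 1. N i) = DIM('a) - 1"
    and s_pos: "0 < s" and s_less: "s < 1"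
    and a_pos: "\<And>i. i \<in> {1..m - 1} \<Longrightarrow> a i > 0"
    and b_pos: "b > 0"
begin

abbreviation en :: 'a where "en \<equiv> e DIM('a)"

abbreviation gv :: "nat \<Rightarrow> (nat \<Rightarrow> real) \<Rightarrow> 'a" where "gv \<equiv> group_vec e N"

abbreviation ix :: "nat \<Rightarrow> nat \<Rightarrow> nat" where "ix i k \<equiv> group_end N (i - 1) + k"

abbreviation cm :: "nat \<Rightarrow> (nat \<Rightarrow> real) measure" where "cm i \<equiv> coord_measure (N i)"

lemma e_Basis: "k \<in> {1..DIM('a)} \<Longrightarrow> e k \<in> Basis"
  using bij_e by (auto simp: bij_betw_def)

lemma e_inner:
  "j \<in> {1..DIM('a)} \<Longrightarrow> k \<in> {1..DIM('a)} \<Longrightarrow> e j \<bullet> e k = (if j = k then 1 else 0)"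
  using bij_e e_Basis by (auto simp: bij_betw_def inner_Basis dest: inj_onD)

lemma n_in: "DIM('a) \<in> {1..DIM('a)}"
  using DIM_positive[where 'a='a] by (simp add: Suc_leI One_nat_def)

lemma norm_en: "norm en = 1" and en_inner: "en \<bullet> en = 1"
  using e_Basis[OF n_in] by (auto simp: inner_Basis)

lemma ix_range:
  assumes "i \<in> {1..m - 1}" "k \<in> {1..N i}"
  shows "ix i k \<in> {1..DIM('a) - 1}"
proof -
  have "ix i k \<le> group_end N i"
    using assms by (auto simp: group_end_Suc)
  also have "\<dots> \<le> group_end N (m - 1)"
    using assms by (intro group_end_mono) auto
  also have "\<dots> = DIM('a) - 1"
    using sum_N by (simp add: group_end_def)
  finally show ?thesis using assms by auto
qed

lemma ix_range': "i \<in> {1..m - 1} \<Longrightarrow> k \<in> {1..N i} \<Longrightarrow> ix i k \<in> {1..DIM('a)}"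
  using ix_range by force

lemma ix_cover:
  assumes "l \<in> {1..DIM('a) - 1}"
  obtains i k where "i \<in> {1..m - 1}" "k \<in> {1..N i}" "l = ix i k"
proof -
  have "l \<in> {1..group_end N (m - 1)}"
    using assms sum_N by (simp add: group_end_def)
  from group_index_exists[OF this] show ?thesis using that by blast
qed

lemma gv_inner:
  assumes "i \<in> {1..m - 1}" "l \<in> {1..DIM('a)}"
  shows "gv i y \<bullet> e l = (\<Sum>k = 1..N i. if ix i k = l then y k else 0)"
  unfolding group_vec_def inner_sum_left
  using assms ix_range'[OF assms(1)] by (intro sum.cong) (auto simp: e_inner)

lemma gv_inner_ix:
  assumes "i \<in> {1..m - 1}" "k \<in> {1..N i}"
  shows "gv i y \<bullet> e (ix i k) = y k"
proof -
  have "gv i y \<bullet> e (ix i k) = (\<Sum>j = 1..N i. if j = k then y j else 0)"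
    unfolding gv_inner[OF assms(1) ix_range'[OF assms]] by (intro sum.cong) auto
  then show ?thesis using assms by simp
qed

lemma gv_inner_en: "i \<in> {1..m - 1} \<Longrightarrow> gv i y \<bullet> en = 0"
  using n_in ix_range by (subst gv_inner) (fastforce intro!: sum.neutral)+

lemma norm_gv:
  assumes "i \<in> {1..m - 1}"
  shows "norm (gv i y) = rad (N i) y"
proof -
  have "gv i y \<bullet> gv i y = (\<Sum>k = 1..N i. y k * (gv i y \<bullet> e (ix i k)))"
    by (subst (2) group_vec_def) (simp add: inner_sum_right)
  also have "\<dots> = (\<Sum>k = 1..N i. (y k)\<^sup>2)"
    using assms by (intro sum.cong) (auto simp: gv_inner_ix power2_eq_square)
  finally show ?thesis
    by (simp add: norm_eq_sqrt_inner L2_set_def)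
qed

lemma gv_flip:
  assumes "k \<in> {1..N i}"
  shows "gv i (y(k := - y k)) = gv i y - (2 * y k) *\<^sub>R e (ix i k)"
proof -
  have "gv i (y(k := - y k)) = (\<Sum>j = 1..N i. y j *\<^sub>R e (ix i j) - (if j = k then (2 * y k) *\<^sub>R e (ix i k) else 0))"
    unfolding group_vec_def by (intro sum.cong) (auto simp: scaleR_diff_left[symmetric])
  also have "\<dots> = gv i y - (\<Sum>j = 1..N i. if j = k then (2 * y k) *\<^sub>R e (ix i k) else 0)"
    by (simp add: sum_subtractf group_vec_def)
  also have "(\<Sum>j = 1..N i. if j = k then (2 * y k) *\<^sub>R e (ix i k) else 0) = (2 * y k) *\<^sub>R e (ix i k)"
    using assms by (subst sum.delta) auto
  finally show ?thesis .
qed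

lemma gv_measurable [measurable]: "gv i \<in> borel_measurable (cm i)"
  unfolding group_vec_def by measurable

lemma norm_le_sum_coord: "norm x \<le> (\<Sum>k = 1..DIM('a). \<bar>x \<bullet> e k\<bar>)"
  using norm_le_l1[of x] sum.reindex_bij_betw[OF bij_e, of "\<lambda>u. \<bar>x \<bullet> u\<bar>"] by simp

lemma norm_sq_coord: "(norm x)\<^sup>2 = (\<Sum>k = 1..DIM('a). (x \<bullet> e k)\<^sup>2)"
  using euclidean_inner[of x x] sum.reindex_bij_betw[OF bij_e, of "\<lambda>u. (x \<bullet> u)\<^sup>2"]
  unfolding power2_norm_eq_inner by (simp add: power2_eq_square)

lemma coord_le_norm: "k \<in> {1..DIM('a)} \<Longrightarrow> \<bar>x \<bullet> e k\<bar> \<le> norm x"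
  using Basis_le_norm[OF e_Basis] .

lemma eq_if_coords: "(\<And>k. k \<in> {1..DIM('a)} \<Longrightarrow> x \<bullet> e k = y \<bullet> e k) \<Longrightarrow> x = y"
  using norm_le_sum_coord[of "x - y"] by (simp add: inner_diff_left)

subsection \<open>Linearity and size of the nonlocal part\<close>

definition NL :: "('a \<Rightarrow> real) \<Rightarrow> 'a \<Rightarrow> real" where
  "NL v x = (\<Sum>i = 1..m - 1. a i * frac_laplacian e N i s v x)"

definition NL_computable :: "('a \<Rightarrow> real) \<Rightarrow> 'a \<Rightarrow> bool" where
  "NL_computable v x \<longleftrightarrow> (\<forall>i\<in>{1..m - 1}. integrable (cm i) (frac_integrand e N i s v x))"

text \<open>
  The operator applied to the extremal profile of second differences: this is the constant in every
  estimate of the nonlocal part.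
\<close>

definition NL_mass :: real where
  "NL_mass = (\<Sum>i = 1..m - 1. a i * (frac_const (N i) s * (LINT y|cm i. jump_weight (N i) s y)))"

definition second_diff :: "('a \<Rightarrow> real) \<Rightarrow> 'a \<Rightarrow> 'a \<Rightarrow> real" where
  "second_diff v x h = 2 * v x - v (x + h) - v (x - h)"

lemma frac_integrand_eq:
  "i \<in> {1..m - 1} \<Longrightarrow> frac_integrand e N i s v x y = second_diff v x (gv i y) / rad (N i) y powr (real (N i) + 2 * s)"
  by (simp add: frac_integrand_def second_diff_def norm_gv)

lemma NL_mass_nonneg: "NL_mass \<ge> 0"
  unfolding NL_mass_def
  by (intro sum_nonneg mult_nonneg_nonneg less_imp_le[OF a_pos] less_imp_le[OF frac_const_pos[OF s_pos s_less]]
      integral_nonneg_AE) (auto simp: jump_weight_nonneg)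

lemma frac_integrand_measurable:
  assumes "continuous_on UNIV v"
  shows "frac_integrand e N i s v x \<in> borel_measurable (cm i)"
proof -
  have [measurable]: "v \<in> borel_measurable borel"
    using assms by (rule borel_measurable_continuous_onI)
  show ?thesis unfolding frac_integrand_def by measurable
qed

text \<open>
  Absolute convergence and size of the nonlocal part follow from the second differences at the
  single point \<open>x\<close>.  Error terms are treated by applying this, one point at a time, to an auxiliary
  function whose definition may depend on \<open>x\<close>.
\<close>

lemma NL_small:
  assumes v: "continuous_on UNIV v"
    and bd: "\<And>h. \<bar>second_diff v x h\<bar> \<le> c * min 1 (norm h powr (1 + s\<^sup>2))"
  shows "NL_computable v x" "\<bar>NL v x\<bar> \<le> c * NL_mass"
proof -
  have le: "\<bar>frac_integrand e N i s v x y\<bar> \<le> c * jump_weight (N i) s y" if "i \<in> {1..m - 1}" for i y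
    using bd[of "gv i y"] that
    by (simp add: frac_integrand_eq jump_weight_def norm_gv abs_divide divide_right_mono)
  have w: "integrable (cm i) (jump_weight (N i) s)" if "i \<in> {1..m - 1}" for i
    using integrable_jump_weight[OF N_pos[OF that] s_pos s_less] .
  have int: "integrable (cm i) (frac_integrand e N i s v x)" if "i \<in> {1..m - 1}" for i
    by (rule Bochner_Integration.integrable_bound[OF integrable_mult_right[OF w[OF that], of c]])
      (use le[OF that] frac_integrand_measurable[OF v] in \<open>auto intro!: AE_I2 intro: order_trans[OF _ abs_ge_self]\<close>)
  then show "NL_computable v x" by (simp add: NL_computable_def)
  have "\<bar>LINT y|cm i. frac_integrand e N i s v x y\<bar> \<le> c * (LINT y|cm i. jump_weight (N i) s y)"
    if i: "i \<in> {1..m - 1}" for i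
  proof -
    have "\<bar>LINT y|cm i. frac_integrand e N i s v x y\<bar> \<le> (LINT y|cm i. \<bar>frac_integrand e N i s v x y\<bar>)"
      by (rule integral_abs_bound)
    also have "\<dots> \<le> (LINT y|cm i. c * jump_weight (N i) s y)"
      using int[OF i] w[OF i] le[OF i] by (intro integral_mono) auto
    finally show ?thesis by simp
  qed
  then have "\<bar>a i * frac_laplacian e N i s v x\<bar>
      \<le> a i * (frac_const (N i) s * (c * (LINT y|cm i. jump_weight (N i) s y)))" if "i \<in> {1..m - 1}" for i
    using that a_pos[OF that] frac_const_pos[OF s_pos s_less, of "N i"]
    by (simp add: frac_laplacian_def abs_mult mult_left_mono less_imp_le)
  then have "\<bar>NL v x\<bar> \<le> (\<Sum>i = 1..m - 1. a i * (frac_const (N i) s * (c * (LINT y|cm i. jump_weight (N i) s y))))"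
    unfolding NL_def by (intro order_trans[OF sum_abs] sum_mono) auto
  also have "\<dots> = c * NL_mass"
    by (simp add: NL_mass_def sum_distrib_left mult_ac)
  finally show "\<bar>NL v x\<bar> \<le> c * NL_mass" .
qed

lemma frac_integrand_add:
  "frac_integrand e N i s (\<lambda>x. v x + w x) x = (\<lambda>y. frac_integrand e N i s v x y + frac_integrand e N i s w x y)"
  by (rule ext) (simp add: frac_integrand_def add_divide_distrib[symmetric] algebra_simps)

lemma frac_integrand_cmult:
  "frac_integrand e N i s (\<lambda>x. c * v x) x = (\<lambda>y. c * frac_integrand e N i s v x y)"
  by (rule ext) (simp add: frac_integrand_def algebra_simps)

lemma frac_laplacian_add:
  assumes "integrable (cm i) (frac_integrand e N i s v x)" "integrable (cm i) (frac_integrand e N i s w x)"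
  shows "frac_laplacian e N i s (\<lambda>x. v x + w x) x = frac_laplacian e N i s v x + frac_laplacian e N i s w x"
  using assms by (simp add: frac_laplacian_def frac_integrand_add distrib_left)

lemma frac_laplacian_cmult: "frac_laplacian e N i s (\<lambda>x. c * v x) x = c * frac_laplacian e N i s v x"
  by (simp add: frac_laplacian_def frac_integrand_cmult)

lemma NL_add:
  assumes "NL_computable v x" "NL_computable w x"
  shows "NL_computable (\<lambda>x. v x + w x) x" "NL (\<lambda>x. v x + w x) x = NL v x + NL w x"
  using assms unfolding NL_computable_def NL_def
  by (auto simp: frac_integrand_add frac_laplacian_add sum.distrib[symmetric] distrib_left
      simp del: sum.distrib intro!: sum.cong)

lemma NL_cmult:
  assumes "NL_computable v x"
  shows "NL_computable (\<lambda>x. c * v x) x" "NL (\<lambda>x. c * v x) x = c * NL v x"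
  using assms unfolding NL_computable_def NL_def
  by (auto simp: frac_integrand_cmult frac_laplacian_cmult sum_distrib_left mult_ac intro!: sum.cong)

lemma NL_sum:
  assumes "finite J" "\<And>j. j \<in> J \<Longrightarrow> NL_computable (v j) x"
  shows "NL_computable (\<lambda>x. \<Sum>j\<in>J. v j x) x \<and> NL (\<lambda>x. \<Sum>j\<in>J. v j x) x = (\<Sum>j\<in>J. NL (v j) x)"
  using assms
proof (induction J rule: finite_induct)
  case empty
  then show ?case
    by (simp add: NL_computable_def NL_def frac_laplacian_def frac_integrand_def[abs_def])
next
  case (insert j J)
  then show ?case
    using NL_add[of "v j" x "\<lambda>x. \<Sum>j\<in>J. v j x"] by simp
qed

end

section \<open>Second differences\<close>

text \<open>
  By l'Hospital's rule.  In this form the local term of the operator is compared at a maximum point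
  exactly like a jump.
\<close>

lemma second_difference_tendsto:
  fixes u :: "'a::real_normed_vector \<Rightarrow> real"
  assumes "twice_partially_differentiable_at v u x"
  shows "((\<lambda>t. (u (x + t *\<^sub>R v) + u (x - t *\<^sub>R v) - 2 * u x) / t\<^sup>2)
           \<longlongrightarrow> partial_deriv v (partial_deriv v u) x) (at 0)"
proof -
  define \<phi> where "\<phi> t = u (x + t *\<^sub>R v)" for t
  define \<phi>' where "\<phi>' t = partial_deriv v u (x + t *\<^sub>R v)" for t
  have \<phi>': "\<phi>' t = deriv \<phi> t" for t
  proof -
    have "\<phi>' t = deriv (\<lambda>r. \<phi> (r + t)) 0"
      by (simp add: \<phi>'_def partial_deriv_def \<phi>_def algebra_simps)
    also have "\<dots> = deriv \<phi> t"
      unfolding deriv_def DERIV_shift[of \<phi> _ 0 t, symmetric] by simp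
    finally show ?thesis .
  qed
  have "\<forall>\<^sub>F t in nhds 0. (\<phi> has_real_derivative \<phi>' t) (at t)"
    using assms unfolding twice_partially_differentiable_at_def
    by (elim conjE eventually_mono)
      (simp add: \<phi>_def[symmetric] \<phi>' DERIV_deriv_iff_real_differentiable)
  then obtain \<delta> where \<delta>: "\<delta> > 0" and der: "\<And>t. \<bar>t\<bar> < \<delta> \<Longrightarrow> (\<phi> has_real_derivative \<phi>' t) (at t)"
    by (auto simp: eventually_nhds_metric dist_real_def)
  have "\<phi>' differentiable (at 0)"
    using assms by (simp add: twice_partially_differentiable_at_def \<phi>'_def[abs_def])
  then have der2: "(\<phi>' has_real_derivative partial_deriv v (partial_deriv v u) x) (at 0)"
    by (simp add: partial_deriv_def[of v "partial_deriv v u"] \<phi>'_def[abs_def, symmetric] DERIV_deriv_iff_real_differentiable)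
  define D where "D = partial_deriv v (partial_deriv v u) x"
  have lim: "((\<lambda>t. (\<phi>' t - \<phi>' 0) / t) \<longlongrightarrow> D) (at 0)"
    using der2 by (simp add: DERIV_def D_def)
  have "filterlim uminus (at 0) (at (0::real))"
    unfolding filterlim_at by (auto intro!: tendsto_eq_intros simp: eventually_at_filter)
  from filterlim_compose[OF lim this]
  have lim': "((\<lambda>t. (\<phi>' (- t) - \<phi>' 0) / (- t)) \<longlongrightarrow> D) (at 0)" .
  have "((\<lambda>t. ((\<phi>' t - \<phi>' 0) / t + (\<phi>' (- t) - \<phi>' 0) / (- t)) / 2) \<longlongrightarrow> (D + D) / 2) (at 0)"
    by (intro tendsto_intros lim lim') simp
  also have "(\<lambda>t. ((\<phi>' t - \<phi>' 0) / t + (\<phi>' (- t) - \<phi>' 0) / (- t)) / 2) = (\<lambda>t. (\<phi>' t - \<phi>' (- t)) / (2 * t))"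
    by (rule ext) (simp add: divide_simps)
  finally have quot: "((\<lambda>t. (\<phi>' t - \<phi>' (- t)) / (2 * t)) \<longlongrightarrow> D) (at 0)" by simp
  have ev: "\<forall>\<^sub>F t in at (0::real). \<bar>t\<bar> < \<delta>"
    using \<delta> by (auto simp: eventually_at dist_real_def)
  have cont: "isCont \<phi> 0"
    using der[of 0] \<delta> by (auto intro: DERIV_isCont)
  have "((\<lambda>t. (\<phi> t + \<phi> (- t) - 2 * \<phi> 0) / t\<^sup>2) \<longlongrightarrow> D) (at 0)"
  proof (rule lhopital[OF _ _ _ _ _ _ quot])
    have "((\<lambda>t. \<phi> (- t)) \<longlongrightarrow> \<phi> 0) (at 0)"
      using filterlim_compose[OF _ \<open>filterlim uminus (at 0) (at (0::real))\<close>] cont by (auto simp: isCont_def)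
    then show "((\<lambda>t. \<phi> t + \<phi> (- t) - 2 * \<phi> 0) \<longlongrightarrow> 0) (at 0)"
      using cont by (auto intro!: tendsto_eq_intros simp: isCont_def)
    show "((\<lambda>t::real. t\<^sup>2) \<longlongrightarrow> 0) (at 0)"
      by (auto intro!: tendsto_eq_intros)
    show "\<forall>\<^sub>F t in at (0::real). t\<^sup>2 \<noteq> 0" "\<forall>\<^sub>F t in at (0::real). 2 * t \<noteq> 0"
      by (auto simp: eventually_at_filter)
    show "\<forall>\<^sub>F t in at 0. ((\<lambda>t. \<phi> t + \<phi> (- t) - 2 * \<phi> 0) has_real_derivative \<phi>' t - \<phi>' (- t)) (at t)"
      using ev
    proof eventually_elim
      case (elim t)
      have "((\<lambda>t. \<phi> (- t)) has_real_derivative \<phi>' (- t) * (- 1)) (at t)"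
        by (rule DERIV_chain2[OF der]) (use elim in \<open>auto intro!: derivative_eq_intros\<close>)
      then show ?case
        by (auto intro!: derivative_eq_intros der elim)
    qed
    show "\<forall>\<^sub>F t in at 0. ((\<lambda>t::real. t\<^sup>2) has_real_derivative 2 * t) (at t)"
      by (intro always_eventually allI) (auto intro!: derivative_eq_intros)
  qed
  then show ?thesis
    by (simp add: \<phi>_def D_def)
qed

text \<open>
  The difference of the two sides vanishes to first order at \<open>t = 0\<close>, and it is convex because
  \<open>(1 - t) powr (\<gamma> - 2) \<ge> 1\<close>.
\<close>

lemma powr_second_difference_unit:
  fixes \<gamma> t :: real
  assumes "0 < \<gamma>" "\<gamma> < 1" "0 \<le> t" "t < 1"
  shows "\<gamma> * (1 - \<gamma>) / 2 * t\<^sup>2 \<le> 2 - (1 + t) powr \<gamma> - (1 - t) powr \<gamma>"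
proof -
  define c where "c = \<gamma> * (1 - \<gamma>) / 2"
  define F where "F t = 2 - (1 + t) powr \<gamma> - (1 - t) powr \<gamma> - c * t\<^sup>2" for t
  define F' where "F' t = - \<gamma> * (1 + t) powr (\<gamma> - 1) + \<gamma> * (1 - t) powr (\<gamma> - 1) - 2 * c * t" for t
  define F'' where "F'' t = \<gamma> * (1 - \<gamma>) * (1 + t) powr (\<gamma> - 2) + \<gamma> * (1 - \<gamma>) * (1 - t) powr (\<gamma> - 2) - 2 * c" for t
  have p1: "((\<lambda>x. (1 + x) powr p) has_real_derivative p * (1 + x) powr (p - 1)) (at x)" if "0 \<le> x" for p x :: real
    by (rule DERIV_cong[OF DERIV_fun_powr[where m = 1]]) (use that in \<open>auto intro!: derivative_eq_intros\<close>)
  have p2: "((\<lambda>x. (1 - x) powr p) has_real_derivative - p * (1 - x) powr (p - 1)) (at x)" if "x < 1" for p x :: real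
    by (rule DERIV_cong[OF DERIV_fun_powr[where m = "- 1"]]) (use that in \<open>auto intro!: derivative_eq_intros\<close>)
  have d1: "(F has_real_derivative F' x) (at x)" if "0 \<le> x" "x < 1" for x
    unfolding F_def F'_def using that by (auto intro!: derivative_eq_intros p1 p2)
  have e2: "\<gamma> - 1 - 1 = \<gamma> - 2" by simp
  have d2: "(F' has_real_derivative F'' x) (at x)" if "0 \<le> x" "x < 1" for x
    unfolding F'_def F''_def using that
    by (auto intro!: derivative_eq_intros p1[of x "\<gamma> - 1", unfolded e2] p2[of x "\<gamma> - 1", unfolded e2] simp: algebra_simps)
  have F'': "F'' x \<ge> 0" if "0 \<le> x" "x < 1" for x
  proof -
    have "1 powr (\<gamma> - 2) \<le> (1 - x) powr (\<gamma> - 2)"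
      using that assms by (intro powr_mono2') auto
    then have "\<gamma> * (1 - \<gamma>) * 1 \<le> \<gamma> * (1 - \<gamma>) * (1 - x) powr (\<gamma> - 2)"
      using assms by (intro mult_left_mono) auto
    moreover have "0 \<le> \<gamma> * (1 - \<gamma>) * (1 + x) powr (\<gamma> - 2)"
      using assms by simp
    ultimately show ?thesis by (simp add: F''_def c_def)
  qed
  have F': "F' 0 \<le> F' x" if "0 \<le> x" "x < 1" for x
    using that d2 F'' by (intro DERIV_nonneg_imp_nondecreasing[OF that(1)]) force
  have "F 0 \<le> F t"
  proof (rule DERIV_nonneg_imp_nondecreasing[OF assms(3)])
    fix x assume "0 \<le> x" "x \<le> t"
    then show "\<exists>y. (F has_real_derivative y) (at x) \<and> 0 \<le> y"
      using d1[of x] F'[of x] assms by (intro exI[of _ "F' x"]) (auto simp: F'_def)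
  qed
  then show ?thesis by (simp add: F_def c_def)
qed

lemma powr_second_difference:
  fixes \<gamma> r t :: real
  assumes "0 < \<gamma>" "\<gamma> < 1" "\<bar>t\<bar> < \<bar>r\<bar>"
  shows "\<gamma> * (1 - \<gamma>) / 2 * \<bar>r\<bar> powr (\<gamma> - 2) * t\<^sup>2 \<le> 2 * \<bar>r\<bar> powr \<gamma> - \<bar>r + t\<bar> powr \<gamma> - \<bar>r - t\<bar> powr \<gamma>"
proof -
  define \<tau> where "\<tau> = \<bar>t\<bar> / \<bar>r\<bar>"
  have r: "\<bar>r\<bar> > 0" and \<tau>: "0 \<le> \<tau>" "\<tau> < 1" using assms by (auto simp: \<tau>_def)
  have split: "\<bar>r + t\<bar> powr \<gamma> + \<bar>r - t\<bar> powr \<gamma> = \<bar>r\<bar> powr \<gamma> * ((1 + \<tau>) powr \<gamma> + (1 - \<tau>) powr \<gamma>)"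
  proof -
    have "\<bar>r + t\<bar> = \<bar>r\<bar> * (1 + \<tau>) \<and> \<bar>r - t\<bar> = \<bar>r\<bar> * (1 - \<tau>)
        \<or> \<bar>r - t\<bar> = \<bar>r\<bar> * (1 + \<tau>) \<and> \<bar>r + t\<bar> = \<bar>r\<bar> * (1 - \<tau>)"
      using r assms(3) by (auto simp: \<tau>_def field_simps abs_if)
    moreover have "(\<bar>r\<bar> * (1 + \<tau>)) powr \<gamma> = \<bar>r\<bar> powr \<gamma> * (1 + \<tau>) powr \<gamma>"
      "(\<bar>r\<bar> * (1 - \<tau>)) powr \<gamma> = \<bar>r\<bar> powr \<gamma> * (1 - \<tau>) powr \<gamma>"
      using r \<tau> by (auto intro: powr_mult)
    ultimately show ?thesis
      unfolding distrib_left by (elim disjE conjE) simp_all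
  qed
  have "\<bar>r\<bar> powr \<gamma> * (\<gamma> * (1 - \<gamma>) / 2 * \<tau>\<^sup>2) \<le> \<bar>r\<bar> powr \<gamma> * (2 - (1 + \<tau>) powr \<gamma> - (1 - \<tau>) powr \<gamma>)"
    using powr_second_difference_unit[OF assms(1,2) \<tau>] by (intro mult_left_mono) auto
  moreover have "\<bar>r\<bar> powr \<gamma> * \<tau>\<^sup>2 = \<bar>r\<bar> powr (\<gamma> - 2) * t\<^sup>2"
    using r by (simp add: \<tau>_def powr_diff power_divide)
  ultimately show ?thesis
    using split by (simp add: algebra_simps)
qed

section \<open>The gain of a reflected jump\<close>

text \<open>
  Two points are coupled by reflecting a single coordinate of the jump.  This preserves the product
  measure, and it suits a penalization that is a sum over the coordinates.
\<close>

abbreviation flip :: "nat \<Rightarrow> (nat \<Rightarrow> real) \<Rightarrow> nat \<Rightarrow> real" where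
  "flip k y \<equiv> y(k := - y k)"

lemma rad_flip: "rad d (flip k y) = rad d y"
  unfolding L2_set_def by (intro arg_cong[where f = sqrt] sum.cong) auto

lemma distr_flip:
  assumes k: "k \<in> {1..d}"
  shows "distr (coord_measure d) (coord_measure d) (flip k) = coord_measure d"
    and "flip k \<in> coord_measure d \<rightarrow>\<^sub>M coord_measure d"
proof -
  interpret product_sigma_finite "\<lambda>_::nat. lborel :: real measure" ..
  show meas: "flip k \<in> coord_measure d \<rightarrow>\<^sub>M coord_measure d"
  proof (rule measurable_PiM_single')
    show "(\<lambda>y. flip k y j) \<in> coord_measure d \<rightarrow>\<^sub>M lborel" if "j \<in> {1..d}" for j
      using that k by (cases "j = k") auto
    show "flip k \<in> space (coord_measure d) \<rightarrow> {1..d} \<rightarrow>\<^sub>E space lborel"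
      using k by (auto simp: space_PiM PiE_def extensional_def)
  qed
  show "distr (coord_measure d) (coord_measure d) (flip k) = coord_measure d"
  proof (rule PiM_eqI)
    fix A :: "nat \<Rightarrow> real set" assume A: "\<And>i. i \<in> {1..d} \<Longrightarrow> A i \<in> sets lborel"
    define A' where "A' = A(k := uminus -` A k)"
    have Ak: "uminus -` A k \<in> sets borel"
      using A[OF k] measurable_sets[of uminus borel borel "A k"] by simp
    have pre: "flip k -` Pi\<^sub>E {1..d} A \<inter> space (coord_measure d) = Pi\<^sub>E {1..d} A'"
    proof (intro equalityI subsetI)
      fix y assume "y \<in> flip k -` Pi\<^sub>E {1..d} A \<inter> space (coord_measure d)"
      then have y: "\<And>j. j \<in> {1..d} \<Longrightarrow> flip k y j \<in> A j" "y \<in> extensional {1..d}"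
        by (auto simp: space_PiM PiE_def Pi_def)
      have "y j \<in> A' j" if "j \<in> {1..d}" for j
        using y(1)[OF that] by (cases "j = k") (auto simp: A'_def)
      then show "y \<in> Pi\<^sub>E {1..d} A'" using y(2) by (auto simp: PiE_def)
    next
      fix y assume "y \<in> Pi\<^sub>E {1..d} A'"
      then have y: "\<And>j. j \<in> {1..d} \<Longrightarrow> y j \<in> A' j" "y \<in> extensional {1..d}"
        by (auto simp: PiE_def Pi_def)
      have "flip k y j \<in> A j" if "j \<in> {1..d}" for j
        using y(1)[OF that] by (cases "j = k") (auto simp: A'_def)
      then show "y \<in> flip k -` Pi\<^sub>E {1..d} A \<inter> space (coord_measure d)"
        using y(2) k by (auto simp: space_PiM PiE_def extensional_def)
    qed
    have "emeasure (distr (coord_measure d) (coord_measure d) (flip k)) (Pi\<^sub>E {1..d} A)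
        = emeasure (coord_measure d) (Pi\<^sub>E {1..d} A')"
      using A by (subst emeasure_distr[OF meas]) (auto simp: pre intro!: sets_PiM_I_finite)
    also have "\<dots> = (\<Prod>i\<in>{1..d}. emeasure lborel (A' i))"
      using A Ak by (intro emeasure_PiM) (auto simp: A'_def)
    also have "\<dots> = (\<Prod>i\<in>{1..d}. emeasure lborel (A i))"
    proof (rule prod.cong)
      fix i assume i: "i \<in> {1..d}"
      have "emeasure lborel (A k) = emeasure (distr lborel borel uminus) (A k)"
        by (simp add: lborel_distr_uminus)
      also have "\<dots> = emeasure lborel (uminus -` A k)"
        using A[OF k] by (subst emeasure_distr) auto
      finally show "emeasure lborel (A' i) = emeasure lborel (A i)"
        using i by (cases "i = k") (auto simp: A'_def)
    qed simp
    finally show "emeasure (distr (coord_measure d) (coord_measure d) (flip k)) (Pi\<^sub>E {1..d} A)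
        = (\<Prod>i\<in>{1..d}. emeasure lborel (A i))" .
  qed auto
qed

lemma integral_flip:
  assumes k: "k \<in> {1..d}" and f: "integrable (coord_measure d) f"
  shows "integrable (coord_measure d) (\<lambda>y. f (flip k y))"
    and "(LINT y|coord_measure d. f (flip k y)) = (LINT y|coord_measure d. f y :: real)"
proof -
  have fm: "f \<in> borel_measurable (coord_measure d)" using f by simp
  show "integrable (coord_measure d) (\<lambda>y. f (flip k y))"
    using integrable_distr_eq[OF distr_flip(2)[OF k] fm] f by (simp add: distr_flip(1)[OF k])
  show "(LINT y|coord_measure d. f (flip k y)) = (LINT y|coord_measure d. f y)"
    using integral_distr[OF distr_flip(2)[OF k] fm] by (simp add: distr_flip(1)[OF k])
qed

text \<open>
  Jumps shorter than \<open>r / 2\<close> are reflected: then a coordinate difference of size \<open>r\<close>, which changes by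
  \<open>2 * y k\<close>, keeps its sign and stays where \<open>\<bar>z\<bar> powr \<gamma>\<close> is smooth.
\<close>

definition gain_weight :: "nat \<Rightarrow> real \<Rightarrow> nat \<Rightarrow> real \<Rightarrow> (nat \<Rightarrow> real) \<Rightarrow> real" where
  "gain_weight d s k r y = (if rad d y < r / 2 then (y k)\<^sup>2 / rad d y powr (real d + 2 * s) else 0)"

definition box_const :: "nat \<Rightarrow> real" where
  "box_const d = 1 / (16 * (real d)\<^sup>2 * (12 * real d) ^ d)"

lemma box_const_pos: "d \<ge> 1 \<Longrightarrow> box_const d > 0"
  by (simp add: box_const_def)

lemma gain_weight_measurable: "k \<in> {1..d} \<Longrightarrow> gain_weight d s k r \<in> borel_measurable (coord_measure d)"
  unfolding gain_weight_def by measurable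

lemma gain_weight_integrable:
  assumes k: "k \<in> {1..d}" and s: "0 < s" "s < 1" and r: "r \<le> 1"
  shows "integrable (coord_measure d) (gain_weight d s k r)"
proof (rule Bochner_Integration.integrable_bound[OF integrable_jump_weight[of d s]])
  show "d \<ge> 1" "0 < s" "s < 1" using k s by auto
  show "gain_weight d s k r \<in> borel_measurable (coord_measure d)"
    by (rule gain_weight_measurable[OF k])
  show "AE y in coord_measure d. norm (gain_weight d s k r y) \<le> norm (jump_weight d s y)"
  proof (rule AE_I2)
    fix y
    show "norm (gain_weight d s k r y) \<le> norm (jump_weight d s y)"
    proof (cases "rad d y < r / 2 \<and> rad d y \<noteq> 0")
      case True
      then have R: "0 < rad d y" "rad d y < 1"
        using r L2_set_nonneg[of y "{1..d}"] by linarith+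
      have "s\<^sup>2 < 1" using s by (simp add: power_less_one_iff abs_square_less_1)
      have "(y k)\<^sup>2 \<le> (rad d y)\<^sup>2"
        using abs_le_rad[OF k, of y] by (simp add: abs_le_square_iff[symmetric])
      also have "\<dots> = rad d y powr 2"
        using R by (simp add: powr_numeral)
      also have "\<dots> \<le> rad d y powr (1 + s\<^sup>2)"
        using R \<open>s\<^sup>2 < 1\<close> by (intro powr_mono') auto
      finally have "(y k)\<^sup>2 \<le> rad d y powr (1 + s\<^sup>2)" .
      moreover have "rad d y powr (1 + s\<^sup>2) \<le> 1"
        using R by (intro powr_le1) auto
      ultimately show ?thesis
        using True by (simp add: gain_weight_def jump_weight_def divide_right_mono)
    next
      case False
      then show ?thesis by (auto simp: gain_weight_def)
    qed
  qed
qed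

text \<open>
  It suffices to integrate over the box where all coordinates lie between \<open>r / (4 * d)\<close> and
  \<open>r / (3 * d)\<close>; the power of \<open>r\<close> is dictated by scaling.
\<close>

lemma gain_weight_integral:
  assumes k: "k \<in> {1..d}" and s: "0 < s" "s < 1" and r: "0 < r" "r \<le> 1"
  shows "box_const d * r powr (2 - 2 * s) \<le> (LINT y|coord_measure d. gain_weight d s k r y)"
proof -
  interpret product_sigma_finite "\<lambda>_::nat. lborel :: real measure" ..
  have d: "d \<ge> 1" using k by auto
  define Q where "Q = Pi\<^sub>E {1..d} (\<lambda>_. {r / (4 * real d)..r / (3 * real d)})"
  have Q: "Q \<in> sets (coord_measure d)"
    unfolding Q_def by (rule sets_PiM_I_finite) auto
  have len: "r / (3 * real d) - r / (4 * real d) = r / (12 * real d)" "r / (4 * real d) \<le> r / (3 * real d)"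
    using d r by (auto simp: field_simps)
  have emQ: "emeasure (coord_measure d) Q = ennreal ((r / (12 * real d)) ^ d)"
  proof -
    have "emeasure (coord_measure d) Q = (\<Prod>k\<in>{1..d}. emeasure lborel {r / (4 * real d)..r / (3 * real d)})"
      unfolding Q_def by (rule emeasure_PiM) auto
    also have "\<dots> = ennreal ((r / (12 * real d)) ^ d)"
      using r by (simp add: len ennreal_power)
    finally show ?thesis .
  qed
  define w where "w = r\<^sup>2 / (16 * (real d)\<^sup>2) / r powr (real d + 2 * s)"
  have w: "w \<ge> 0" by (simp add: w_def)
  have le: "w * indicator Q y \<le> gain_weight d s k r y" for y
  proof (cases "y \<in> Q")
    case True
    then have y: "r / (4 * real d) \<le> y j" "y j \<le> r / (3 * real d)" if "j \<in> {1..d}" for j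
      using that by (auto simp: Q_def PiE_def Pi_def)
    have q: "0 < r / (4 * real d)" using r d by simp
    have "rad d y \<le> (\<Sum>j\<in>{1..d}. \<bar>y j\<bar>)" by (rule L2_set_le_sum_abs)
    also have "\<dots> \<le> (\<Sum>j\<in>{1..d}. r / (3 * real d))"
      using y q by (intro sum_mono) (fastforce simp: abs_if)
    also have "\<dots> = r / 3" using d by simp
    finally have R: "rad d y \<le> r / 3" .
    have Rp: "0 < rad d y" using abs_le_rad[OF k, of y] y[OF k] q by linarith
    have "(r / (4 * real d))\<^sup>2 \<le> (y k)\<^sup>2"
      using y(1)[OF k] q by (intro power_mono) auto
    moreover have "rad d y powr (real d + 2 * s) \<le> r powr (real d + 2 * s)"
      using R r s Rp by (intro powr_mono2) auto
    ultimately have "w \<le> (y k)\<^sup>2 / rad d y powr (real d + 2 * s)"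
      unfolding w_def using Rp by (intro frac_le) (auto simp: power_divide power_mult_distrib)
    then show ?thesis using True R r by (simp add: gain_weight_def)
  next
    case False
    then show ?thesis by (simp add: gain_weight_def)
  qed
  have "box_const d * r powr (2 - 2 * s) = w * (r / (12 * real d)) ^ d"
  proof -
    have "r powr (2 - 2 * s) = r\<^sup>2 * r ^ d / r powr (real d + 2 * s)"
      using r by (simp add: powr_diff powr_add powr_realpow powr_numeral)
    then show ?thesis
      by (simp add: box_const_def w_def power_divide mult_ac)
  qed
  also have "\<dots> = (LINT y|coord_measure d. w * indicator Q y)"
    using emQ r sets.sets_into_space[OF Q] by (simp add: measure_def Int_absorb2)
  also have "\<dots> \<le> (LINT y|coord_measure d. gain_weight d s k r y)"
    using le gain_weight_integrable[OF k s r(2)] Q emQ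
    by (intro integral_mono) (auto simp: integrable_indicator_iff)
  finally show ?thesis .
qed

context anisotropic
begin

section \<open>Doubling of variables\<close>

text \<open>
  If \<open>u\<close> violated the Hoelder bound, then \<open>u x - w y - A * coord_powr \<gamma> (x - y)\<close>, localized by a
  bounded well, would have a maximum off the diagonal.  There one coordinate difference is nonzero.  Coupling the jumps at the two points by a reflection in that coordinate, and moving
  them in parallel otherwise, bounds the difference of the two operators from below by a multiple
  of \<open>A\<close>, because \<open>\<bar>z\<bar> powr \<gamma>\<close> is strictly concave; from above it is bounded by the data.
\<close>

definition coord_powr :: "real \<Rightarrow> 'a \<Rightarrow> real" where
  "coord_powr \<gamma> z = (\<Sum>k = 1..DIM('a). \<bar>z \<bullet> e k\<bar> powr \<gamma>)"

text \<open>
  The smallest gain among the groups and the last variable.  The factor is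
  \<open>4 * (\<gamma> * (1 - \<gamma>) / 2)\<close>: the reflected coordinate changes by twice the jump, and
  \<open>powr_second_difference\<close> contributes the rest.
\<close>

definition coupling_gain :: "real \<Rightarrow> real" where
  "coupling_gain \<gamma> = Min (insert (2 * b * (\<gamma> * (1 - \<gamma>)))
     ((\<lambda>i. 2 * a i * frac_const (N i) s * (\<gamma> * (1 - \<gamma>)) * box_const (N i)) ` {1..m - 1}))"

lemma coupling_gain_pos: "0 < \<gamma> \<Longrightarrow> \<gamma> < 1 \<Longrightarrow> coupling_gain \<gamma> > 0"
  unfolding coupling_gain_def
  using b_pos a_pos frac_const_pos[OF s_pos s_less] box_const_pos[OF N_pos]
  by (subst Min_gr_iff) (auto intro!: mult_pos_pos)

lemma coupling_gain_le:
  "coupling_gain \<gamma> \<le> 2 * b * (\<gamma> * (1 - \<gamma>))"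
  "i \<in> {1..m - 1} \<Longrightarrow> coupling_gain \<gamma> \<le> 2 * a i * frac_const (N i) s * (\<gamma> * (1 - \<gamma>)) * box_const (N i)"
  unfolding coupling_gain_def by (rule Min_le, simp, simp, rule Min_le, simp, blast)

lemma aniso_op_eq: "aniso_op e m N a b s u x = NL u x - b * partial_deriv en (partial_deriv en u) x"
  by (simp add: aniso_op_def NL_def)

lemma aniso_computable_iff:
  "aniso_computable_at e m N s u x \<longleftrightarrow> NL_computable u x \<and> twice_partially_differentiable_at en u x"
  by (simp add: aniso_computable_at_def NL_computable_def)

lemma coord_powr_nonneg: "coord_powr \<gamma> z \<ge> 0"
  by (simp add: coord_powr_def sum_nonneg)

lemma coord_powr_ge: "k \<in> {1..DIM('a)} \<Longrightarrow> \<bar>z \<bullet> e k\<bar> powr \<gamma> \<le> coord_powr \<gamma> z"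
  unfolding coord_powr_def by (rule member_le_sum) auto

lemma coord_powr_0: "coord_powr \<gamma> 0 = 0"
  by (simp add: coord_powr_def)

lemma coord_powr_flip:
  assumes "k \<in> {1..DIM('a)}"
  shows "coord_powr \<gamma> (z + t *\<^sub>R e k) - coord_powr \<gamma> z = \<bar>z \<bullet> e k + t\<bar> powr \<gamma> - \<bar>z \<bullet> e k\<bar> powr \<gamma>"
proof -
  have "coord_powr \<gamma> (z + t *\<^sub>R e k) - coord_powr \<gamma> z
      = (\<Sum>j = 1..DIM('a). if j = k then \<bar>z \<bullet> e k + t\<bar> powr \<gamma> - \<bar>z \<bullet> e k\<bar> powr \<gamma> else 0)"
    unfolding coord_powr_def sum_subtractf[symmetric]
    using assms by (intro sum.cong) (auto simp: inner_add_left e_inner)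
  then show ?thesis using assms by simp
qed

text \<open>
  The well confines the maximum point.  It is semiconcave, which bounds its contribution to the
  operators from the right side, and it is constant from the distance \<open>1/16\<close> on.
\<close>

definition well :: "'a \<Rightarrow> 'a \<Rightarrow> real" where
  "well c x = min 1 (256 * (dist c x)\<^sup>2)"

lemma well_second_diff: "second_diff (well c) x h \<ge> - 512 * min 1 ((norm h)\<^sup>2)"
proof -
  have par: "(dist c (x + h))\<^sup>2 + (dist c (x - h))\<^sup>2 = 2 * (dist c x)\<^sup>2 + 2 * (norm h)\<^sup>2"
  proof -
    have "(norm (x - c + h))\<^sup>2 + (norm (x - c - h))\<^sup>2 = 2 * (norm (x - c))\<^sup>2 + 2 * (norm h)\<^sup>2"
      by (simp add: power2_norm_eq_inner inner_simps inner_commute)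
    moreover have d: "dist c z = norm (z - c)" for z
      by (simp add: dist_norm norm_minus_commute)
    moreover have e: "x + h - c = x - c + h" "x - h - c = x - c - h" by simp_all
    ultimately show ?thesis unfolding d e by blast
  qed
  have "- 512 * min 1 r \<le> 2 * min 1 (256 * q) - min 1 (256 * p1) - min 1 (256 * p2)"
    if "p1 + p2 = 2 * q + 2 * r" "0 \<le> p1" "0 \<le> p2" "0 \<le> q" "0 \<le> r" for p1 p2 q r :: real
    using that by (auto simp: min_def)
  from this[OF par] show ?thesis
    by (simp add: second_diff_def well_def)
qed

text \<open>
  At a maximum point the increments of \<open>u\<close> and \<open>w\<close> along any two displacements \<open>h\<close> and \<open>h'\<close> can be
  compared; the penalization sees only \<open>h - h'\<close>.
\<close>

lemma coupled_second_diff: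
  assumes max: "\<And>x' y'. u x' - w y' - A * coord_powr \<gamma> (x' - y') - 2 * S * well c x'
        \<le> u x - w y - A * coord_powr \<gamma> (x - y) - 2 * S * well c x" and S: "S > 0"
  shows "second_diff u x h - second_diff w y h'
     \<ge> A * second_diff (coord_powr \<gamma>) (x - y) (h - h') - 1024 * S * min 1 ((norm h)\<^sup>2)"
proof -
  have "2 * S * second_diff (well c) x h \<ge> 2 * S * (- 512 * min 1 ((norm h)\<^sup>2))"
    using S well_second_diff[where c = c and x = x and h = h] by (intro mult_left_mono) auto
  moreover have "x + h - (y + h') = x - y + (h - h')" "x - h - (y - h') = x - y - (h - h')"
    by simp_all
  ultimately show ?thesis
    using max[of "x + h" "y + h'"] max[of "x - h" "y - h'"]
    unfolding second_diff_def by (simp only:) (simp add: algebra_simps)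
qed

lemma flip_second_diff:
  assumes k: "k \<in> {1..DIM('a)}" and \<gamma>: "0 < \<gamma>" "\<gamma> < 1" and t: "\<bar>t\<bar> < \<bar>z \<bullet> e k\<bar>"
  shows "second_diff (coord_powr \<gamma>) z (t *\<^sub>R e k) \<ge> \<gamma> * (1 - \<gamma>) / 2 * \<bar>z \<bullet> e k\<bar> powr (\<gamma> - 2) * t\<^sup>2"
  using powr_second_difference[OF \<gamma> t] coord_powr_flip[OF k, of \<gamma> z t] coord_powr_flip[OF k, of \<gamma> z "- t"]
  by (simp add: second_diff_def)

text \<open>
  The sign \<open>\<sigma>\<close> lets the two points move in parallel or in opposite directions.
\<close>

lemma partial_deriv2_ge:
  assumes u: "twice_partially_differentiable_at en u x" and w: "twice_partially_differentiable_at en w y"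
    and t0: "t0 > 0" and \<sigma>: "\<bar>\<sigma>\<bar> = 1"
    and ge: "\<And>t. 0 < \<bar>t\<bar> \<Longrightarrow> \<bar>t\<bar> < t0 \<Longrightarrow> second_diff u x (t *\<^sub>R en) - second_diff w y ((\<sigma> * t) *\<^sub>R en) \<ge> E * t\<^sup>2"
  shows "partial_deriv en (partial_deriv en w) y - partial_deriv en (partial_deriv en u) x \<ge> E"
proof -
  have eq: "second_diff w y ((\<sigma> * t) *\<^sub>R en) = second_diff w y (t *\<^sub>R en)" for t
    using \<sigma> by (auto simp: second_diff_def abs_if split: if_splits)
  have "((\<lambda>t. (w (y + t *\<^sub>R en) + w (y - t *\<^sub>R en) - 2 * w y) / t\<^sup>2
      - (u (x + t *\<^sub>R en) + u (x - t *\<^sub>R en) - 2 * u x) / t\<^sup>2)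
     \<longlongrightarrow> partial_deriv en (partial_deriv en w) y - partial_deriv en (partial_deriv en u) x) (at 0)"
    by (intro tendsto_diff second_difference_tendsto u w)
  moreover have "\<forall>\<^sub>F t in at 0. E \<le> (w (y + t *\<^sub>R en) + w (y - t *\<^sub>R en) - 2 * w y) / t\<^sup>2
      - (u (x + t *\<^sub>R en) + u (x - t *\<^sub>R en) - 2 * u x) / t\<^sup>2"
    unfolding eventually_at
  proof (intro exI[of _ t0] conjI ballI impI t0)
    fix t :: real assume "t \<noteq> 0 \<and> dist t 0 < t0"
    then have t: "0 < \<bar>t\<bar>" "\<bar>t\<bar> < t0" "t\<^sup>2 > 0" by auto
    have "E * t\<^sup>2 \<le> second_diff u x (t *\<^sub>R en) - second_diff w y (t *\<^sub>R en)"
      using ge[OF t(1,2)] by (simp add: eq)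
    then have "E \<le> (second_diff u x (t *\<^sub>R en) - second_diff w y (t *\<^sub>R en)) / t\<^sup>2"
      using t by (simp add: pos_le_divide_eq)
    also have "\<dots> = (w (y + t *\<^sub>R en) + w (y - t *\<^sub>R en) - 2 * w y) / t\<^sup>2
      - (u (x + t *\<^sub>R en) + u (x - t *\<^sub>R en) - 2 * u x) / t\<^sup>2"
      by (simp add: second_diff_def diff_divide_distrib[symmetric] algebra_simps)
    finally show "E \<le> (w (y + t *\<^sub>R en) + w (y - t *\<^sub>R en) - 2 * w y) / t\<^sup>2
      - (u (x + t *\<^sub>R en) + u (x - t *\<^sub>R en) - 2 * u x) / t\<^sup>2" .
  qed
  ultimately show ?thesis
    by (intro tendsto_lowerbound[of _ _ "at 0"]) auto
qed

lemma min_sq_le: "0 \<le> r \<Longrightarrow> min 1 (r\<^sup>2) \<le> min 1 (r powr (1 + s\<^sup>2))"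
proof (cases "r = 0 \<or> r \<ge> 1")
  case True
  then show "0 \<le> r \<Longrightarrow> ?thesis" by (auto simp: min_def ge_one_powr_ge_zero)
next
  case False
  assume "0 \<le> r"
  have "s\<^sup>2 < 1" using s_pos s_less by (simp add: power_less_one_iff)
  then have "r powr 2 \<le> r powr (1 + s\<^sup>2)"
    using False \<open>0 \<le> r\<close> by (intro powr_mono') auto
  then show ?thesis using \<open>0 \<le> r\<close> False by (auto simp: powr_numeral min_def)
qed

lemma jump_weight_ge_sq:
  "min 1 ((rad d y)\<^sup>2) / rad d y powr (real d + 2 * s) \<le> jump_weight d s y"
  unfolding jump_weight_def using min_sq_le[of "rad d y"] by (intro divide_right_mono) auto

lemma jump_weight_integrable: "i \<in> {1..m - 1} \<Longrightarrow> integrable (cm i) (jump_weight (N i) s)"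
  using integrable_jump_weight[OF N_pos s_pos s_less] .

text \<open>
  In the integral at \<open>y\<close> the short jumps are replaced by their reflections, which does not change its
  value; afterwards the two integrands are compared jump by jump.
\<close>

lemma frac_laplacian_reflect:
  assumes i: "i \<in> {1..m - 1}" and k: "k \<in> {1..N i}" and r: "r \<le> 1"
    and u: "integrable (cm i) (frac_integrand e N i s u x)"
    and w: "integrable (cm i) (frac_integrand e N i s w y)"
    and sync: "\<And>h. second_diff u x h - second_diff w y h \<ge> - D * min 1 ((norm h)\<^sup>2)" and D: "D \<ge> 0"
    and refl: "\<And>\<eta>. rad (N i) \<eta> < r / 2 \<Longrightarrow> second_diff u x (gv i \<eta>) - second_diff w y (gv i (flip k \<eta>))
        \<ge> E * (\<eta> k)\<^sup>2 - D * min 1 ((rad (N i) \<eta>)\<^sup>2)"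
  shows "frac_laplacian e N i s u x - frac_laplacian e N i s w y
     \<ge> frac_const (N i) s * (E * (LINT \<eta>|cm i. gain_weight (N i) s k r \<eta>) - D * (LINT \<eta>|cm i. jump_weight (N i) s \<eta>))"
proof -
  define Iu where "Iu = frac_integrand e N i s u x"
  define Iw where "Iw = frac_integrand e N i s w y"
  define A where "A \<eta> = (if rad (N i) \<eta> < r / 2 then Iw \<eta> else 0)" for \<eta>
  define B where "B \<eta> = (if rad (N i) \<eta> < r / 2 then 0 else Iw \<eta>)" for \<eta>
  have Iu: "integrable (cm i) Iu" and Iw: "integrable (cm i) Iw"
    using u w by (simp_all add: Iu_def Iw_def)
  have [measurable]: "Iw \<in> borel_measurable (cm i)" using Iw by simp
  have A: "integrable (cm i) A" and B: "integrable (cm i) B"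
    by (rule Bochner_Integration.integrable_bound[OF Iw]; simp add: A_def[abs_def] B_def[abs_def])+
  note Af = integral_flip[OF k A]
  have "(LINT \<eta>|cm i. Iw \<eta>) = (LINT \<eta>|cm i. A \<eta> + B \<eta>)"
    by (intro Bochner_Integration.integral_cong) (auto simp: A_def B_def)
  also have "\<dots> = (LINT \<eta>|cm i. A (flip k \<eta>) + B \<eta>)"
    using A B Af by simp
  finally have eq: "(LINT \<eta>|cm i. Iw \<eta>) = (LINT \<eta>|cm i. A (flip k \<eta>) + B \<eta>)" .
  have pw: "E * gain_weight (N i) s k r \<eta> - D * jump_weight (N i) s \<eta> \<le> Iu \<eta> - (A (flip k \<eta>) + B \<eta>)" for \<eta>
  proof -
    define R where "R = rad (N i) \<eta> powr (real (N i) + 2 * s)"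
    have R: "R \<ge> 0" by (simp add: R_def)
    have "D * (min 1 ((rad (N i) \<eta>)\<^sup>2) / R) \<le> D * jump_weight (N i) s \<eta>"
      unfolding R_def using D jump_weight_ge_sq by (intro mult_left_mono)
    moreover have "E * gain_weight (N i) s k r \<eta> - D * (min 1 ((rad (N i) \<eta>)\<^sup>2) / R) \<le> Iu \<eta> - (A (flip k \<eta>) + B \<eta>)"
    proof (cases "rad (N i) \<eta> < r / 2")
      case True
      have "(E * (\<eta> k)\<^sup>2 - D * min 1 ((rad (N i) \<eta>)\<^sup>2)) / R
          \<le> (second_diff u x (gv i \<eta>) - second_diff w y (gv i (flip k \<eta>))) / R"
        using refl[OF True] R by (intro divide_right_mono) auto
      then show ?thesis
        using True i unfolding Iu_def A_def B_def Iw_def gain_weight_def frac_integrand_eq[OF i] rad_flip R_def[symmetric]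
        by (simp add: diff_divide_distrib)
    next
      case False
      have "(- D * min 1 ((rad (N i) \<eta>)\<^sup>2)) / R
          \<le> (second_diff u x (gv i \<eta>) - second_diff w y (gv i \<eta>)) / R"
        using sync[of "gv i \<eta>"] R by (intro divide_right_mono) (auto simp: norm_gv[OF i])
      then show ?thesis
        using False i unfolding Iu_def A_def B_def Iw_def gain_weight_def frac_integrand_eq[OF i] rad_flip R_def[symmetric]
        by (simp add: diff_divide_distrib)
    qed
    ultimately show ?thesis by linarith
  qed
  have g: "integrable (cm i) (gain_weight (N i) s k r)"
    by (rule gain_weight_integrable[OF k s_pos s_less r])
  have "E * (LINT \<eta>|cm i. gain_weight (N i) s k r \<eta>) - D * (LINT \<eta>|cm i. jump_weight (N i) s \<eta>)
     = (LINT \<eta>|cm i. E * gain_weight (N i) s k r \<eta> - D * jump_weight (N i) s \<eta>)"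
    using g jump_weight_integrable[OF i] by simp
  also have "\<dots> \<le> (LINT \<eta>|cm i. Iu \<eta> - (A (flip k \<eta>) + B \<eta>))"
    using g jump_weight_integrable[OF i] Iu Af B pw by (intro integral_mono) auto
  also have "\<dots> = (LINT \<eta>|cm i. Iu \<eta>) - (LINT \<eta>|cm i. Iw \<eta>)"
    unfolding eq using Iu Af B by (intro Bochner_Integration.integral_diff) auto
  finally have "frac_const (N i) s * (E * (LINT \<eta>|cm i. gain_weight (N i) s k r \<eta>) - D * (LINT \<eta>|cm i. jump_weight (N i) s \<eta>))
      \<le> frac_const (N i) s * ((LINT \<eta>|cm i. Iu \<eta>) - (LINT \<eta>|cm i. Iw \<eta>))"
    using frac_const_pos[OF s_pos s_less, of "N i"] by (intro mult_left_mono) auto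
  then show ?thesis
    by (simp add: frac_laplacian_def Iu_def Iw_def right_diff_distrib)
qed

lemma frac_laplacian_sync:
  assumes i: "i \<in> {1..m - 1}"
    and u: "integrable (cm i) (frac_integrand e N i s u x)"
    and w: "integrable (cm i) (frac_integrand e N i s w y)"
    and sync: "\<And>h. second_diff u x h - second_diff w y h \<ge> - D * min 1 ((norm h)\<^sup>2)" and D: "D \<ge> 0"
  shows "frac_laplacian e N i s u x - frac_laplacian e N i s w y
     \<ge> - D * (frac_const (N i) s * (LINT \<eta>|cm i. jump_weight (N i) s \<eta>))"
proof -
  have "1 \<in> {1..N i}" using N_pos[OF i] by simp
  moreover have "\<not> rad (N i) \<eta> < 0 / 2" for \<eta> by (simp add: not_less)
  ultimately show ?thesis
    using frac_laplacian_reflect[OF i _ _ u w sync D, of 1 0 0] by (simp add: mult_ac)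
qed

text \<open>
  Two functions \<open>u\<close> and \<open>w\<close> are allowed, one with an upper and one with a lower bound on the operator,
  since a solution will be replaced by two different corrections of it.  The gain is
  \<open>A * r powr (\<gamma> - 2 * s)\<close> up to a constant, with \<open>r \<le> 1\<close> the size of a nonzero coordinate difference;
  the hypothesis \<open>\<gamma> \<le> 2 * s\<close> keeps it of order \<open>A\<close>.
\<close>

lemma doubling_estimate:
  assumes \<gamma>: "0 < \<gamma>" "\<gamma> < 1" "\<gamma> \<le> 2 * s" and S: "S > 0" and \<tau>: "\<tau> \<ge> 0"
    and cu: "continuous_on UNIV u" and cw: "continuous_on UNIV w"
    and Su: "\<And>x. \<bar>u x\<bar> \<le> S" and Sw: "\<And>x. \<bar>w x\<bar> \<le> S"
    and u: "\<And>x. dist c x \<le> 1/8 \<Longrightarrow> aniso_computable_at e m N s u x \<and> aniso_op e m N a b s u x \<le> K"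
    and w: "\<And>x. dist c x \<le> 1/8 \<Longrightarrow> aniso_computable_at e m N s w x \<and> - K \<le> aniso_op e m N a b s w x"
    and close: "\<And>x. u x - w x \<le> \<tau>"
    and A1: "2 * K + 1024 * S * (NL_mass + b) < A * coupling_gain \<gamma>"
    and A2: "2 * S \<le> A * (1 / (16 * DIM('a))) powr \<gamma>"
  shows "u c - w y \<le> A * coord_powr \<gamma> (c - y) + \<tau>"
proof (rule ccontr)
  assume neg: "\<not> ?thesis"
  define n where "n = DIM('a)"
  have n: "n \<ge> 1" using n_in by (simp add: n_def)
  have Ap: "A > 0"
  proof -
    have "0 < A * (1 / (16 * DIM('a))) powr \<gamma>" using A2 S by linarith
    then show ?thesis by (simp add: zero_less_mult_iff)
  qed
  define \<Phi> where "\<Phi> x y = u x - w y - A * coord_powr \<gamma> (x - y) - 2 * S * well c x" for x y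
  have \<Phi>y: "\<Phi> c y > \<tau>"
    using neg by (simp add: \<Phi>_def well_def)
  \<comment> \<open>The well confines \<open>x\<close>, and a large \<open>A\<close> forces \<open>y\<close> to be close to \<open>x\<close>.\<close>
  have far: "dist c x \<le> 1/16 \<and> dist c y \<le> 1/8" if "\<Phi> x y > \<tau>" for x y
  proof -
    have "u x - w y \<le> 2 * S" using Su[of x] Sw[of y] by linarith
    then have lt: "A * coord_powr \<gamma> (x - y) + 2 * S * well c x < 2 * S"
      using that \<tau> by (simp add: \<Phi>_def)
    have "0 \<le> A * coord_powr \<gamma> (x - y)" using Ap coord_powr_nonneg by simp
    then have "2 * S * well c x < 2 * S * 1" using lt by simp
    then have "well c x < 1" using S by (simp only: mult_less_cancel_left_pos)
    then have "256 * (dist c x)\<^sup>2 < 1" by (simp add: well_def min_def split: if_splits)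
    then have "(dist c x)\<^sup>2 < (1/16)\<^sup>2" by (simp add: power2_eq_square)
    then have dx: "dist c x < 1/16" by (rule power2_less_imp_less) simp
    have "0 \<le> 2 * S * well c x" using S by (simp add: well_def)
    then have lt2: "A * coord_powr \<gamma> (x - y) < A * (1 / (16 * DIM('a))) powr \<gamma>"
      using lt A2 by linarith
    have "\<bar>(x - y) \<bullet> e k\<bar> \<le> 1 / (16 * real n)" if k: "k \<in> {1..n}" for k
    proof (rule ccontr)
      assume "\<not> ?thesis"
      then have "(1 / (16 * real n)) powr \<gamma> \<le> \<bar>(x - y) \<bullet> e k\<bar> powr \<gamma>"
        using \<gamma> by (intro powr_mono2) auto
      also have "\<dots> \<le> coord_powr \<gamma> (x - y)"
        using k by (intro coord_powr_ge) (simp add: n_def)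
      finally show False using lt2 Ap by (simp add: n_def)
    qed
    then have "(\<Sum>k = 1..n. \<bar>(x - y) \<bullet> e k\<bar>) \<le> (\<Sum>k = 1..n. 1 / (16 * real n))"
      by (intro sum_mono) auto
    then have "norm (x - y) \<le> 1/16"
      using norm_le_sum_coord[of "x - y"] n by (simp add: n_def)
    then have "dist x y \<le> 1/16" by (simp add: dist_norm)
    then show ?thesis using dx dist_triangle[of c y x] by linarith
  qed
  have "\<exists>p\<in>cball c (1/16) \<times> cball c (1/8). \<forall>q\<in>cball c (1/16) \<times> cball c (1/8). \<Phi> (fst q) (snd q) \<le> \<Phi> (fst p) (snd p)"
  proof (rule continuous_attains_sup)
    have "continuous_on UNIV (\<lambda>q. \<Phi> (fst q) (snd q))"
      unfolding \<Phi>_def coord_powr_def well_def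
      by (intro continuous_intros continuous_on_compose2[OF cu] continuous_on_compose2[OF cw] continuous_on_powr')
        (use \<gamma> in auto)
    then show "continuous_on (cball c (1/16) \<times> cball c (1/8)) (\<lambda>q. \<Phi> (fst q) (snd q))"
      by (rule continuous_on_subset) auto
  qed (auto intro!: compact_Times)
  then obtain p where p: "\<forall>q\<in>cball c (1/16) \<times> cball c (1/8). \<Phi> (fst q) (snd q) \<le> \<Phi> (fst p) (snd p)"
    by blast
  define x0 y0 where "x0 = fst p" and "y0 = snd p"
  have xy0: "\<Phi> x y \<le> \<Phi> x0 y0" if "dist c x \<le> 1/16" "dist c y \<le> 1/8" for x y
    using p[rule_format, of "(x, y)"] that by (simp add: x0_def y0_def)
  have \<Phi>0: "\<Phi> x0 y0 > \<tau>"
    using xy0[of c y] far[OF \<Phi>y] \<Phi>y by auto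
  \<comment> \<open>The jumps leave the compact set, so the maximum has to be global.\<close>
  have max: "\<Phi> x y \<le> \<Phi> x0 y0" for x y
    using xy0[of x y] far[of x y] \<Phi>0 by linarith
  have d0: "dist c x0 \<le> 1/8" "dist c y0 \<le> 1/8"
    using far[OF \<Phi>0] by auto
  define z where "z = x0 - y0"
  have "z \<noteq> 0"
  proof
    assume "z = 0"
    then have "x0 = y0" by (simp add: z_def)
    moreover have "0 \<le> 2 * S * well c x0" using S by (simp add: well_def)
    ultimately show False using \<Phi>0 close[of x0] by (simp add: \<Phi>_def coord_powr_0)
  qed
  then obtain l where l: "l \<in> {1..n}" "z \<bullet> e l \<noteq> 0"
    using eq_if_coords[of z 0] by (auto simp: n_def)
  define r where "r = \<bar>z \<bullet> e l\<bar>"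
  have r: "0 < r" "r \<le> 1"
  proof -
    show "0 < r" using l by (simp add: r_def)
    have "dist x0 y0 \<le> 1" using d0 dist_triangle3[of x0 y0 c] by linarith
    then show "r \<le> 1" using coord_le_norm[of l z] l by (simp add: r_def z_def dist_norm n_def)
  qed
  define D where "D = 1024 * S"
  have D: "D \<ge> 0" using S by (simp add: D_def)
  have coupled: "second_diff u x0 h - second_diff w y0 h'
      \<ge> A * second_diff (coord_powr \<gamma>) z (h - h') - D * min 1 ((norm h)\<^sup>2)" for h h'
    using coupled_second_diff[OF max[unfolded \<Phi>_def] S, of h h'] by (simp add: z_def D_def)
  have sync: "second_diff u x0 h - second_diff w y0 h \<ge> - D * min 1 ((norm h)\<^sup>2)" for h
    using coupled[of h h] by (simp add: second_diff_def)
  define G where "G = A * (\<gamma> * (1 - \<gamma>) / 2 * r powr (\<gamma> - 2))"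
  have G: "G \<ge> 0" using Ap \<gamma> by (simp add: G_def)
  have reflect: "second_diff u x0 h - second_diff w y0 h' \<ge> G * t\<^sup>2 - D * min 1 ((norm h)\<^sup>2)"
    if "h - h' = t *\<^sub>R e l" "\<bar>t\<bar> < r" for h h' t
  proof -
    have "G * t\<^sup>2 \<le> A * second_diff (coord_powr \<gamma>) z (t *\<^sub>R e l)"
      using mult_left_mono[OF flip_second_diff[of l \<gamma> t z] less_imp_le[OF Ap]] l \<gamma> that
      by (simp add: G_def r_def n_def mult_ac)
    then show ?thesis using coupled[of h h'] that by simp
  qed
  have Cu: "integrable (cm i) (frac_integrand e N i s u x0)" and Cw: "integrable (cm i) (frac_integrand e N i s w y0)"
    if "i \<in> {1..m - 1}" for i
    using u[OF d0(1)] w[OF d0(2)] that by (auto simp: aniso_computable_at_def)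
  have Tu: "twice_partially_differentiable_at en u x0" and Tw: "twice_partially_differentiable_at en w y0"
    using u[OF d0(1)] w[OF d0(2)] by (auto simp: aniso_computable_at_def)
  define jw where "jw i = (LINT \<eta>|cm i. jump_weight (N i) s \<eta>)" for i
  define \<Delta> where "\<Delta> i = frac_laplacian e N i s u x0 - frac_laplacian e N i s w y0" for i
  define P where "P = partial_deriv en (partial_deriv en w) y0 - partial_deriv en (partial_deriv en u) x0"
  have \<Delta>_sync: "\<Delta> i \<ge> - D * (frac_const (N i) s * jw i)" if "i \<in> {1..m - 1}" for i
    unfolding \<Delta>_def jw_def by (rule frac_laplacian_sync[OF that Cu[OF that] Cw[OF that] sync D])
  have P_sync: "P \<ge> - D"
    unfolding P_def
  proof (rule partial_deriv2_ge[OF Tu Tw, of 1 1])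
    fix t :: real
    have "min 1 ((norm (t *\<^sub>R en))\<^sup>2) \<le> t\<^sup>2" by (simp add: norm_en)
    then have "D * min 1 ((norm (t *\<^sub>R en))\<^sup>2) \<le> D * t\<^sup>2" using D by (rule mult_left_mono)
    then show "second_diff u x0 (t *\<^sub>R en) - second_diff w y0 ((1 * t) *\<^sub>R en) \<ge> - D * t\<^sup>2"
      using sync[of "t *\<^sub>R en"] by simp
  qed auto
  have op: "aniso_op e m N a b s u x0 - aniso_op e m N a b s w y0 = (\<Sum>i = 1..m - 1. a i * \<Delta> i) + b * P"
    by (simp add: aniso_op_eq NL_def \<Delta>_def P_def sum_subtractf algebra_simps)
  have mass: "(\<Sum>i = 1..m - 1. a i * (- D * (frac_const (N i) s * jw i))) = - D * NL_mass"
    by (simp add: NL_mass_def jw_def sum_distrib_left mult_ac sum_negf)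
  have gain: "(\<Sum>i = 1..m - 1. a i * \<Delta> i) + b * P \<ge> A * coupling_gain \<gamma> - D * NL_mass - D * b"
  proof (cases "l = n")
    case True
    have "P \<ge> 4 * G - D"
      unfolding P_def
    proof (rule partial_deriv2_ge[OF Tu Tw, of "r / 2" "- 1"])
      fix t :: real assume t: "\<bar>t\<bar> < r / 2"
      have "min 1 ((norm (t *\<^sub>R en))\<^sup>2) \<le> t\<^sup>2" by (simp add: norm_en)
      then have "D * min 1 ((norm (t *\<^sub>R en))\<^sup>2) \<le> D * t\<^sup>2" using D by (rule mult_left_mono)
      moreover have "second_diff u x0 (t *\<^sub>R en) - second_diff w y0 ((- 1 * t) *\<^sub>R en)
          \<ge> G * (2 * t)\<^sup>2 - D * min 1 ((norm (t *\<^sub>R en))\<^sup>2)"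
        using t True by (intro reflect) (auto simp: n_def scaleR_2 simp flip: scaleR_left_distrib)
      ultimately show "second_diff u x0 (t *\<^sub>R en) - second_diff w y0 ((- 1 * t) *\<^sub>R en) \<ge> (4 * G - D) * t\<^sup>2"
        by (simp add: algebra_simps power2_eq_square)
    qed (use r in auto)
    then have "b * (4 * G - D) \<le> b * P" using b_pos by simp
    moreover have "A * coupling_gain \<gamma> \<le> b * (4 * G)"
    proof -
      have "1 \<le> r powr (\<gamma> - 2)" using r \<gamma> powr_mono2'[of "\<gamma> - 2" r 1] by simp
      then have "2 * b * (\<gamma> * (1 - \<gamma>)) * 1 \<le> 2 * b * (\<gamma> * (1 - \<gamma>)) * r powr (\<gamma> - 2)"
        using b_pos \<gamma> by (intro mult_left_mono) auto
      then have "coupling_gain \<gamma> \<le> 2 * b * (\<gamma> * (1 - \<gamma>)) * r powr (\<gamma> - 2)"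
        using coupling_gain_le(1)[of \<gamma>] by linarith
      then have "A * coupling_gain \<gamma> \<le> A * (2 * b * (\<gamma> * (1 - \<gamma>)) * r powr (\<gamma> - 2))"
        using Ap by simp
      then show ?thesis by (simp add: G_def algebra_simps)
    qed
    moreover have "(\<Sum>i = 1..m - 1. a i * \<Delta> i) \<ge> - D * NL_mass"
      unfolding mass[symmetric] using \<Delta>_sync a_pos by (intro sum_mono mult_left_mono) (auto simp: less_imp_le)
    ultimately show ?thesis by (simp add: algebra_simps)
  next
    case False
    then have "l \<in> {1..DIM('a) - 1}" using l by (auto simp: n_def)
    then obtain i k where ik: "i \<in> {1..m - 1}" "k \<in> {1..N i}" "l = ix i k" by (rule ix_cover)
    have "\<Delta> i \<ge> frac_const (N i) s * (4 * G * (LINT \<eta>|cm i. gain_weight (N i) s k r \<eta>) - D * jw i)"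
      unfolding \<Delta>_def jw_def
    proof (rule frac_laplacian_reflect[OF ik(1,2) r(2) Cu[OF ik(1)] Cw[OF ik(1)] sync D])
      fix \<eta> assume \<eta>: "rad (N i) \<eta> < r / 2"
      have "second_diff u x0 (gv i \<eta>) - second_diff w y0 (gv i (flip k \<eta>))
          \<ge> G * (2 * \<eta> k)\<^sup>2 - D * min 1 ((norm (gv i \<eta>))\<^sup>2)"
        using \<eta> abs_le_rad[OF ik(2), of \<eta>] by (intro reflect) (auto simp: gv_flip[OF ik(2)] ik(3))
      then show "second_diff u x0 (gv i \<eta>) - second_diff w y0 (gv i (flip k \<eta>))
          \<ge> 4 * G * (\<eta> k)\<^sup>2 - D * min 1 ((rad (N i) \<eta>)\<^sup>2)"
        by (simp add: norm_gv[OF ik(1)] power_mult_distrib)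
    qed
    then have "a i * (frac_const (N i) s * (4 * G * (LINT \<eta>|cm i. gain_weight (N i) s k r \<eta>) - D * jw i)) \<le> a i * \<Delta> i"
      using a_pos[OF ik(1)] by simp
    moreover have "A * coupling_gain \<gamma> \<le> a i * (frac_const (N i) s * (4 * G * (LINT \<eta>|cm i. gain_weight (N i) s k r \<eta>)))"
    proof -
      have "1 \<le> r powr (\<gamma> - 2 * s)" using r \<gamma> powr_mono2'[of "\<gamma> - 2 * s" r 1] by simp
      have "4 * G * (box_const (N i) * r powr (2 - 2 * s)) \<le> 4 * G * (LINT \<eta>|cm i. gain_weight (N i) s k r \<eta>)"
        using gain_weight_integral[OF ik(2) s_pos s_less r] G by (intro mult_left_mono) auto
      moreover have "r powr (\<gamma> - 2) * r powr (2 - 2 * s) = r powr (\<gamma> - 2 * s)"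
        by (simp add: powr_add[symmetric])
      moreover have "4 * G = 2 * A * (\<gamma> * (1 - \<gamma>)) * r powr (\<gamma> - 2)"
        by (simp add: G_def)
      then have "4 * G * (box_const (N i) * r powr (2 - 2 * s))
          = A * (2 * (\<gamma> * (1 - \<gamma>)) * box_const (N i) * (r powr (\<gamma> - 2) * r powr (2 - 2 * s)))"
        by (simp only: mult_ac)
      ultimately have "A * (2 * (\<gamma> * (1 - \<gamma>)) * box_const (N i) * r powr (\<gamma> - 2 * s))
          \<le> 4 * G * (LINT \<eta>|cm i. gain_weight (N i) s k r \<eta>)"
        by (simp only:)
      moreover have "A * (2 * (\<gamma> * (1 - \<gamma>)) * box_const (N i) * 1)
          \<le> A * (2 * (\<gamma> * (1 - \<gamma>)) * box_const (N i) * r powr (\<gamma> - 2 * s))"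
        using \<open>1 \<le> r powr (\<gamma> - 2 * s)\<close> Ap \<gamma> box_const_pos[OF N_pos[OF ik(1)]]
        by (intro mult_left_mono) auto
      ultimately have "A * (2 * (\<gamma> * (1 - \<gamma>)) * box_const (N i)) \<le> 4 * G * (LINT \<eta>|cm i. gain_weight (N i) s k r \<eta>)"
        by simp
      then have "a i * frac_const (N i) s * (A * (2 * (\<gamma> * (1 - \<gamma>)) * box_const (N i)))
          \<le> a i * frac_const (N i) s * (4 * G * (LINT \<eta>|cm i. gain_weight (N i) s k r \<eta>))"
        using a_pos[OF ik(1)] frac_const_pos[OF s_pos s_less, of "N i"] by (intro mult_left_mono) auto
      moreover have "A * coupling_gain \<gamma> \<le> A * (2 * a i * frac_const (N i) s * (\<gamma> * (1 - \<gamma>)) * box_const (N i))"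
        using coupling_gain_le(2)[OF ik(1), of \<gamma>] Ap by simp
      ultimately show ?thesis by (simp add: algebra_simps)
    qed
    ultimately have gi: "a i * \<Delta> i \<ge> A * coupling_gain \<gamma> + a i * (- D * (frac_const (N i) s * jw i))"
      by (simp add: algebra_simps)
    have "(\<Sum>j = 1..m - 1. a j * \<Delta> j) \<ge> (\<Sum>j = 1..m - 1. (if j = i then A * coupling_gain \<gamma> else 0) + a j * (- D * (frac_const (N j) s * jw j)))"
    proof (rule sum_mono)
      fix j assume j: "j \<in> {1..m - 1}"
      have "a j * (- D * (frac_const (N j) s * jw j)) \<le> a j * \<Delta> j"
        using \<Delta>_sync[OF j] a_pos[OF j] by (intro mult_left_mono) auto
      then show "(if j = i then A * coupling_gain \<gamma> else 0) + a j * (- D * (frac_const (N j) s * jw j)) \<le> a j * \<Delta> j"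
        using gi by auto
    qed
    also have "(\<Sum>j = 1..m - 1. (if j = i then A * coupling_gain \<gamma> else 0) + a j * (- D * (frac_const (N j) s * jw j)))
        = A * coupling_gain \<gamma> - D * NL_mass"
      unfolding sum.distrib mass using ik(1) by simp
    finally have "A * coupling_gain \<gamma> - D * NL_mass \<le> (\<Sum>j = 1..m - 1. a j * \<Delta> j)" .
    moreover have "b * P \<ge> - D * b" using mult_left_mono[OF P_sync, of b] b_pos by (simp add: mult_ac)
    ultimately show ?thesis by linarith
  qed
  have "aniso_op e m N a b s u x0 - aniso_op e m N a b s w y0 \<le> 2 * K"
    using u[OF d0(1)] w[OF d0(2)] by linarith
  then have "A * coupling_gain \<gamma> - D * NL_mass - D * b \<le> 2 * K" using op gain by linarith
  then show False using A1 by (simp add: D_def algebra_simps)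
qed

text \<open>Both lower bounds on the factor \<open>A\<close> in the doubling argument are linear in \<open>K + S\<close>.\<close>

definition Holder_factor :: "nat \<Rightarrow> real \<Rightarrow> real" where
  "Holder_factor n \<gamma> = max ((3 + 1024 * (NL_mass + b)) / coupling_gain \<gamma>) (2 * (16 * real n) powr \<gamma>)"

lemma Holder_factor_pos: "0 < \<gamma> \<Longrightarrow> \<gamma> < 1 \<Longrightarrow> Holder_factor n \<gamma> > 0"
  using coupling_gain_pos[of \<gamma>] NL_mass_nonneg b_pos
  by (auto simp: Holder_factor_def less_max_iff_disj intro!: divide_pos_pos)

lemma Holder_estimate:
  assumes \<gamma>: "0 < \<gamma>" "\<gamma> < 1" "\<gamma> \<le> 2 * s" and S: "S > 0" and K: "K \<ge> 0" and \<tau>: "\<tau> \<ge> 0"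
    and cu: "continuous_on UNIV u" and cw: "continuous_on UNIV w"
    and Su: "\<And>x. \<bar>u x\<bar> \<le> S" and Sw: "\<And>x. \<bar>w x\<bar> \<le> S"
    and u: "\<And>x. dist c x \<le> 1/8 \<Longrightarrow> aniso_computable_at e m N s u x \<and> aniso_op e m N a b s u x \<le> K"
    and w: "\<And>x. dist c x \<le> 1/8 \<Longrightarrow> aniso_computable_at e m N s w x \<and> - K \<le> aniso_op e m N a b s w x"
    and close: "\<And>x. u x - w x \<le> \<tau>"
  shows "u c - w y \<le> Holder_factor DIM('a) \<gamma> * (K + S) * coord_powr \<gamma> (c - y) + \<tau>"
proof (rule doubling_estimate[OF \<gamma> S \<tau> cu cw Su Sw u w close])
  have g: "coupling_gain \<gamma> > 0" using \<gamma> by (intro coupling_gain_pos)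
  have M: "NL_mass + b \<ge> 0" using NL_mass_nonneg b_pos by simp
  have "0 \<le> K * (NL_mass + b)" using K M by simp
  then have "2 * K + 1024 * S * (NL_mass + b) < (3 + 1024 * (NL_mass + b)) * (K + S)"
    using K S by (simp add: algebra_simps)
  also have "\<dots> = (3 + 1024 * (NL_mass + b)) / coupling_gain \<gamma> * (K + S) * coupling_gain \<gamma>"
    using g by simp
  also have "\<dots> \<le> Holder_factor DIM('a) \<gamma> * (K + S) * coupling_gain \<gamma>"
    using g K S by (intro mult_right_mono) (auto simp: Holder_factor_def)
  finally show "2 * K + 1024 * S * (NL_mass + b) < Holder_factor DIM('a) \<gamma> * (K + S) * coupling_gain \<gamma>" .
  define q where "q = (16 * real DIM('a)) powr \<gamma>"
  have q: "q > 0" using n_in by (simp add: q_def)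
  have "2 * S \<le> 2 * (K + S)" using K by simp
  also have "\<dots> = 2 * q * (K + S) * (1 / q)" using q by simp
  also have "\<dots> \<le> Holder_factor DIM('a) \<gamma> * (K + S) * (1 / q)"
    using q K S by (intro mult_right_mono) (auto simp: Holder_factor_def q_def)
  also have "1 / q = (1 / (16 * DIM('a))) powr \<gamma>"
    by (simp add: q_def powr_divide)
  finally show "2 * S \<le> Holder_factor DIM('a) \<gamma> * (K + S) * (1 / (16 * DIM('a))) powr \<gamma>" .
qed

lemma coord_powr_le:
  assumes "0 < \<gamma>"
  shows "coord_powr \<gamma> z \<le> DIM('a) * norm z powr \<gamma>"
proof -
  have "coord_powr \<gamma> z \<le> (\<Sum>k = 1..DIM('a). norm z powr \<gamma>)"
    unfolding coord_powr_def using assms coord_le_norm by (intro sum_mono powr_mono2) auto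
  then show ?thesis by simp
qed

section \<open>Functions of the first variables\<close>

text \<open>
  Corrections of the solution will not depend on the last variable: then its second derivative in
  that variable is not affected, and on such functions the operator is its nonlocal part.
\<close>

definition vertical :: "('a \<Rightarrow> real) \<Rightarrow> bool" where
  "vertical v \<longleftrightarrow> (\<forall>x t. v (x + t *\<^sub>R en) = v x)"

lemma verticalD: "vertical v \<Longrightarrow> v (x + t *\<^sub>R en) = v x"
  by (simp add: vertical_def)

lemma vertical_op:
  assumes "vertical v"
  shows "twice_partially_differentiable_at en v x" "aniso_op e m N a b s v x = NL v x"
proof -
  have 1: "partial_deriv en v = (\<lambda>x. 0)"
    using assms by (auto simp: partial_deriv_def vertical_def)
  show "twice_partially_differentiable_at en v x"
    using assms by (simp add: twice_partially_differentiable_at_def 1 vertical_def)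
  show "aniso_op e m N a b s v x = NL v x"
    by (simp add: aniso_op_eq 1) (simp add: partial_deriv_def)
qed

text \<open>
  The doubling argument itself supplies the modulus of continuity of the corrections.
\<close>

lemma vertical_Holder:
  assumes v: "vertical v" "continuous_on UNIV v" and S: "S > 0" "\<And>x. \<bar>v x\<bar> \<le> S" and K: "K \<ge> 0"
    and NL: "\<And>x. NL_computable v x" "\<And>x. \<bar>NL v x\<bar> \<le> K"
  shows "\<bar>v x - v y\<bar> \<le> Holder_factor DIM('a) s * (K + S) * DIM('a) * dist x y powr s"
proof -
  have one: "v x - v y \<le> Holder_factor DIM('a) s * (K + S) * DIM('a) * dist x y powr s" for x y
  proof -
    have "v x - v y \<le> Holder_factor DIM('a) s * (K + S) * coord_powr s (x - y) + 0"
    proof (rule Holder_estimate[OF s_pos s_less _ S(1) K _ v(2) v(2) S(2) S(2)])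
      show "aniso_computable_at e m N s v x \<and> aniso_op e m N a b s v x \<le> K"
        "aniso_computable_at e m N s v x \<and> - K \<le> aniso_op e m N a b s v x" for x
        using NL(1)[of x] NL(2)[of x] vertical_op[OF v(1), of x] by (auto simp: aniso_computable_iff)
    qed (use s_pos in auto)
    also have "\<dots> \<le> Holder_factor DIM('a) s * (K + S) * (DIM('a) * norm (x - y) powr s) + 0"
      using coord_powr_le[OF s_pos, of "x - y"] Holder_factor_pos[OF s_pos s_less] K S(1)
      by (intro add_right_mono mult_left_mono mult_nonneg_nonneg) (auto simp: less_imp_le)
    finally show ?thesis by (simp add: dist_norm mult_ac)
  qed
  show ?thesis using one[of x y] one[of y x] by (simp add: abs_le_iff dist_commute)
qed

text \<open>
  A class that is stable under averaging over translates, on which the truncated operators converge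
  at a uniform rate.
\<close>

definition regular :: "real \<Rightarrow> ('a \<Rightarrow> real) \<Rightarrow> bool" where
  "regular C v \<longleftrightarrow> vertical v \<and> (\<forall>x y. \<bar>v x - v y\<bar> \<le> C * dist x y)
     \<and> (\<forall>x h. \<bar>second_diff v x h\<bar> \<le> C * (norm h)\<^sup>2)"

lemma regularD:
  assumes "regular C v"
  shows "vertical v" "\<bar>v x - v y\<bar> \<le> C * dist x y" "\<bar>second_diff v x h\<bar> \<le> C * (norm h)\<^sup>2"
  using assms by (auto simp: regular_def)

lemma regular_nonneg:
  assumes "regular C v"
  shows "C \<ge> 0"
proof -
  have "0 \<le> C * (norm en)\<^sup>2" using regularD(3)[OF assms, of 0 en] by linarith
  then show ?thesis by (simp add: norm_en)
qed

lemma Lipschitz_continuous: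
  fixes v :: "'a \<Rightarrow> real"
  assumes "\<And>x y. \<bar>v x - v y\<bar> \<le> C * dist x y"
  shows "continuous_on UNIV v"
proof -
  have "(max C 0)-lipschitz_on UNIV v"
  proof (rule lipschitz_onI)
    show "dist (v x) (v y) \<le> max C 0 * dist x y" for x y
      using assms[of x y] mult_right_mono[of C "max C 0" "dist x y"] by (auto simp: dist_real_def)
  qed auto
  then show ?thesis by (rule lipschitz_on_continuous_on)
qed

lemma regular_continuous: "regular C v \<Longrightarrow> continuous_on UNIV v"
  using Lipschitz_continuous regularD(2) by blast

lemma regular_cmult: "regular C v \<Longrightarrow> 0 \<le> c \<Longrightarrow> regular (c * C) (\<lambda>x. c * v x)"
  unfolding regular_def vertical_def second_diff_def
  by (auto simp: right_diff_distrib[symmetric] abs_mult mult.assoc mult_left_mono)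
    (metis (no_types, lifting) abs_mult abs_of_nonneg mult.assoc mult.left_commute mult_left_mono right_diff_distrib')

lemma regular_second_diff_bound:
  assumes v: "regular C v" and S: "\<And>x. \<bar>v x\<bar> \<le> S"
  shows "\<bar>second_diff v x h\<bar> \<le> max C (4 * S) * min 1 (norm h powr (1 + s\<^sup>2))"
proof -
  have "\<bar>second_diff v x h\<bar> \<le> max C (4 * S) * min 1 ((norm h)\<^sup>2)"
  proof (cases "(norm h)\<^sup>2 \<le> 1")
    case True
    have "C * (norm h)\<^sup>2 \<le> max C (4 * S) * (norm h)\<^sup>2" by (intro mult_right_mono) auto
    then show ?thesis using regularD(3)[OF v, of x h] True by (simp add: min_absorb2)
  next
    case False
    have "\<bar>second_diff v x h\<bar> \<le> 4 * S"
      using S[of x] S[of "x + h"] S[of "x - h"] by (simp add: second_diff_def)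
    then show ?thesis using False by (simp add: min_def)
  qed
  also have "\<dots> \<le> max C (4 * S) * min 1 (norm h powr (1 + s\<^sup>2))"
    using min_sq_le[of "norm h"] regular_nonneg[OF v] by (intro mult_left_mono) auto
  finally show ?thesis .
qed

subsection \<open>Smoothing\<close>

lemma lborel_shift:
  fixes f :: "'a \<Rightarrow> real"
  assumes "f \<in> borel_measurable borel"
  shows "(LINT z|lborel. f (z + h)) = (LINT z|lborel. f z)"
    and "integrable lborel f \<Longrightarrow> integrable lborel (\<lambda>z. f (z + h))"
proof -
  show "(LINT z|lborel. f (z + h)) = (LINT z|lborel. f z)"
    using integral_distr[of "\<lambda>z. z + h" lborel borel f] assms by (simp add: lborel_distr_add)
  show "integrable lborel f \<Longrightarrow> integrable lborel (\<lambda>z. f (z + h))"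
    using integrable_distr_eq[of "\<lambda>z. z + h" lborel borel f] assms by (simp add: lborel_distr_add)
qed

text \<open>
  A change of variables moves one of the two differences in a second difference from \<open>w\<close> to the kernel,
  so Lipschitz continuity of \<open>w\<close> and of the kernel bounds the second difference by \<open>(norm h)\<^sup>2\<close>.  The
  kernel lives in the ball of radius \<open>\<tau>\<close>, which preserves constancy on such balls.
\<close>

lemma mollify:
  fixes w :: "'a \<Rightarrow> real"
  assumes w: "vertical w" and range: "\<And>x. 0 \<le> w x \<and> w x \<le> 1"
    and lip: "\<And>x y. \<bar>w x - w y\<bar> \<le> L * dist x y" and \<tau>: "\<tau> > 0"
  obtains g C where "regular C g" "\<And>x. 0 \<le> g x \<and> g x \<le> 1"
    "\<And>x \<kappa>. (\<And>y. dist x y < \<tau> \<Longrightarrow> w y = \<kappa>) \<Longrightarrow> g x = \<kappa>"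
proof -
  define \<rho> where "\<rho> z = max 0 (1 - norm z / \<tau>)" for z :: 'a
  have [measurable]: "w \<in> borel_measurable borel"
    using Lipschitz_continuous[OF lip] by (rule borel_measurable_continuous_onI)
  have [measurable]: "\<rho> \<in> borel_measurable borel"
    unfolding \<rho>_def by measurable
  have \<rho>01: "0 \<le> \<rho> z" "\<rho> z \<le> 1" for z using \<tau> by (auto simp: \<rho>_def)
  have \<rho>0: "\<rho> z = 0" if "norm z \<ge> \<tau>" for z using that \<tau> by (simp add: \<rho>_def)
  have L: "L \<ge> 0"
    using lip[of 0 en] by (simp add: dist_norm norm_en)
  define Bq where "Bq z = (indicator (ball 0 \<tau>) z :: real)" for z :: 'a
  have Bq: "integrable lborel Bq"
    unfolding Bq_def by (intro integrable_real_indicator) (auto intro!: emeasure_bounded_finite[unfolded infinity_ennreal_def])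
  have \<rho>B: "\<rho> z \<le> Bq z" for z
    using \<rho>01[of z] \<rho>0[of z] by (auto simp: Bq_def indicator_def)
  have \<rho>i: "integrable lborel \<rho>"
    by (rule Bochner_Integration.integrable_bound[OF Bq]) (use \<rho>B \<rho>01 in \<open>auto intro: order_trans[OF _ abs_ge_self]\<close>)
  have int: "integrable lborel (\<lambda>z. \<rho> z * f z)" if [measurable]: "f \<in> borel_measurable borel" and "\<And>z. \<bar>f z\<bar> \<le> D" for f D
  proof (rule Bochner_Integration.integrable_bound[OF integrable_mult_right[OF \<rho>i, of D]])
    show "AE z in lborel. norm (\<rho> z * f z) \<le> norm (D * \<rho> z)"
    proof (rule AE_I2)
      fix z
      have "\<bar>f z\<bar> \<le> \<bar>D\<bar>" using that(2)[of z] by linarith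
      then show "norm (\<rho> z * f z) \<le> norm (D * \<rho> z)"
        using \<rho>01[of z] mult_left_mono[of "\<bar>f z\<bar>" "\<bar>D\<bar>" "\<rho> z"] by (simp add: abs_mult mult.commute)
    qed
  qed simp
  define c where "c = (LINT z|lborel. \<rho> z)"
  have c: "c > 0"
  proof -
    have "0 < measure lborel (ball (0::'a) (\<tau> / 2))"
      using \<tau> by (simp add: content_ball_pos)
    also have "(1/2) * measure lborel (ball (0::'a) (\<tau> / 2)) = (LINT z|lborel. (1/2) * indicator (ball (0::'a) (\<tau> / 2)) z)"
      by simp
    also have "\<dots> \<le> c"
      unfolding c_def
    proof (intro integral_mono \<rho>i)
      show "integrable lborel (\<lambda>z. (1/2 :: real) * indicator (ball (0::'a) (\<tau> / 2)) z)"
        by (intro integrable_mult_right integrable_real_indicator) (auto intro!: emeasure_bounded_finite[unfolded infinity_ennreal_def])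
      show "(1/2) * indicator (ball (0::'a) (\<tau> / 2)) z \<le> \<rho> z" for z
        using \<tau> by (auto simp: \<rho>_def indicator_def field_simps)
    qed
    finally show ?thesis by simp
  qed
  define g where "g x = (LINT z|lborel. \<rho> z * w (x + z)) / c" for x
  have wi: "integrable lborel (\<lambda>z. \<rho> z * w (x + z))" for x
    by (rule int[of _ 1]) (use range in auto)
  have "vertical g"
  proof -
    have "w (x + t *\<^sub>R en + z) = w (x + z)" for x t z
      using verticalD[OF w, of "x + z" t] by (simp add: algebra_simps)
    then show ?thesis by (simp add: vertical_def g_def)
  qed
  have g01: "0 \<le> g x \<and> g x \<le> 1" for x
  proof
    show "0 \<le> g x"
      unfolding g_def using c range \<rho>01 by (intro divide_nonneg_pos Bochner_Integration.integral_nonneg) auto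
    have "(LINT z|lborel. \<rho> z * w (x + z)) \<le> (LINT z|lborel. \<rho> z)"
      using wi \<rho>i range \<rho>01 by (intro integral_mono) (auto simp: mult_left_le)
    then show "g x \<le> 1" using c by (simp add: g_def c_def)
  qed
  have gc: "g x = \<kappa>" if "\<And>y. dist x y < \<tau> \<Longrightarrow> w y = \<kappa>" for x \<kappa>
  proof -
    have "\<rho> z * w (x + z) = \<rho> z * \<kappa>" for z
      using that[of "x + z"] \<rho>0[of z] by (cases "norm z < \<tau>") (auto simp: dist_norm)
    then have "(LINT z|lborel. \<rho> z * w (x + z)) = (LINT z|lborel. \<rho> z * \<kappa>)" by (simp only:)
    then show ?thesis using c by (simp add: g_def c_def)
  qed
  have gL: "\<bar>g x - g y\<bar> \<le> L * dist x y" for x y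
  proof -
    have "\<bar>(LINT z|lborel. \<rho> z * w (x + z)) - (LINT z|lborel. \<rho> z * w (y + z))\<bar>
       = \<bar>LINT z|lborel. \<rho> z * (w (x + z) - w (y + z))\<bar>"
      using wi by (simp add: right_diff_distrib)
    also have "\<dots> \<le> (LINT z|lborel. \<rho> z * (L * dist x y))"
    proof (rule order_trans[OF integral_abs_bound])
      have "\<bar>\<rho> z * (w (x + z) - w (y + z))\<bar> \<le> \<rho> z * (L * dist x y)" for z
        using lip[of "x + z" "y + z"] \<rho>01[of z] by (simp add: abs_mult mult_left_mono)
      then show "(LINT z|lborel. \<bar>\<rho> z * (w (x + z) - w (y + z))\<bar>) \<le> (LINT z|lborel. \<rho> z * (L * dist x y))"
        using \<rho>i wi by (intro integral_mono) (auto simp: right_diff_distrib)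
    qed
    also have "\<dots> = c * (L * dist x y)" by (simp add: c_def)
    finally show ?thesis
      unfolding g_def diff_divide_distrib[symmetric] abs_divide using c by (simp add: divide_le_eq mult_ac)
  qed
  define V where "V = (LINT z|lborel. Bq z)"
  have V: "V \<ge> 0" unfolding V_def by (rule Bochner_Integration.integral_nonneg) (simp add: Bq_def)
  have gS: "\<bar>second_diff g x h\<bar> \<le> (2 * L * V / (\<tau> * c)) * (norm h)\<^sup>2" for x h
  proof -
    have m1: "(\<lambda>z. w (x + z)) \<in> borel_measurable borel" "(\<lambda>z. w (x + h + z)) \<in> borel_measurable borel" by measurable
    have sh: "(LINT z|lborel. \<rho> z * w (x + z)) = (LINT z|lborel. \<rho> (z + h) * w (x + h + z))"
      using lborel_shift(1)[of "\<lambda>z. \<rho> z * w (x + z)" h] by (simp add: algebra_simps)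
    have sh2: "(LINT z|lborel. \<rho> z * w (x - h + z)) = (LINT z|lborel. \<rho> (z + h) * w (x + z))"
      using lborel_shift(1)[of "\<lambda>z. \<rho> z * w (x - h + z)" h] by (simp add: algebra_simps)
    have i1: "integrable lborel (\<lambda>z. \<rho> (z + h) * w (x + h + z))"
      using lborel_shift(2)[of "\<lambda>z. \<rho> z * w (x + z)" h] wi[of x] by (simp add: algebra_simps)
    have i2: "integrable lborel (\<lambda>z. \<rho> (z + h) * w (x + z))"
      using lborel_shift(2)[of "\<lambda>z. \<rho> z * w (x - h + z)" h] wi[of "x - h"] by (simp add: algebra_simps)
    have "c * second_diff g x h = (LINT z|lborel. \<rho> z * w (x + z)) - (LINT z|lborel. \<rho> z * w (x + h + z))
        + (LINT z|lborel. \<rho> (z + h) * w (x + h + z)) - (LINT z|lborel. \<rho> (z + h) * w (x + z))"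
      using c sh unfolding second_diff_def g_def sh2[symmetric] by (simp add: field_simps)
    also have "\<dots> = (LINT z|lborel. (\<rho> z - \<rho> (z + h)) * (w (x + z) - w (x + h + z)))"
      using wi[of x] wi[of "x + h"] i1 i2 by (simp add: algebra_simps)
    finally have "c * \<bar>second_diff g x h\<bar> = \<bar>LINT z|lborel. (\<rho> z - \<rho> (z + h)) * (w (x + z) - w (x + h + z))\<bar>"
      using c by (metis abs_mult abs_of_pos)
    also have "\<dots> \<le> (LINT z|lborel. norm h / \<tau> * (Bq z + Bq (z + h)) * (L * norm h))"
    proof (rule order_trans[OF integral_abs_bound], rule integral_mono)
      show "integrable lborel (\<lambda>z. \<bar>(\<rho> z - \<rho> (z + h)) * (w (x + z) - w (x + h + z))\<bar>)"
        using wi[of x] wi[of "x + h"] i1 i2 by (intro integrable_abs) (simp add: algebra_simps)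
      show "integrable lborel (\<lambda>z. norm h / \<tau> * (Bq z + Bq (z + h)) * (L * norm h))"
        using Bq lborel_shift(2)[of Bq h] by (simp add: Bq_def[abs_def])
      show "\<bar>(\<rho> z - \<rho> (z + h)) * (w (x + z) - w (x + h + z))\<bar> \<le> norm h / \<tau> * (Bq z + Bq (z + h)) * (L * norm h)" for z
        unfolding abs_mult
      proof (rule mult_mono)
        show "\<bar>w (x + z) - w (x + h + z)\<bar> \<le> L * norm h"
          using lip[of "x + z" "x + h + z"] by (simp add: dist_norm)
        have "\<bar>\<rho> z - \<rho> (z + h)\<bar> \<le> norm h / \<tau>"
        proof -
          have "\<bar>\<rho> z - \<rho> (z + h)\<bar> \<le> \<bar>norm (z + h) / \<tau> - norm z / \<tau>\<bar>" by (simp add: \<rho>_def max_def)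
          also have "\<dots> = \<bar>norm (z + h) - norm z\<bar> / \<tau>" using \<tau> by (simp add: diff_divide_distrib[symmetric])
          also have "\<dots> \<le> norm h / \<tau>"
            using \<tau> norm_triangle_ineq3[of "z + h" z] by (intro divide_right_mono) auto
          finally show ?thesis .
        qed
        moreover have "Bq z + Bq (z + h) \<ge> 1" if "\<rho> z \<noteq> 0 \<or> \<rho> (z + h) \<noteq> 0"
        proof -
          have "norm z < \<tau> \<or> norm (z + h) < \<tau>" using that \<rho>0 by (meson not_less)
          then show ?thesis by (auto simp: Bq_def indicator_def)
        qed
        ultimately show "\<bar>\<rho> z - \<rho> (z + h)\<bar> \<le> norm h / \<tau> * (Bq z + Bq (z + h))"
        proof (cases "\<rho> z \<noteq> 0 \<or> \<rho> (z + h) \<noteq> 0")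
          case True
          then have "norm h / \<tau> * 1 \<le> norm h / \<tau> * (Bq z + Bq (z + h))"
            using \<open>\<rho> z \<noteq> 0 \<or> \<rho> (z + h) \<noteq> 0 \<Longrightarrow> Bq z + Bq (z + h) \<ge> 1\<close> \<tau> by (intro mult_left_mono) auto
          then show ?thesis using \<open>\<bar>\<rho> z - \<rho> (z + h)\<bar> \<le> norm h / \<tau>\<close> by linarith
        next
          case False
          then show ?thesis using \<tau> by (simp add: Bq_def)
        qed
        show "0 \<le> norm h / \<tau> * (Bq z + Bq (z + h))" using \<tau> by (simp add: Bq_def)
      qed auto
    qed
    also have "\<dots> = norm h / \<tau> * (V + V) * (L * norm h)"
      using Bq lborel_shift[of Bq h] by (simp add: V_def Bq_def[abs_def])
    also have "\<dots> = c * ((2 * L * V / (\<tau> * c)) * (norm h)\<^sup>2)"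
      using c \<tau> by (simp add: field_simps power2_eq_square)
    finally show ?thesis using c by (simp only: mult_le_cancel_left_pos)
  qed
  define C where "C = max L (2 * L * V / (\<tau> * c))"
  have "regular C g"
    unfolding regular_def
  proof (intro conjI allI)
    show "vertical g" by fact
    show "\<bar>g x - g y\<bar> \<le> C * dist x y" for x y
      by (rule order_trans[OF gL mult_right_mono]) (auto simp: C_def)
    show "\<bar>second_diff g x h\<bar> \<le> C * (norm h)\<^sup>2" for x h
      by (rule order_trans[OF gS mult_right_mono]) (auto simp: C_def)
  qed
  then show thesis using that g01 gc by blast
qed

text \<open>Distances are measured between projections to the hyperplane orthogonal to the last direction.\<close>

definition proj :: "'a \<Rightarrow> 'a" where "proj x = x - (x \<bullet> en) *\<^sub>R en"

definition hdist :: "'a set \<Rightarrow> 'a \<Rightarrow> real" where "hdist E x = infdist (proj x) E"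

lemma proj_shift: "proj (x + t *\<^sub>R en) = proj x"
  by (simp add: proj_def inner_add_left en_inner algebra_simps)

lemma norm_proj_le: "norm (proj x) \<le> norm x"
proof -
  have "(norm (proj x))\<^sup>2 = (norm x)\<^sup>2 - (x \<bullet> en)\<^sup>2"
    unfolding power2_norm_eq_inner by (simp add: proj_def inner_simps en_inner inner_commute power2_eq_square algebra_simps)
  then have "(norm (proj x))\<^sup>2 \<le> (norm x)\<^sup>2" by simp
  then show ?thesis by (rule power2_le_imp_le) simp
qed

lemma proj_diff: "proj x - proj y = proj (x - y)"
  by (simp add: proj_def inner_diff_left algebra_simps)

lemma hdist_vertical: "vertical (hdist E)"
  by (simp add: vertical_def hdist_def proj_shift)

lemma hdist_Lipschitz: "\<bar>hdist E x - hdist E y\<bar> \<le> dist x y"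
proof -
  have "dist (proj x) (proj y) \<le> dist x y"
    by (simp add: dist_norm proj_diff norm_proj_le)
  moreover have "\<bar>infdist (proj x) E - infdist (proj y) E\<bar> \<le> dist (proj x) (proj y)"
    using infdist_triangle[of "proj x" E "proj y"] infdist_triangle[of "proj y" E "proj x"]
    by (simp add: dist_commute abs_le_iff)
  ultimately show ?thesis by (simp add: hdist_def)
qed

lemma cutoff:
  assumes r: "r > 0"
  obtains \<theta> C where "regular C \<theta>" "\<And>x. 0 \<le> \<theta> x \<and> \<theta> x \<le> 1"
    "\<And>x. hdist E x = 0 \<Longrightarrow> \<theta> x = 1" "\<And>x. hdist E x \<ge> r \<Longrightarrow> \<theta> x = 0"
proof -
  define w where "w x = min 1 (max 0 (2 - 3 / r * hdist E x))" for x
  have "vertical w" using hdist_vertical[of E] by (simp add: vertical_def w_def)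
  moreover have "0 \<le> w x \<and> w x \<le> 1" for x by (simp add: w_def)
  moreover have "\<bar>w x - w y\<bar> \<le> 3 / r * dist x y" for x y
  proof -
    have "\<bar>w x - w y\<bar> \<le> \<bar>3 / r * hdist E x - 3 / r * hdist E y\<bar>"
      unfolding w_def by (auto simp: min_def max_def abs_if)
    also have "\<dots> = 3 / r * \<bar>hdist E x - hdist E y\<bar>"
      using r unfolding right_diff_distrib[symmetric] abs_mult by simp
    also have "\<dots> \<le> 3 / r * dist x y"
      using r hdist_Lipschitz by (intro mult_left_mono) auto
    finally show ?thesis .
  qed
  moreover have "r / 3 > 0" using r by simp
  ultimately obtain g C where g: "regular C g" "\<And>x. 0 \<le> g x \<and> g x \<le> 1"
    "\<And>x \<kappa>. (\<And>y. dist x y < r / 3 \<Longrightarrow> w y = \<kappa>) \<Longrightarrow> g x = \<kappa>"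
    using mollify[of w "3 / r" "r / 3"] by metis
  have "g x = 1" if "hdist E x = 0" for x
  proof (rule g(3))
    fix y assume "dist x y < r / 3"
    then have "3 / r * hdist E y \<le> 1"
      using hdist_Lipschitz[of E x y] that r by (simp add: field_simps)
    then show "w y = 1" by (simp add: w_def)
  qed
  moreover have "g x = 0" if "hdist E x \<ge> r" for x
  proof (rule g(3))
    fix y assume "dist x y < r / 3"
    then have "2 / 3 * r \<le> hdist E y"
      using hdist_Lipschitz[of E x y] that by linarith
    then have "3 / r * hdist E y \<ge> 2"
      using r by (simp add: field_simps)
    then show "w y = 0" by (simp add: w_def)
  qed
  ultimately show thesis using that g by blast
qed

section \<open>An approximate resolvent of the nonlocal part\<close>

text \<open>
  The equation \<open>v + NL v = g\<close> is solved up to a small error.  Jumps shorter than \<open>\<delta>\<close> are removed, so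
  that the operator becomes \<open>\<Lambda> * v - jump_avg \<delta> v\<close> with the total mass \<open>\<Lambda>\<close> of the jumps, and the
  equation \<open>(1 + \<Lambda>) * v = g + jump_avg \<delta> v\<close> is solved by iteration.  Bounds on \<open>g\<close>, on its
  differences and on its mass pass to \<open>v\<close> because \<open>jump_avg\<close> averages over translates.

  A nonnegative vertical function that is not almost everywhere zero has infinite integral; its mass
  is therefore taken in a slab of height one, which the jumps preserve.
\<close>

definition slab :: "'a set" where "slab = {x. 0 < x \<bullet> en \<and> x \<bullet> en < 1}"

definition slab_mass :: "('a \<Rightarrow> real) \<Rightarrow> ennreal" where
  "slab_mass v = (\<integral>\<^sup>+x\<in>slab. ennreal (v x) \<partial>lborel)"

definition cut_weight :: "real \<Rightarrow> nat \<Rightarrow> (nat \<Rightarrow> real) \<Rightarrow> real" where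
  "cut_weight \<delta> i y = (if rad (N i) y > \<delta> then 1 / rad (N i) y powr (real (N i) + 2 * s) else 0)"

definition jump_avg :: "real \<Rightarrow> ('a \<Rightarrow> real) \<Rightarrow> 'a \<Rightarrow> real" where
  "jump_avg \<delta> v x = (\<Sum>i = 1..m - 1. a i * (frac_const (N i) s *
     (LINT y|cm i. cut_weight \<delta> i y * (v (x + gv i y) + v (x - gv i y)))))"

definition cut_mass :: "real \<Rightarrow> real" where
  "cut_mass \<delta> = jump_avg \<delta> (\<lambda>_. 1) 0"

lemma slab_measurable [measurable]: "slab \<in> sets borel"
proof -
  have "slab = {x. 0 < x \<bullet> en} \<inter> {x. x \<bullet> en < 1}" by (auto simp: slab_def)
  moreover have "open {x. 0 < x \<bullet> en}" "open {x. x \<bullet> en < 1}"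
    by (intro open_Collect_less continuous_intros)+
  ultimately show ?thesis by auto
qed

lemma cut_weight_measurable [measurable]: "cut_weight \<delta> i \<in> borel_measurable (cm i)"
  unfolding cut_weight_def by measurable

lemma cut_weight_nonneg: "cut_weight \<delta> i y \<ge> 0"
  by (simp add: cut_weight_def)

lemma coeff_nonneg: "i \<in> {1..m - 1} \<Longrightarrow> 0 \<le> a i * frac_const (N i) s"
  using a_pos frac_const_pos[OF s_pos s_less] by (simp add: less_imp_le)

lemma cut_weight_le:
  assumes \<delta>: "0 < \<delta>" "\<delta> \<le> 1"
  shows "cut_weight \<delta> i y \<le> \<delta> powr - (1 + s\<^sup>2) * jump_weight (N i) s y"
proof (cases "rad (N i) y > \<delta>")
  case True
  define r where "r = rad (N i) y"
  have r: "r > \<delta>" using True by (simp add: r_def)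
  have "\<delta> powr (1 + s\<^sup>2) \<le> min 1 (r powr (1 + s\<^sup>2))"
    using r \<delta> by (auto intro!: powr_le1 powr_mono2 add_nonneg_nonneg)
  then have "\<delta> powr - (1 + s\<^sup>2) * \<delta> powr (1 + s\<^sup>2) \<le> \<delta> powr - (1 + s\<^sup>2) * min 1 (r powr (1 + s\<^sup>2))"
    by (rule mult_left_mono) simp
  then have "1 \<le> \<delta> powr - (1 + s\<^sup>2) * min 1 (r powr (1 + s\<^sup>2))"
    using \<delta> by (simp only: powr_add[symmetric]) simp
  then have "1 / r powr (real (N i) + 2 * s) \<le> \<delta> powr - (1 + s\<^sup>2) * min 1 (r powr (1 + s\<^sup>2)) / r powr (real (N i) + 2 * s)"
    by (intro divide_right_mono) auto
  then show ?thesis using True by (simp add: cut_weight_def jump_weight_def r_def)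
next
  case False
  then show ?thesis using jump_weight_nonneg by (simp add: cut_weight_def)
qed

context
  fixes \<delta> :: real
  assumes \<delta>: "0 < \<delta>" "\<delta> \<le> 1"
begin

lemma cut_weight_integrable:
  assumes i: "i \<in> {1..m - 1}"
  shows "integrable (cm i) (cut_weight \<delta> i)"
proof (rule Bochner_Integration.integrable_bound[OF integrable_mult_right[OF jump_weight_integrable[OF i]]])
  show "AE y in cm i. norm (cut_weight \<delta> i y) \<le> norm (\<delta> powr - (1 + s\<^sup>2) * jump_weight (N i) s y)"
    using cut_weight_le[OF \<delta>] cut_weight_nonneg by (intro AE_I2) (simp add: abs_mult jump_weight_nonneg)
qed simp

lemma cut_integrable:
  assumes i: "i \<in> {1..m - 1}" and [measurable]: "f \<in> borel_measurable (cm i)" and f: "\<And>y. \<bar>f y\<bar> \<le> D"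
  shows "integrable (cm i) (\<lambda>y. cut_weight \<delta> i y * f y)"
proof (rule Bochner_Integration.integrable_bound[OF integrable_mult_right[OF cut_weight_integrable[OF i], of D]])
  show "AE y in cm i. norm (cut_weight \<delta> i y * f y) \<le> norm (D * cut_weight \<delta> i y)"
  proof (rule AE_I2)
    fix y
    have "\<bar>f y\<bar> \<le> \<bar>D\<bar>" using f[of y] by linarith
    then show "norm (cut_weight \<delta> i y * f y) \<le> norm (D * cut_weight \<delta> i y)"
      using cut_weight_nonneg[of \<delta> i y] mult_left_mono[of "\<bar>f y\<bar>" "\<bar>D\<bar>" "cut_weight \<delta> i y"]
      by (simp add: abs_mult mult.commute)
  qed
qed simp

lemma cut_mass_eq: "cut_mass \<delta> = (\<Sum>i = 1..m - 1. a i * (frac_const (N i) s * (LINT y|cm i. cut_weight \<delta> i y * 2)))"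
  by (simp add: cut_mass_def jump_avg_def)

lemma cut_mass_nonneg: "cut_mass \<delta> \<ge> 0"
  unfolding cut_mass_eq
  by (intro sum_nonneg mult_nonneg_nonneg Bochner_Integration.integral_nonneg less_imp_le[OF a_pos]
      less_imp_le[OF frac_const_pos[OF s_pos s_less]]) (auto simp: cut_weight_nonneg)

text \<open>
  Positivity and total mass of \<open>jump_avg\<close>, combined with its translation invariance: an upper bound for
  a combination of translates of functions passes to their averages.  Taking two or three translates
  gives the bounds for values, increments and second differences.
\<close>

lemma jump_avg_combination_le:
  fixes v :: "nat \<Rightarrow> 'a \<Rightarrow> real" and c :: "nat \<Rightarrow> real" and x :: "nat \<Rightarrow> 'a"
  assumes J: "finite J" and v: "\<And>j. j \<in> J \<Longrightarrow> continuous_on UNIV (v j)" "\<And>j z. j \<in> J \<Longrightarrow> \<bar>v j z\<bar> \<le> S"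
    and le: "\<And>h. (\<Sum>j\<in>J. c j * v j (x j + h)) \<le> B"
  shows "(\<Sum>j\<in>J. c j * jump_avg \<delta> (v j) (x j)) \<le> cut_mass \<delta> * B"
proof -
  have meas: "(\<lambda>y. v j (x j + gv i y) + v j (x j - gv i y)) \<in> borel_measurable (cm i)" if "j \<in> J" for i j
  proof -
    have [measurable]: "v j \<in> borel_measurable borel"
      using v(1)[OF that] by (rule borel_measurable_continuous_onI)
    show ?thesis by measurable
  qed
  have int: "integrable (cm i) (\<lambda>y. cut_weight \<delta> i y * (v j (x j + gv i y) + v j (x j - gv i y)))"
    if "i \<in> {1..m - 1}" "j \<in> J" for i j
  proof (rule cut_integrable[OF that(1) meas[OF that(2)], of "2 * S"])
    show "\<bar>v j (x j + gv i y) + v j (x j - gv i y)\<bar> \<le> 2 * S" for y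
      using v(2)[OF that(2), of "x j + gv i y"] v(2)[OF that(2), of "x j - gv i y"] by linarith
  qed
  have "(\<Sum>j\<in>J. c j * jump_avg \<delta> (v j) (x j))
     = (\<Sum>i = 1..m - 1. a i * (frac_const (N i) s *
         (\<Sum>j\<in>J. c j * (LINT y|cm i. cut_weight \<delta> i y * (v j (x j + gv i y) + v j (x j - gv i y))))))"
    unfolding jump_avg_def sum_distrib_left by (subst sum.swap) (simp add: mult_ac)
  also have "\<dots> = (\<Sum>i = 1..m - 1. a i * (frac_const (N i) s *
         (LINT y|cm i. (\<Sum>j\<in>J. c j * (cut_weight \<delta> i y * (v j (x j + gv i y) + v j (x j - gv i y)))))))"
    using int by (intro sum.cong refl arg_cong2[where f = "(*)"]) simp
  also have "\<dots> \<le> (\<Sum>i = 1..m - 1. a i * (frac_const (N i) s * (LINT y|cm i. cut_weight \<delta> i y * 2 * B)))"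
  proof (rule sum_mono)
    fix i assume i: "i \<in> {1..m - 1}"
    have "(LINT y|cm i. (\<Sum>j\<in>J. c j * (cut_weight \<delta> i y * (v j (x j + gv i y) + v j (x j - gv i y)))))
        \<le> (LINT y|cm i. cut_weight \<delta> i y * 2 * B)"
    proof (rule integral_mono)
      show "integrable (cm i) (\<lambda>y. \<Sum>j\<in>J. c j * (cut_weight \<delta> i y * (v j (x j + gv i y) + v j (x j - gv i y))))"
        using int[OF i] by (intro Bochner_Integration.integrable_sum integrable_mult_right) auto
      show "integrable (cm i) (\<lambda>y. cut_weight \<delta> i y * 2 * B)"
        using cut_weight_integrable[OF i] by simp
      fix y
      have "(\<Sum>j\<in>J. c j * (cut_weight \<delta> i y * (v j (x j + gv i y) + v j (x j - gv i y))))
         = cut_weight \<delta> i y * ((\<Sum>j\<in>J. c j * v j (x j + gv i y)) + (\<Sum>j\<in>J. c j * v j (x j + - gv i y)))"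
        by (simp add: sum_distrib_left sum.distrib[symmetric] algebra_simps)
      also have "\<dots> \<le> cut_weight \<delta> i y * (2 * B)"
        using le[of "gv i y"] le[of "- gv i y"] cut_weight_nonneg by (intro mult_left_mono) auto
      finally show "(\<Sum>j\<in>J. c j * (cut_weight \<delta> i y * (v j (x j + gv i y) + v j (x j - gv i y)))) \<le> cut_weight \<delta> i y * 2 * B"
        by simp
    qed
    then show "a i * (frac_const (N i) s * (LINT y|cm i. (\<Sum>j\<in>J. c j * (cut_weight \<delta> i y * (v j (x j + gv i y) + v j (x j - gv i y))))))
        \<le> a i * (frac_const (N i) s * (LINT y|cm i. cut_weight \<delta> i y * 2 * B))"
      unfolding mult.assoc[symmetric] using coeff_nonneg[OF i] by (intro mult_left_mono) auto
  qed
  also have "\<dots> = cut_mass \<delta> * B"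
    unfolding cut_mass_eq sum_distrib_right by (intro sum.cong) (auto simp: mult_ac)
  finally show ?thesis .
qed

lemma jump_avg_diff_le:
  assumes "continuous_on UNIV v" "continuous_on UNIV w" "\<And>z. \<bar>v z\<bar> \<le> S" "\<And>z. \<bar>w z\<bar> \<le> S"
    and "\<And>h. v (x + h) - w (y + h) \<le> B"
  shows "jump_avg \<delta> v x - jump_avg \<delta> w y \<le> cut_mass \<delta> * B"
  using jump_avg_combination_le[of "{0, 1::nat}" "\<lambda>j. if j = 0 then v else w" S "\<lambda>j. if j = 0 then 1 else -1"
      "\<lambda>j. if j = 0 then x else y" B] assms
  by (simp add: split: if_splits)

lemma jump_avg_second_diff_le:
  assumes "continuous_on UNIV v" "\<And>z. \<bar>v z\<bar> \<le> S"
    and "\<And>z. c * second_diff v z h \<le> B"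
  shows "c * second_diff (jump_avg \<delta> v) x h \<le> cut_mass \<delta> * B"
proof -
  have "(\<Sum>j\<in>{0, 1, 2::nat}. (if j = 0 then 2 * c else - c) * jump_avg \<delta> v (if j = 0 then x else if j = 1 then x + h else x - h))
     \<le> cut_mass \<delta> * B"
  proof (rule jump_avg_combination_le[where S = S])
    fix h'
    show "(\<Sum>j\<in>{0, 1, 2::nat}. (if j = 0 then 2 * c else - c) * v ((if j = 0 then x else if j = 1 then x + h else x - h) + h')) \<le> B"
      using assms(3)[of "x + h'"] by (simp add: second_diff_def algebra_simps)
  qed (use assms in auto)
  then show ?thesis by (simp add: second_diff_def algebra_simps)
qed

lemma jump_avg_const: "jump_avg \<delta> (\<lambda>_. k) x = cut_mass \<delta> * k"
  unfolding cut_mass_eq jump_avg_def sum_distrib_right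
  by (intro sum.cong) (auto simp: mult_ac simp flip: mult_2)

lemma jump_avg_regular:
  assumes v: "regular C v" and S: "\<And>z. \<bar>v z\<bar> \<le> S"
  shows "regular (cut_mass \<delta> * C) (jump_avg \<delta> v)"
  unfolding regular_def
proof (intro conjI allI)
  have cv: "continuous_on UNIV v" by (rule regular_continuous[OF v])
  show "vertical (jump_avg \<delta> v)"
  proof -
    have "v (x + t *\<^sub>R en + h) = v (x + h)" "v (x + t *\<^sub>R en - h) = v (x - h)" for x t h
      using verticalD[OF regularD(1)[OF v], of "x + h" t] verticalD[OF regularD(1)[OF v], of "x - h" t]
      by (simp_all add: algebra_simps)
    then show ?thesis by (simp add: vertical_def jump_avg_def)
  qed
  have one: "jump_avg \<delta> v x - jump_avg \<delta> v y \<le> cut_mass \<delta> * (C * dist x y)" for x y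
  proof (rule jump_avg_diff_le[OF cv cv S S])
    show "v (x + h) - v (y + h) \<le> C * dist x y" for h
      using regularD(2)[OF v, of "x + h" "y + h"] by (simp add: abs_le_iff)
  qed
  show "\<bar>jump_avg \<delta> v x - jump_avg \<delta> v y\<bar> \<le> cut_mass \<delta> * C * dist x y" for x y
    using one[of x y] one[of y x] by (simp add: abs_le_iff dist_commute mult_ac)
  show "\<bar>second_diff (jump_avg \<delta> v) x h\<bar> \<le> cut_mass \<delta> * C * (norm h)\<^sup>2" for x h
  proof -
    have "\<And>z. 1 * second_diff v z h \<le> C * (norm h)\<^sup>2" "\<And>z. - 1 * second_diff v z h \<le> C * (norm h)\<^sup>2"
      using regularD(3)[OF v] by (simp_all add: abs_le_iff)
    from jump_avg_second_diff_le[OF cv S this(1), of x] jump_avg_second_diff_le[OF cv S this(2), of x]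
    show ?thesis by (simp add: abs_le_iff mult_ac)
  qed
qed

lemma slab_mass_shift:
  assumes "continuous_on UNIV v" "h \<bullet> en = 0"
  shows "slab_mass (\<lambda>x. v (x + h)) = slab_mass v"
proof -
  have [measurable]: "v \<in> borel_measurable borel"
    using assms(1) by (rule borel_measurable_continuous_onI)
  have "slab_mass v = (\<integral>\<^sup>+x. ennreal (v x) * indicator slab x \<partial>distr lborel borel (\<lambda>z. z + h))"
    by (simp add: slab_mass_def lborel_distr_add)
  also have "\<dots> = (\<integral>\<^sup>+x. ennreal (v (x + h)) * indicator slab (x + h) \<partial>lborel)"
    by (subst nn_integral_distr) auto
  also have "\<dots> = slab_mass (\<lambda>x. v (x + h))"
    using assms(2) by (simp add: slab_mass_def indicator_def slab_def inner_add_left)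
  finally show ?thesis by simp
qed

text \<open>
  Tonelli's theorem, and invariance of the slab under the jumps.
\<close>

lemma jump_avg_slab_mass:
  assumes v: "continuous_on UNIV v" "\<And>z. 0 \<le> v z" "\<And>z. v z \<le> S"
  shows "slab_mass (jump_avg \<delta> v) \<le> ennreal (cut_mass \<delta>) * slab_mass v"
proof -
  have [measurable]: "v \<in> borel_measurable borel"
    using v(1) by (rule borel_measurable_continuous_onI)
  define I where "I i x = (LINT y|cm i. cut_weight \<delta> i y * (v (x + gv i y) + v (x - gv i y)))" for i x
  have bd: "\<bar>v (x + gv i y) + v (x - gv i y)\<bar> \<le> 2 * S" for x i y
    using v(2)[of "x + gv i y"] v(3)[of "x + gv i y"] v(2)[of "x - gv i y"] v(3)[of "x - gv i y"] by linarith
  have I: "ennreal (I i x) = (\<integral>\<^sup>+y. ennreal (cut_weight \<delta> i y * (v (x + gv i y) + v (x - gv i y))) \<partial>cm i)"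
    if "i \<in> {1..m - 1}" for i x
    unfolding I_def
    by (rule nn_integral_eq_integral[symmetric], rule cut_integrable[OF that _ bd]) (use v cut_weight_nonneg in auto)
  have I0: "I i x \<ge> 0" for i x
    unfolding I_def using v cut_weight_nonneg by (intro Bochner_Integration.integral_nonneg) simp
  have mI [measurable]: "(\<lambda>x. ennreal (I i x)) \<in> borel_measurable borel" if i: "i \<in> {1..m - 1}" for i
  proof -
    interpret sigma_finite_measure "cm i"
      by (intro product_sigma_finite.sigma_finite) (auto simp: product_sigma_finite_def sigma_finite_lborel)
    show ?thesis
      unfolding I[OF i] by measurable
  qed
  have Im: "(\<integral>\<^sup>+x\<in>slab. ennreal (I i x) \<partial>lborel) = ennreal (LINT y|cm i. cut_weight \<delta> i y * 2) * slab_mass v"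
    if i: "i \<in> {1..m - 1}" for i
  proof -
    interpret S: sigma_finite_measure "cm i"
      by (intro product_sigma_finite.sigma_finite) (auto simp: product_sigma_finite_def sigma_finite_lborel)
    interpret P: pair_sigma_finite "cm i" "lborel :: 'a measure" ..
    have "(\<integral>\<^sup>+x\<in>slab. ennreal (I i x) \<partial>lborel)
       = (\<integral>\<^sup>+x. (\<integral>\<^sup>+y. ennreal (cut_weight \<delta> i y * (v (x + gv i y) + v (x - gv i y))) * indicator slab x \<partial>cm i) \<partial>lborel)"
      unfolding I[OF i] by (intro nn_integral_cong) (subst nn_integral_multc[symmetric], auto)
    also have "\<dots> = (\<integral>\<^sup>+y. (\<integral>\<^sup>+x. ennreal (cut_weight \<delta> i y * (v (x + gv i y) + v (x - gv i y))) * indicator slab x \<partial>lborel) \<partial>cm i)"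
      by (rule P.Fubini') measurable
    also have "\<dots> = (\<integral>\<^sup>+y. ennreal (cut_weight \<delta> i y * 2) * slab_mass v \<partial>cm i)"
    proof (rule nn_integral_cong)
      fix y
      have "(\<integral>\<^sup>+x. ennreal (cut_weight \<delta> i y * (v (x + gv i y) + v (x - gv i y))) * indicator slab x \<partial>lborel)
         = (\<integral>\<^sup>+x. ennreal (cut_weight \<delta> i y) * (ennreal (v (x + gv i y)) * indicator slab x + ennreal (v (x + - gv i y)) * indicator slab x) \<partial>lborel)"
        using v(2) cut_weight_nonneg by (intro nn_integral_cong) (auto simp: ennreal_mult ennreal_plus indicator_def)
      also have "\<dots> = ennreal (cut_weight \<delta> i y) * (slab_mass (\<lambda>x. v (x + gv i y)) + slab_mass (\<lambda>x. v (x + - gv i y)))"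
        by (simp add: nn_integral_cmult nn_integral_add slab_mass_def)
      also have "\<dots> = ennreal (cut_weight \<delta> i y * 2) * slab_mass v"
        using slab_mass_shift[OF v(1), of "gv i y"] slab_mass_shift[OF v(1), of "- gv i y"] gv_inner_en[OF i] cut_weight_nonneg
        by (simp add: ennreal_mult mult.assoc mult_2[symmetric])
      finally show "(\<integral>\<^sup>+x. ennreal (cut_weight \<delta> i y * (v (x + gv i y) + v (x - gv i y))) * indicator slab x \<partial>lborel)
         = ennreal (cut_weight \<delta> i y * 2) * slab_mass v" .
    qed
    also have "\<dots> = (\<integral>\<^sup>+y. ennreal (cut_weight \<delta> i y * 2) \<partial>cm i) * slab_mass v"
      by (rule nn_integral_multc) auto
    also have "(\<integral>\<^sup>+y. ennreal (cut_weight \<delta> i y * 2) \<partial>cm i) = ennreal (LINT y|cm i. cut_weight \<delta> i y * 2)"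
      using cut_weight_integrable[OF i] cut_weight_nonneg by (intro nn_integral_eq_integral) auto
    finally show ?thesis .
  qed
  define A where "A i = a i * frac_const (N i) s" for i
  have A: "A i \<ge> 0" if "i \<in> {1..m - 1}" for i using coeff_nonneg[OF that] by (simp add: A_def)
  have "slab_mass (jump_avg \<delta> v) = (\<integral>\<^sup>+x. (\<Sum>i = 1..m - 1. ennreal (A i) * (ennreal (I i x) * indicator slab x)) \<partial>lborel)"
  proof -
    have "ennreal (jump_avg \<delta> v x) * indicator slab x = (\<Sum>i = 1..m - 1. ennreal (A i) * (ennreal (I i x) * indicator slab x))" for x
    proof -
      have "ennreal (jump_avg \<delta> v x) = ennreal (\<Sum>i = 1..m - 1. A i * I i x)"
        by (simp add: jump_avg_def A_def I_def mult.assoc)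
      also have "\<dots> = (\<Sum>i = 1..m - 1. ennreal (A i * I i x))"
        using A I0 by (intro sum_ennreal[symmetric]) auto
      also have "\<dots> = (\<Sum>i = 1..m - 1. ennreal (A i) * ennreal (I i x))"
        using A I0 by (intro sum.cong) (auto simp: ennreal_mult)
      finally show ?thesis by (simp add: sum_distrib_right mult.assoc)
    qed
    then show ?thesis by (simp add: slab_mass_def)
  qed
  also have "\<dots> = (\<Sum>i = 1..m - 1. ennreal (A i) * (\<integral>\<^sup>+x\<in>slab. ennreal (I i x) \<partial>lborel))"
  proof (subst nn_integral_sum)
    fix i assume i: "i \<in> {1..m - 1}"
    note [measurable] = mI[OF i]
    show "(\<lambda>x. ennreal (A i) * (ennreal (I i x) * indicator slab x)) \<in> borel_measurable lborel" by measurable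
  next
    show "(\<Sum>i = 1..m - 1. \<integral>\<^sup>+x. ennreal (A i) * (ennreal (I i x) * indicator slab x) \<partial>lborel)
      = (\<Sum>i = 1..m - 1. ennreal (A i) * (\<integral>\<^sup>+x\<in>slab. ennreal (I i x) \<partial>lborel))"
    proof (rule sum.cong)
      fix i assume i: "i \<in> {1..m - 1}"
      note [measurable] = mI[OF i]
      show "(\<integral>\<^sup>+x. ennreal (A i) * (ennreal (I i x) * indicator slab x) \<partial>lborel)
        = ennreal (A i) * (\<integral>\<^sup>+x\<in>slab. ennreal (I i x) \<partial>lborel)"
        by (rule nn_integral_cmult) measurable
    qed simp
  qed
  also have "\<dots> = (\<Sum>i = 1..m - 1. ennreal (A i * (LINT y|cm i. cut_weight \<delta> i y * 2)) * slab_mass v)"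
    using A cut_weight_nonneg by (intro sum.cong) (auto simp: Im ennreal_mult mult.assoc intro!: Bochner_Integration.integral_nonneg)
  also have "\<dots> = ennreal (\<Sum>i = 1..m - 1. A i * (LINT y|cm i. cut_weight \<delta> i y * 2)) * slab_mass v"
    using A cut_weight_nonneg
    by (subst sum_ennreal[symmetric]) (auto simp: sum_distrib_right intro!: mult_nonneg_nonneg Bochner_Integration.integral_nonneg)
  also have "(\<Sum>i = 1..m - 1. A i * (LINT y|cm i. cut_weight \<delta> i y * 2)) = cut_mass \<delta>"
    by (simp add: cut_mass_eq A_def mult.assoc)
  finally show ?thesis by simp
qed

text \<open>
  For jumps shorter than \<open>\<delta>\<close> the second difference is at most
  \<open>C * (norm h)\<^sup>2 \<le> C * \<delta> powr (1 - s\<^sup>2) * norm h powr (1 + s\<^sup>2)\<close>.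
\<close>

lemma NL_cut:
  assumes v: "regular C v" and S: "\<And>z. \<bar>v z\<bar> \<le> S"
  shows "\<bar>NL v x - (cut_mass \<delta> * v x - jump_avg \<delta> v x)\<bar> \<le> C * \<delta> powr (1 - s\<^sup>2) * NL_mass"
proof -
  have cv: "continuous_on UNIV v" by (rule regular_continuous[OF v])
  have [measurable]: "v \<in> borel_measurable borel"
    using cv by (rule borel_measurable_continuous_onI)
  have "NL_computable v x"
    by (rule NL_small(1)[OF cv regular_second_diff_bound[OF v S]])
  then have F: "integrable (cm i) (frac_integrand e N i s v x)" if "i \<in> {1..m - 1}" for i
    using that by (simp add: NL_computable_def)
  define R where "R i y = frac_integrand e N i s v x y - cut_weight \<delta> i y * second_diff v x (gv i y)" for i y
  have sd: "\<bar>second_diff v x h\<bar> \<le> 4 * S" for h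
    using S[of x] S[of "x + h"] S[of "x - h"] by (simp add: second_diff_def)
  have c1: "integrable (cm i) (\<lambda>y. cut_weight \<delta> i y * second_diff v x (gv i y))" if "i \<in> {1..m - 1}" for i
    by (rule cut_integrable[OF that _ sd]) (simp add: second_diff_def)
  have c2: "integrable (cm i) (\<lambda>y. cut_weight \<delta> i y * (v (x + gv i y) + v (x - gv i y)))" if "i \<in> {1..m - 1}" for i
  proof (rule cut_integrable[OF that, of _ "2 * S"])
    show "\<bar>v (x + gv i y) + v (x - gv i y)\<bar> \<le> 2 * S" for y
      using S[of "x + gv i y"] S[of "x - gv i y"] by linarith
  qed simp
  have cut: "(\<Sum>i = 1..m - 1. a i * (frac_const (N i) s * (LINT y|cm i. cut_weight \<delta> i y * second_diff v x (gv i y))))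
      = cut_mass \<delta> * v x - jump_avg \<delta> v x"
  proof -
    have "(LINT y|cm i. cut_weight \<delta> i y * second_diff v x (gv i y))
        = (LINT y|cm i. cut_weight \<delta> i y * 2) * v x - (LINT y|cm i. cut_weight \<delta> i y * (v (x + gv i y) + v (x - gv i y)))"
      if "i \<in> {1..m - 1}" for i
    proof -
      have "(LINT y|cm i. cut_weight \<delta> i y * second_diff v x (gv i y))
         = (LINT y|cm i. cut_weight \<delta> i y * (2 * v x) - cut_weight \<delta> i y * (v (x + gv i y) + v (x - gv i y)))"
        by (simp add: second_diff_def algebra_simps)
      also have "\<dots> = (LINT y|cm i. cut_weight \<delta> i y * (2 * v x)) - (LINT y|cm i. cut_weight \<delta> i y * (v (x + gv i y) + v (x - gv i y)))"
        by (rule Bochner_Integration.integral_diff[OF integrable_mult_left[OF cut_weight_integrable[OF that]] c2[OF that]])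
      finally show ?thesis by simp
    qed
    then show ?thesis
      unfolding cut_mass_eq jump_avg_def sum_distrib_right sum_subtractf[symmetric]
      by (intro sum.cong refl) (simp only: right_diff_distrib mult.assoc)
  qed
  have Rb: "\<bar>R i y\<bar> \<le> C * \<delta> powr (1 - s\<^sup>2) * jump_weight (N i) s y" if i: "i \<in> {1..m - 1}" for i y
  proof (cases "rad (N i) y > \<delta> \<or> rad (N i) y = 0")
    case True
    then have "R i y = 0"
      using \<delta> by (auto simp: R_def frac_integrand_eq[OF i] cut_weight_def)
    then show ?thesis using regular_nonneg[OF v] jump_weight_nonneg by simp
  next
    case False
    define r where "r = rad (N i) y"
    have r: "0 < r" "r \<le> \<delta>" using False L2_set_nonneg[of y "{1..N i}"] unfolding r_def by linarith+
    have s2: "s\<^sup>2 < 1" using s_pos s_less by (simp add: power_less_one_iff)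
    have "r\<^sup>2 = r powr (1 - s\<^sup>2) * r powr (1 + s\<^sup>2)"
      using r by (simp add: powr_add[symmetric] powr_numeral)
    also have "\<dots> \<le> \<delta> powr (1 - s\<^sup>2) * min 1 (r powr (1 + s\<^sup>2))"
    proof (rule mult_mono)
      show "r powr (1 - s\<^sup>2) \<le> \<delta> powr (1 - s\<^sup>2)" using r s2 by (intro powr_mono2) auto
      have "r powr (1 + s\<^sup>2) \<le> 1" using r \<delta> by (intro powr_le1) auto
      then show "r powr (1 + s\<^sup>2) \<le> min 1 (r powr (1 + s\<^sup>2))" by simp
    qed auto
    finally have le: "r\<^sup>2 \<le> \<delta> powr (1 - s\<^sup>2) * min 1 (r powr (1 + s\<^sup>2))" .
    have "\<bar>second_diff v x (gv i y)\<bar> \<le> C * r\<^sup>2"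
      using regularD(3)[OF v, of x "gv i y"] by (simp add: norm_gv[OF i] r_def)
    also have "\<dots> \<le> C * (\<delta> powr (1 - s\<^sup>2) * min 1 (r powr (1 + s\<^sup>2)))"
      using le regular_nonneg[OF v] by (rule mult_left_mono)
    finally have "\<bar>second_diff v x (gv i y)\<bar> / r powr (real (N i) + 2 * s)
       \<le> C * (\<delta> powr (1 - s\<^sup>2) * min 1 (r powr (1 + s\<^sup>2))) / r powr (real (N i) + 2 * s)"
      by (rule divide_right_mono) simp
    moreover have "R i y = second_diff v x (gv i y) / r powr (real (N i) + 2 * s)"
      using r unfolding R_def frac_integrand_eq[OF i] cut_weight_def r_def[symmetric] by simp
    ultimately show ?thesis
      by (simp add: jump_weight_def r_def[symmetric] abs_divide mult.assoc)
  qed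
  have Ri: "integrable (cm i) (R i)" if "i \<in> {1..m - 1}" for i
    unfolding R_def using F[OF that] c1[OF that] by (intro Bochner_Integration.integrable_diff)
  have "NL v x - (cut_mass \<delta> * v x - jump_avg \<delta> v x) = (\<Sum>i = 1..m - 1. a i * (frac_const (N i) s * (LINT y|cm i. R i y)))"
    unfolding cut[symmetric] NL_def sum_subtractf[symmetric] R_def
    using F c1 by (intro sum.cong) (auto simp: frac_laplacian_def algebra_simps)
  also have "\<bar>\<dots>\<bar> \<le> (\<Sum>i = 1..m - 1. a i * (frac_const (N i) s * (C * \<delta> powr (1 - s\<^sup>2) * (LINT y|cm i. jump_weight (N i) s y))))"
  proof (rule order_trans[OF sum_abs], rule sum_mono)
    fix i assume i: "i \<in> {1..m - 1}"
    have "\<bar>LINT y|cm i. R i y\<bar> \<le> (LINT y|cm i. \<bar>R i y\<bar>)" by (rule integral_abs_bound)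
    also have "\<dots> \<le> (LINT y|cm i. C * \<delta> powr (1 - s\<^sup>2) * jump_weight (N i) s y)"
      using Ri[OF i] jump_weight_integrable[OF i] Rb[OF i] by (intro integral_mono) auto
    finally have "\<bar>LINT y|cm i. R i y\<bar> \<le> C * \<delta> powr (1 - s\<^sup>2) * (LINT y|cm i. jump_weight (N i) s y)" by simp
    then show "\<bar>a i * (frac_const (N i) s * (LINT y|cm i. R i y))\<bar>
        \<le> a i * (frac_const (N i) s * (C * \<delta> powr (1 - s\<^sup>2) * (LINT y|cm i. jump_weight (N i) s y)))"
      using a_pos[OF i] frac_const_pos[OF s_pos s_less, of "N i"] by (simp add: abs_mult mult_left_mono less_imp_le)
  qed
  also have "\<dots> = C * \<delta> powr (1 - s\<^sup>2) * NL_mass"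
    by (simp add: NL_mass_def sum_distrib_left mult_ac)
  finally show ?thesis .
qed

end

lemma regular_add: "regular C v \<Longrightarrow> regular D w \<Longrightarrow> regular (C + D) (\<lambda>x. v x + w x)"
  unfolding regular_def
proof (elim conjE, intro conjI allI)
  assume v: "vertical v" "\<forall>x y. \<bar>v x - v y\<bar> \<le> C * dist x y" "\<forall>x h. \<bar>second_diff v x h\<bar> \<le> C * (norm h)\<^sup>2"
    and w: "vertical w" "\<forall>x y. \<bar>w x - w y\<bar> \<le> D * dist x y" "\<forall>x h. \<bar>second_diff w x h\<bar> \<le> D * (norm h)\<^sup>2"
  show "vertical (\<lambda>x. v x + w x)" using v(1) w(1) by (simp add: vertical_def)
  show "\<bar>v x + w x - (v y + w y)\<bar> \<le> (C + D) * dist x y" for x y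
    using v(2)[rule_format, of x y] w(2)[rule_format, of x y] by (simp add: distrib_right)
  show "\<bar>second_diff (\<lambda>x. v x + w x) x h\<bar> \<le> (C + D) * (norm h)\<^sup>2" for x h
    using v(3)[rule_format, of x h] w(3)[rule_format, of x h] by (simp add: distrib_right second_diff_def)
qed

text \<open>
  The iteration contracts in the supremum norm with factor \<open>\<Lambda> / (1 + \<Lambda>)\<close>, so a finite iterate already
  solves the truncated equation up to \<open>\<epsilon> / 2\<close>; the truncation parameter accounts for the rest.
\<close>

lemma approx_resolvent:
  assumes g: "regular C g" and gK: "\<And>x. 0 \<le> g x" "\<And>x. g x \<le> K" and \<epsilon>: "\<epsilon> > 0"
  obtains v where "regular C v" "\<And>x. 0 \<le> v x" "\<And>x. v x \<le> K" "slab_mass v \<le> slab_mass g"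
    "\<And>x. \<bar>NL v x - (g x - v x)\<bar> \<le> \<epsilon>"
proof -
  have s2: "s\<^sup>2 < 1" using s_pos s_less by (simp add: power_less_one_iff)
  have K: "K \<ge> 0" using gK[of 0] by linarith
  have C: "C \<ge> 0" by (rule regular_nonneg[OF g])
  define D where "D = 2 * (C * NL_mass + 1)"
  have D: "D > 0" using C NL_mass_nonneg by (simp add: D_def add_nonneg_pos)
  define \<delta> where "\<delta> = min 1 ((\<epsilon> / D) powr (1 / (1 - s\<^sup>2)))"
  have \<delta>: "0 < \<delta>" "\<delta> \<le> 1" using \<epsilon> D by (auto simp: \<delta>_def)
  have "\<delta> powr (1 - s\<^sup>2) \<le> ((\<epsilon> / D) powr (1 / (1 - s\<^sup>2))) powr (1 - s\<^sup>2)"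
    using \<delta> s2 by (intro powr_mono2) (auto simp: \<delta>_def)
  also have "\<dots> = \<epsilon> / D" using \<epsilon> D s2 by (simp add: powr_powr)
  finally have "C * \<delta> powr (1 - s\<^sup>2) * NL_mass \<le> C * (\<epsilon> / D) * NL_mass"
    using C NL_mass_nonneg by (intro mult_right_mono mult_left_mono) auto
  also have "\<dots> \<le> \<epsilon> / 2"
  proof -
    have "\<epsilon> * (2 * (C * NL_mass)) \<le> \<epsilon> * D" using \<epsilon> by (simp add: D_def)
    then show ?thesis using D by (simp add: field_simps)
  qed
  finally have err: "C * \<delta> powr (1 - s\<^sup>2) * NL_mass \<le> \<epsilon> / 2" .
  define \<Lambda> where "\<Lambda> = cut_mass \<delta>"
  have \<Lambda>: "\<Lambda> \<ge> 0" unfolding \<Lambda>_def by (rule cut_mass_nonneg[OF \<delta>])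
  define V where "V = rec_nat (\<lambda>x. 0) (\<lambda>_ v x. 1 / (1 + \<Lambda>) * (g x + jump_avg \<delta> v x))"
  have V0: "V 0 = (\<lambda>x. 0)" and VS: "V (Suc k) = (\<lambda>x. 1 / (1 + \<Lambda>) * (g x + jump_avg \<delta> (V k) x))" for k
    by (simp_all add: V_def)
  have inv: "regular C (V k) \<and> (\<forall>x. 0 \<le> V k x \<and> V k x \<le> K) \<and> slab_mass (V k) \<le> slab_mass g" for k
  proof (induction k)
    case 0
    show ?case using C K by (simp add: V0 regular_def vertical_def second_diff_def slab_mass_def)
  next
    case (Suc k)
    then have r: "regular C (V k)" and VK: "\<And>x. 0 \<le> V k x" "\<And>x. V k x \<le> K" and sm: "slab_mass (V k) \<le> slab_mass g"
      by auto
    have VK': "\<bar>V k x\<bar> \<le> K" for x using VK by simp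
    note cV = regular_continuous[OF r]
    have jr: "regular (\<Lambda> * C) (jump_avg \<delta> (V k))"
      unfolding \<Lambda>_def by (rule jump_avg_regular[OF \<delta> r VK'])
    have "regular (1 / (1 + \<Lambda>) * (C + \<Lambda> * C)) (V (Suc k))"
      unfolding VS using \<Lambda> by (intro regular_cmult regular_add g jr) auto
    moreover have "1 / (1 + \<Lambda>) * (C + \<Lambda> * C) = C"
      using \<Lambda> by (simp add: field_simps)
    ultimately have reg: "regular C (V (Suc k))" by simp
    have j: "0 \<le> jump_avg \<delta> (V k) x" "jump_avg \<delta> (V k) x \<le> \<Lambda> * K" for x
      using jump_avg_diff_le[OF \<delta> continuous_on_const[of UNIV 0] cV, where S = K and x = x and y = x and B = 0]
        jump_avg_diff_le[OF \<delta> cV continuous_on_const[of UNIV 0], where S = K and x = x and y = x and B = K] K VK VK'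
      by (simp_all add: jump_avg_const[OF \<delta>] \<Lambda>_def)
    have "0 \<le> V (Suc k) x \<and> V (Suc k) x \<le> K" for x
    proof
      show "0 \<le> V (Suc k) x" unfolding VS using \<Lambda> gK j by simp
      have "g x + jump_avg \<delta> (V k) x \<le> K * (1 + \<Lambda>)" using gK(2)[of x] j(2)[of x] by (simp add: algebra_simps)
      then show "V (Suc k) x \<le> K" unfolding VS using \<Lambda> by (simp add: divide_le_eq)
    qed
    moreover have "slab_mass (V (Suc k)) \<le> slab_mass g"
    proof -
      have [measurable]: "g \<in> borel_measurable borel" "jump_avg \<delta> (V k) \<in> borel_measurable borel"
        using regular_continuous[OF g] regular_continuous[OF jr] by (auto intro: borel_measurable_continuous_onI)
      have "slab_mass (V (Suc k)) = (\<integral>\<^sup>+x. ennreal (1 / (1 + \<Lambda>)) * (ennreal (g x) * indicator slab x + ennreal (jump_avg \<delta> (V k) x) * indicator slab x) \<partial>lborel)"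
        unfolding slab_mass_def VS
      proof (rule nn_integral_cong)
        fix x
        have "ennreal (1 / (1 + \<Lambda>) * (g x + jump_avg \<delta> (V k) x)) = ennreal (1 / (1 + \<Lambda>)) * (ennreal (g x) + ennreal (jump_avg \<delta> (V k) x))"
          using \<Lambda> gK j by (subst ennreal_mult) (auto simp: ennreal_plus)
        then show "ennreal (1 / (1 + \<Lambda>) * (g x + jump_avg \<delta> (V k) x)) * indicator slab x
            = ennreal (1 / (1 + \<Lambda>)) * (ennreal (g x) * indicator slab x + ennreal (jump_avg \<delta> (V k) x) * indicator slab x)"
          by (simp add: indicator_def)
      qed
      also have "\<dots> = ennreal (1 / (1 + \<Lambda>)) * (slab_mass g + slab_mass (jump_avg \<delta> (V k)))"
        by (simp add: nn_integral_cmult nn_integral_add slab_mass_def)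
      also have "\<dots> \<le> ennreal (1 / (1 + \<Lambda>)) * (slab_mass g + ennreal \<Lambda> * slab_mass g)"
        using jump_avg_slab_mass[OF \<delta> cV VK] sm unfolding \<Lambda>_def
        by (intro mult_left_mono add_left_mono order_trans[OF _ mult_left_mono[OF sm]]) auto
      also have "\<dots> = ennreal (1 / (1 + \<Lambda>)) * (ennreal (1 + \<Lambda>) * slab_mass g)"
        using \<Lambda> by (simp add: ennreal_plus distrib_right)
      also have "\<dots> = ennreal (1 / (1 + \<Lambda>) * (1 + \<Lambda>)) * slab_mass g"
        using \<Lambda> by (subst ennreal_mult) (auto simp: mult.assoc)
      also have "\<dots> = slab_mass g"
        using \<Lambda> by simp
      finally show ?thesis .
    qed
    ultimately show ?case using reg by blast
  qed
  define q where "q = \<Lambda> / (1 + \<Lambda>)"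
  have q: "0 \<le> q" "q < 1" using \<Lambda> by (auto simp: q_def)
  have V_bound: "\<bar>V k x\<bar> \<le> K" for k x using inv[of k] by simp
  have cV: "continuous_on UNIV (V k)" for k using inv[of k] regular_continuous by blast
  have step: "\<bar>V (Suc k) x - V k x\<bar> \<le> K * q ^ k" for k x
  proof (induction k arbitrary: x)
    case 0
    show ?case using inv[of "Suc 0"] by (simp add: V0)
  next
    case (Suc k)
    have "V (Suc k) (x + h) - V k (x + h) \<le> K * q ^ k" "V k (x + h) - V (Suc k) (x + h) \<le> K * q ^ k" for h
      using Suc.IH[of "x + h"] by (simp_all add: abs_le_iff)
    from jump_avg_diff_le[OF \<delta> cV cV V_bound V_bound this(1)] jump_avg_diff_le[OF \<delta> cV cV V_bound V_bound this(2)]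
    have "\<bar>jump_avg \<delta> (V (Suc k)) x - jump_avg \<delta> (V k) x\<bar> \<le> \<Lambda> * (K * q ^ k)"
      by (simp add: \<Lambda>_def abs_le_iff)
    then have "\<bar>jump_avg \<delta> (V (Suc k)) x - jump_avg \<delta> (V k) x\<bar> / (1 + \<Lambda>) \<le> \<Lambda> * (K * q ^ k) / (1 + \<Lambda>)"
      using \<Lambda> by (intro divide_right_mono) auto
    moreover have "V (Suc (Suc k)) x - V (Suc k) x = (jump_avg \<delta> (V (Suc k)) x - jump_avg \<delta> (V k) x) / (1 + \<Lambda>)"
      by (simp add: VS diff_divide_distrib[symmetric])
    ultimately show ?case using \<Lambda> by (simp add: q_def abs_divide mult_ac)
  qed
  have "(\<lambda>k. (1 + \<Lambda>) * (K * q ^ k)) \<longlonglongrightarrow> (1 + \<Lambda>) * (K * 0)"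
    using q by (intro tendsto_intros LIMSEQ_realpow_zero)
  then have "\<forall>\<^sub>F k in sequentially. (1 + \<Lambda>) * (K * q ^ k) < \<epsilon> / 2"
    using \<epsilon> by (intro order_tendstoD(2)[of _ "(1 + \<Lambda>) * (K * 0)"]) auto
  then obtain k where k: "(1 + \<Lambda>) * (K * q ^ k) < \<epsilon> / 2"
    by (auto simp: eventually_sequentially)
  have "\<bar>NL (V k) x - (g x - V k x)\<bar> \<le> \<epsilon>" for x
  proof -
    have "\<Lambda> * V k x - jump_avg \<delta> (V k) x = g x - V k x - (1 + \<Lambda>) * (V (Suc k) x - V k x)"
    proof -
      have "(1 + \<Lambda>) * V (Suc k) x = g x + jump_avg \<delta> (V k) x"
        using \<Lambda> unfolding VS by simp
      then show ?thesis by (simp add: algebra_simps)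
    qed
    moreover have "\<bar>(1 + \<Lambda>) * (V (Suc k) x - V k x)\<bar> \<le> (1 + \<Lambda>) * (K * q ^ k)"
      using step[of k x] \<Lambda> by (simp add: abs_mult)
    moreover have "\<bar>NL (V k) x - (\<Lambda> * V k x - jump_avg \<delta> (V k) x)\<bar> \<le> \<epsilon> / 2"
      using NL_cut[OF \<delta>, of C "V k" K x] inv[of k] V_bound[of k] err by (simp add: \<Lambda>_def)
    ultimately show ?thesis using k by linarith
  qed
  then show thesis using that[of "V k"] inv[of k] by blast
qed

section \<open>Barriers\<close>

text \<open>
  Barriers are small corrections on which the nonlocal operator is almost nonnegative.  The Hoelder bound makes
  them stable under multiplication by cutoff functions: the cross term in the product rule for
  second differences is then of order \<open>norm h powr (1 + s\<^sup>2)\<close>.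
\<close>

definition barrier :: "real \<Rightarrow> ('a \<Rightarrow> real) \<Rightarrow> bool" where
  "barrier \<epsilon> v \<longleftrightarrow> vertical v \<and> (\<forall>x. \<bar>v x\<bar> \<le> \<epsilon>) \<and> (\<forall>x y. \<bar>v x - v y\<bar> \<le> \<epsilon> * dist x y powr s\<^sup>2)
     \<and> (\<forall>x. NL_computable v x \<and> - \<epsilon> \<le> NL v x)"

lemma barrierD:
  assumes "barrier \<epsilon> v"
  shows "vertical v" "\<bar>v x\<bar> \<le> \<epsilon>" "\<bar>v x - v y\<bar> \<le> \<epsilon> * dist x y powr s\<^sup>2" "NL_computable v x" "- \<epsilon> \<le> NL v x"
  using assms by (auto simp: barrier_def)

lemma s_sq: "0 < s\<^sup>2" "s\<^sup>2 < 1"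
  using s_pos s_less by (auto simp: power_less_one_iff)

lemma Holder_continuous:
  fixes v :: "'a \<Rightarrow> real"
  assumes "\<And>x y. \<bar>v x - v y\<bar> \<le> \<epsilon> * dist x y powr p" "p > 0"
  shows "continuous_on UNIV v"
  unfolding continuous_on_def
proof
  fix x :: 'a
  have "((\<lambda>y. \<epsilon> * dist x y powr p) \<longlongrightarrow> \<epsilon> * dist x x powr p) (at x)"
    using assms(2) by (intro tendsto_intros tendsto_powr') auto
  then have lim: "((\<lambda>y. \<epsilon> * dist x y powr p) \<longlongrightarrow> 0) (at x)" by simp
  have "((\<lambda>y. v y - v x) \<longlongrightarrow> 0) (at x)"
    by (rule tendsto_rabs_zero_cancel, rule tendsto_sandwich[OF _ _ tendsto_const lim])
      (use assms(1)[of x] in \<open>auto simp: abs_minus_commute intro!: always_eventually\<close>)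
  then show "(v \<longlongrightarrow> v x) (at x within UNIV)"
    by (simp add: LIM_zero_iff)
qed

lemma barrier_continuous: "barrier \<epsilon> v \<Longrightarrow> continuous_on UNIV v"
  using Holder_continuous[of v \<epsilon> "s\<^sup>2"] barrierD(3) s_sq by blast

lemma regular_computable: "regular C v \<Longrightarrow> (\<And>x. \<bar>v x\<bar> \<le> S) \<Longrightarrow> NL_computable v x"
  by (rule NL_small(1)[OF regular_continuous regular_second_diff_bound])

text \<open>
  A large value would spread, by equicontinuity, over a ball of fixed radius inside the slab.
\<close>

lemma small_if_slab_mass_small:
  assumes v: "vertical v" "\<And>x. 0 \<le> v x" "continuous_on UNIV v"
    and H: "H \<ge> 0" "\<And>x y. \<bar>v x - v y\<bar> \<le> H * dist x y powr s"
    and r: "0 < r" "r \<le> 1/2" "H * r powr s \<le> \<epsilon> / 2" and \<epsilon>: "\<epsilon> > 0"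
    and mass: "slab_mass v < ennreal (\<epsilon> / 2 * measure lborel (ball (0::'a) r))"
  shows "v x \<le> \<epsilon>"
proof (rule ccontr)
  assume neg: "\<not> ?thesis"
  define x' where "x' = x + (1/2 - x \<bullet> en) *\<^sub>R en"
  have vx': "v x' > \<epsilon>" using neg verticalD[OF v(1)] by (simp add: x'_def)
  have x'n: "x' \<bullet> en = 1/2" by (simp add: x'_def inner_add_left en_inner)
  have "ennreal (\<epsilon> / 2) * indicator (ball x' r) z \<le> ennreal (v z) * indicator slab z" for z
  proof (cases "z \<in> ball x' r")
    case True
    have "\<bar>(z - x') \<bullet> en\<bar> \<le> norm (z - x')" by (rule coord_le_norm[OF n_in])
    also have "\<dots> < r" using True by (simp add: dist_norm norm_minus_commute)
    finally have "\<bar>z \<bullet> en - 1/2\<bar> < 1/2" using r x'n by (simp add: inner_diff_left)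
    then have "0 < z \<bullet> en" "z \<bullet> en < 1" by linarith+
    then have "z \<in> slab" by (simp add: slab_def)
    have "H * dist x' z powr s \<le> H * r powr s"
      using H True s_pos by (intro mult_left_mono powr_mono2) auto
    then have "\<epsilon> / 2 \<le> v z" using H(2)[of x' z] vx' r by linarith
    then show ?thesis using True \<open>z \<in> slab\<close> by (simp add: ennreal_leI)
  qed simp
  then have "(\<integral>\<^sup>+z. ennreal (\<epsilon> / 2) * indicator (ball x' r) z \<partial>lborel) \<le> slab_mass v"
    unfolding slab_mass_def by (intro nn_integral_mono) auto
  also have "(\<integral>\<^sup>+z. ennreal (\<epsilon> / 2) * indicator (ball x' r) z \<partial>lborel) = ennreal (\<epsilon> / 2) * emeasure lborel (ball x' r)"
    by (rule nn_integral_cmult_indicator) simp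
  also have "emeasure lborel (ball x' r) = emeasure lborel (ball (0::'a) r)"
  proof -
    have "emeasure lborel (ball x' r) = emeasure (distr lborel borel ((+) x')) (ball x' r)"
      by (simp add: lborel_distr_plus)
    also have "\<dots> = emeasure lborel ((+) x' -` ball x' r)" by (subst emeasure_distr) auto
    also have "(+) x' -` ball x' r = ball 0 r" by (auto simp: dist_norm)
    finally show ?thesis .
  qed
  also have "ennreal (\<epsilon> / 2) * emeasure lborel (ball (0::'a) r) = ennreal (\<epsilon> / 2 * measure lborel (ball (0::'a) r))"
    using \<epsilon> emeasure_bounded_finite[OF bounded_ball, of "0::'a" r]
    by (simp add: emeasure_eq_ennreal_measure ennreal_mult[symmetric] less_top)
  finally show False using mass by simp
qed

lemma hdist_eq_0:
  assumes "closed Q" "Q \<noteq> {}" "\<And>x t. x \<in> Q \<Longrightarrow> x + t *\<^sub>R en \<in> Q"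
  shows "hdist Q x = 0 \<longleftrightarrow> x \<in> Q"
proof -
  have "hdist Q x = 0 \<longleftrightarrow> proj x \<in> Q"
    unfolding hdist_def using in_closed_iff_infdist_zero[OF assms(1,2)] by simp
  also have "\<dots> \<longleftrightarrow> x \<in> Q"
    using assms(3)[of "proj x" "x \<bullet> en"] assms(3)[of x "- (x \<bullet> en)"] by (auto simp: proj_def)
  finally show ?thesis .
qed

text \<open>
  The right-hand side \<open>g\<close> of \<open>v + NL v = g\<close> is \<open>K + 1\<close> on \<open>Q\<close> and vanishes away from a thin neighbourhood of \<open>Q\<close>,
  so its mass in the slab is as small as desired.  All these \<open>v\<close> have the same modulus of continuity,
  by \<open>vertical_Holder\<close>, hence small mass makes them uniformly small, and then \<open>NL v\<close> is close to \<open>g\<close>.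
\<close>

lemma barrier_on_null_set:
  assumes Q: "closed Q" "Q \<noteq> {}" "\<And>x t. x \<in> Q \<Longrightarrow> x + t *\<^sub>R en \<in> Q" "bounded (proj ` Q)" "Q \<in> null_sets lborel"
    and K: "K \<ge> 0" and \<epsilon>: "\<epsilon> > 0"
  obtains v where "barrier \<epsilon> v" "\<And>x. x \<in> Q \<Longrightarrow> K \<le> NL v x"
proof -
  define K1 where "K1 = K + 1"
  have K1: "K1 \<ge> 1" using K by (simp add: K1_def)
  define H where "H = Holder_factor DIM('a) s * (2 * K1 + 1 + K1) * DIM('a)"
  have H: "H > 0"
    unfolding H_def using Holder_factor_pos[OF s_pos s_less, of "DIM('a)"] K1 by simp
  define \<epsilon>1 where "\<epsilon>1 = min (\<epsilon> / 2) (1/2)"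
  define \<epsilon>0 where "\<epsilon>0 = min \<epsilon>1 ((\<epsilon> / H powr s) powr (1 / (1 - s)) / 2)"
  have \<epsilon>1: "0 < \<epsilon>1" "\<epsilon>1 \<le> \<epsilon> / 2" "\<epsilon>1 \<le> 1/2" using \<epsilon> by (auto simp: \<epsilon>1_def)
  have \<epsilon>0: "0 < \<epsilon>0" "\<epsilon>0 \<le> \<epsilon>1" using \<epsilon>1 \<epsilon> H by (auto simp: \<epsilon>0_def)
  \<comment> \<open>An increment below both \<open>2 * \<epsilon>0\<close> and \<open>H * dist x y powr s\<close> is below the weighted geometric mean.\<close>
  have interp: "(2 * \<epsilon>0) powr (1 - s) * H powr s \<le> \<epsilon>"
  proof -
    have "(2 * \<epsilon>0) powr (1 - s) \<le> ((\<epsilon> / H powr s) powr (1 / (1 - s))) powr (1 - s)"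
      using \<epsilon>0 s_less by (intro powr_mono2) (auto simp: \<epsilon>0_def)
    also have "\<dots> = \<epsilon> / H powr s" using s_less \<epsilon> H by (simp add: powr_powr)
    finally show ?thesis using H by (simp add: pos_le_divide_eq)
  qed
  define r where "r = min (1/2) ((\<epsilon>0 / (2 * H)) powr (1 / s))"
  have r: "0 < r" "r \<le> 1/2" using \<epsilon>0 H by (auto simp: r_def)
  have rH: "H * r powr s \<le> \<epsilon>0 / 2"
  proof -
    have "r powr s \<le> ((\<epsilon>0 / (2 * H)) powr (1 / s)) powr s"
      using r s_pos by (intro powr_mono2) (auto simp: r_def)
    also have "\<dots> = \<epsilon>0 / (2 * H)" using s_pos \<epsilon>0 H by (simp add: powr_powr)
    finally show ?thesis using H by (simp add: field_simps)
  qed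
  define \<mu> where "\<mu> = \<epsilon>0 / 2 * measure lborel (ball (0::'a) r)"
  have \<mu>: "\<mu> > 0" using \<epsilon>0 r by (simp add: \<mu>_def content_ball_pos)
  define A where "A j = slab \<inter> {x. hdist Q x < 1 / real (Suc j)}" for j
  have ch: "continuous_on UNIV (hdist Q)"
    by (rule Lipschitz_continuous[of _ 1]) (simp add: hdist_Lipschitz)
  have Am: "A j \<in> sets borel" for j
  proof -
    have "open {x. hdist Q x < 1 / real (Suc j)}"
      using ch by (intro open_Collect_less) auto
    then show ?thesis unfolding A_def by measurable
  qed
  have "(\<lambda>j. emeasure lborel (A j)) \<longlonglongrightarrow> emeasure lborel (\<Inter>j. A j)"
  proof (rule Lim_emeasure_decseq)
    show "range A \<subseteq> sets lborel" using Am by auto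
    show "decseq A"
    proof -
      have "1 / real (Suc j) \<le> 1 / real (Suc i)" if "i \<le> j" for i j
        using that by (intro divide_left_mono) auto
      then show ?thesis
        unfolding decseq_def A_def by (blast intro: less_le_trans)
    qed
    obtain B where B: "\<And>q. q \<in> Q \<Longrightarrow> norm (proj q) \<le> B" using Q(4) by (auto simp: bounded_iff)
    fix j
    have "A j \<subseteq> cball 0 (B + 2)"
    proof
      fix x assume "x \<in> A j"
      then have x: "0 < x \<bullet> en" "x \<bullet> en < 1" and hx: "hdist Q x < 1 / real (Suc j)"
        by (simp_all add: A_def slab_def)
      have "1 / real (Suc j) \<le> 1" by simp
      with hx have "hdist Q x < 1" by (rule less_le_trans)
      obtain q where q: "q \<in> Q" and qd: "infdist (proj x) Q = dist (proj x) q"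
        using infdist_attains_inf[OF Q(1,2), of "proj x"] by blast
      have q1: "dist (proj x) q < 1"
        using \<open>hdist Q x < 1\<close> unfolding hdist_def qd .
      have pp: "proj (proj x) = proj x"
        by (simp add: proj_def inner_diff_left en_inner)
      have "norm (proj x - proj q) \<le> dist (proj x) q"
        using norm_proj_le[of "proj x - q"] by (simp add: proj_diff[symmetric] pp dist_norm)
      then have "norm (proj x) \<le> B + 1"
        using norm_triangle_sub[of "proj x" "proj q"] B[OF q] q1 by linarith
      moreover have "norm x \<le> norm (proj x) + \<bar>x \<bullet> en\<bar>"
        using norm_triangle_ineq[of "proj x" "(x \<bullet> en) *\<^sub>R en"] by (simp add: proj_def norm_en)
      ultimately show "x \<in> cball 0 (B + 2)" using x by simp
    qed
    then have "bounded (A j)" using bounded_subset bounded_cball by blast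
    from emeasure_bounded_finite[OF this] show "emeasure lborel (A j) \<noteq> \<infinity>" by simp
  qed
  moreover have "emeasure lborel (\<Inter>j. A j) = 0"
  proof -
    have "(\<Inter>j. A j) \<subseteq> Q"
    proof
      fix x assume x: "x \<in> (\<Inter>j. A j)"
      have "hdist Q x \<le> 0"
      proof (rule ccontr)
        assume "\<not> ?thesis"
        then obtain j where "1 / real (Suc j) < hdist Q x"
          using nat_approx_posE[of "hdist Q x"] by auto
        moreover have "hdist Q x < 1 / real (Suc j)" using x by (auto simp: A_def)
        ultimately show False by simp
      qed
      then have "hdist Q x = 0" by (simp add: hdist_def infdist_nonneg antisym)
      then show "x \<in> Q" using hdist_eq_0[OF Q(1-3)] by simp
    qed
    moreover have "(\<Inter>j. A j) \<in> sets lborel" using Am by auto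
    ultimately show ?thesis using Q(5) by (meson null_setsD1 null_sets_subset)
  qed
  ultimately have "(\<lambda>j. emeasure lborel (A j)) \<longlonglongrightarrow> 0" by simp
  then have "\<forall>\<^sub>F j in sequentially. emeasure lborel (A j) < ennreal (\<mu> / K1)"
    using \<mu> K1 by (intro order_tendstoD(2)[of _ 0]) auto
  then obtain j where j: "emeasure lborel (A j) < ennreal (\<mu> / K1)"
    by (auto simp: eventually_sequentially)
  have "1 / real (Suc j) > 0" by simp
  then obtain \<theta> C where \<theta>: "regular C \<theta>" "\<And>x. 0 \<le> \<theta> x \<and> \<theta> x \<le> 1"
    "\<And>x. hdist Q x = 0 \<Longrightarrow> \<theta> x = 1" "\<And>x. hdist Q x \<ge> 1 / real (Suc j) \<Longrightarrow> \<theta> x = 0"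
    using cutoff[of "1 / real (Suc j)" Q] by metis
  define g where "g x = K1 * \<theta> x" for x
  have g: "regular (K1 * C) g" unfolding g_def using K1 \<theta>(1) by (intro regular_cmult) auto
  have g0: "0 \<le> g x" and gK: "g x \<le> K1" for x using \<theta>(2)[of x] K1 by (auto simp: g_def mult_left_le)
  have gm: "slab_mass g < ennreal \<mu>"
  proof -
    have "slab_mass g \<le> (\<integral>\<^sup>+x. ennreal K1 * indicator (A j) x \<partial>lborel)"
      unfolding slab_mass_def
    proof (rule nn_integral_mono)
      fix x
      show "ennreal (g x) * indicator slab x \<le> ennreal K1 * indicator (A j) x"
        using \<theta>(4)[of x] gK[of x] by (auto simp: A_def g_def indicator_def not_le ennreal_leI)
    qed
    also have "\<dots> = ennreal K1 * emeasure lborel (A j)"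
      using Am by (intro nn_integral_cmult_indicator) auto
    also have "\<dots> < ennreal K1 * ennreal (\<mu> / K1)"
      using j K1 by (intro ennreal_mult_strict_left_mono) auto
    also have "\<dots> = ennreal \<mu>"
      using K1 \<mu> by (simp add: ennreal_mult[symmetric])
    finally show ?thesis .
  qed
  obtain v where v: "regular (K1 * C) v" "\<And>x. 0 \<le> v x" "\<And>x. v x \<le> K1" "slab_mass v \<le> slab_mass g"
    "\<And>x. \<bar>NL v x - (g x - v x)\<bar> \<le> \<epsilon>1"
    using approx_resolvent[OF g g0 gK \<epsilon>1(1)] by blast
  have vK: "\<bar>v x\<bar> \<le> K1" for x using v(2,3)[of x] by simp
  have comp: "NL_computable v x" for x by (rule regular_computable[OF v(1) vK])
  have NLb: "\<bar>NL v x\<bar> \<le> 2 * K1 + 1" for x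
    using v(5)[of x] v(2,3)[of x] g0[of x] gK[of x] \<epsilon>1 K1 unfolding abs_le_iff by linarith
  have Hv: "\<bar>v x - v y\<bar> \<le> H * dist x y powr s" for x y
    unfolding H_def using K1
    by (intro vertical_Holder[OF regularD(1)[OF v(1)] regular_continuous[OF v(1)] _ vK _ comp NLb]) auto
  have vs: "v x \<le> \<epsilon>0" for x
    by (rule small_if_slab_mass_small[OF regularD(1)[OF v(1)] v(2) regular_continuous[OF v(1)] less_imp_le[OF H] Hv r rH \<epsilon>0(1)])
      (use gm v(4) in \<open>auto simp: \<mu>_def\<close>)
  have "barrier \<epsilon> v"
    unfolding barrier_def
  proof (intro conjI allI)
    show "vertical v" by (rule regularD(1)[OF v(1)])
    show "\<bar>v x\<bar> \<le> \<epsilon>" for x using v(2)[of x] vs[of x] \<epsilon>0 \<epsilon>1 \<epsilon> by linarith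
    show "NL_computable v x" for x by (rule comp)
    show "- \<epsilon> \<le> NL v x" for x
      using v(5)[of x] vs[of x] g0[of x] \<epsilon>0 \<epsilon>1 unfolding abs_le_iff by linarith
    show "\<bar>v x - v y\<bar> \<le> \<epsilon> * dist x y powr s\<^sup>2" for x y
    proof -
      define D where "D = \<bar>v x - v y\<bar>"
      have D: "0 \<le> D" "D \<le> 2 * \<epsilon>0" "D \<le> H * dist x y powr s"
        using v(2)[of x] v(2)[of y] vs[of x] vs[of y] \<epsilon>0 Hv[of x y] by (auto simp: D_def abs_le_iff)
      have "D = D powr (1 - s) * D powr s"
        using D(1) by (simp add: powr_add[symmetric])
      also have "\<dots> \<le> (2 * \<epsilon>0) powr (1 - s) * (H * dist x y powr s) powr s"
        using D s_pos s_less by (intro mult_mono powr_mono2) auto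
      also have "\<dots> = (2 * \<epsilon>0) powr (1 - s) * H powr s * dist x y powr s\<^sup>2"
        using H by (simp add: powr_mult powr_powr power2_eq_square)
      also have "\<dots> \<le> \<epsilon> * dist x y powr s\<^sup>2"
        using interp by (rule mult_right_mono) simp
      finally show ?thesis by (simp add: D_def)
    qed
  qed
  moreover have "K \<le> NL v x" if "x \<in> Q" for x
  proof -
    have "g x = K1" using \<theta>(3)[of x] hdist_eq_0[OF Q(1-3), of x] that by (simp add: g_def)
    then show ?thesis using v(5)[of x] vs[of x] \<epsilon>0 \<epsilon>1 unfolding abs_le_iff K1_def by linarith
  qed
  ultimately show thesis by (rule that)
qed

section \<open>Dominating a function by barriers\<close>

text \<open>
  Here \<open>G\<close> stands for the excess of the right-hand side over its essential bound.  The sets \<open>E\<close> on which it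
  can be compensated by arbitrarily small barriers are stable under finite unions; the aim is to
  reach a whole cylinder by a Baire category argument.
\<close>

definition dominated :: "('a \<Rightarrow> real) \<Rightarrow> 'a set \<Rightarrow> bool" where
  "dominated G E \<longleftrightarrow> (\<forall>\<epsilon>>0. \<exists>v. barrier \<epsilon> v \<and> (\<forall>x\<in>E. G x - \<epsilon> \<le> NL v x))"

definition vertical_set :: "'a set \<Rightarrow> bool" where
  "vertical_set E \<longleftrightarrow> (\<forall>x t. x \<in> E \<longrightarrow> x + t *\<^sub>R en \<in> E)"

lemma zero_barrier: "\<epsilon> \<ge> 0 \<Longrightarrow> barrier \<epsilon> (\<lambda>_. 0)" "NL (\<lambda>_. 0) x = 0"
proof -
  show *: "NL (\<lambda>_. 0) x = 0" for x
    by (simp add: NL_def frac_laplacian_def frac_integrand_def)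
  have "NL_computable (\<lambda>_. 0) x" for x
    unfolding NL_computable_def frac_integrand_def[abs_def] by simp
  then show "\<epsilon> \<ge> 0 \<Longrightarrow> barrier \<epsilon> (\<lambda>_. 0)"
    unfolding barrier_def vertical_def * by simp
qed

lemma barrier_mono:
  assumes v: "barrier \<epsilon> v" and le: "\<epsilon> \<le> \<epsilon>'"
  shows "barrier \<epsilon>' v"
  unfolding barrier_def
proof (intro conjI allI)
  show "vertical v" "NL_computable v x" for x by (rule barrierD[OF v])+
  show "\<bar>v x\<bar> \<le> \<epsilon>'" "- \<epsilon>' \<le> NL v x" for x
    using barrierD(2)[OF v, of x] barrierD(5)[OF v, of x] le by linarith+
  show "\<bar>v x - v y\<bar> \<le> \<epsilon>' * dist x y powr s\<^sup>2" for x y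
    by (rule order_trans[OF barrierD(3)[OF v] mult_right_mono[OF le]]) simp
qed

lemma barrier_add:
  assumes v: "barrier \<epsilon> v" and w: "barrier \<epsilon>' w"
  shows "barrier (\<epsilon> + \<epsilon>') (\<lambda>x. v x + w x)" "NL (\<lambda>x. v x + w x) x = NL v x + NL w x"
proof -
  show *: "NL (\<lambda>x. v x + w x) x = NL v x + NL w x" for x
    by (rule NL_add(2)[OF barrierD(4)[OF v] barrierD(4)[OF w]])
  show "barrier (\<epsilon> + \<epsilon>') (\<lambda>x. v x + w x)"
    unfolding barrier_def
  proof (intro conjI allI)
    show "vertical (\<lambda>x. v x + w x)"
      using barrierD(1)[OF v] barrierD(1)[OF w] by (simp add: vertical_def)
    show "\<bar>v x + w x\<bar> \<le> \<epsilon> + \<epsilon>'" for x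
      using barrierD(2)[OF v, of x] barrierD(2)[OF w, of x] by linarith
    show "\<bar>v x + w x - (v y + w y)\<bar> \<le> (\<epsilon> + \<epsilon>') * dist x y powr s\<^sup>2" for x y
      using barrierD(3)[OF v, of x y] barrierD(3)[OF w, of x y] by (simp add: distrib_right)
    show "NL_computable (\<lambda>x. v x + w x) x" for x
      by (rule NL_add(1)[OF barrierD(4)[OF v] barrierD(4)[OF w]])
    show "- (\<epsilon> + \<epsilon>') \<le> NL (\<lambda>x. v x + w x) x" for x
      using barrierD(5)[OF v, of x] barrierD(5)[OF w, of x] by (simp add: *)
  qed
qed

lemma dominated_subset: "dominated G E \<Longrightarrow> E' \<subseteq> E \<Longrightarrow> dominated G E'"
  unfolding dominated_def by (meson subsetD)

lemma dominated_nonpos: "(\<And>x. x \<in> E \<Longrightarrow> G x \<le> 0) \<Longrightarrow> dominated G E"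
  unfolding dominated_def using zero_barrier by (fastforce intro!: exI[of _ "\<lambda>_. 0"])

lemma dominated_Un:
  assumes "dominated G E" "dominated G E'"
  shows "dominated G (E \<union> E')"
  unfolding dominated_def
proof (intro allI impI)
  fix \<epsilon> :: real assume "\<epsilon> > 0"
  then have e: "\<epsilon> / 2 > 0" by simp
  obtain v where v: "barrier (\<epsilon> / 2) v" "\<And>x. x \<in> E \<Longrightarrow> G x - \<epsilon> / 2 \<le> NL v x"
    using assms(1) e unfolding dominated_def by blast
  obtain w where w: "barrier (\<epsilon> / 2) w" "\<And>x. x \<in> E' \<Longrightarrow> G x - \<epsilon> / 2 \<le> NL w x"
    using assms(2) e unfolding dominated_def by blast
  have "G x - \<epsilon> \<le> NL (\<lambda>x. v x + w x) x" if "x \<in> E \<union> E'" for x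
    using that v(2)[of x] w(2)[of x] barrierD(5)[OF v(1), of x] barrierD(5)[OF w(1), of x]
    by (auto simp: barrier_add(2)[OF v(1) w(1)])
  then show "\<exists>v. barrier \<epsilon> v \<and> (\<forall>x\<in>E \<union> E'. G x - \<epsilon> \<le> NL v x)"
    using barrier_add(1)[OF v(1) w(1)] by (intro exI[of _ "\<lambda>x. v x + w x"]) auto
qed

lemma dominated_UN: "finite J \<Longrightarrow> (\<And>j. j \<in> J \<Longrightarrow> dominated G (E j)) \<Longrightarrow> dominated G (\<Union>j\<in>J. E j)"
  by (induction J rule: finite_induct) (auto intro: dominated_nonpos dominated_Un)

text \<open>
  The error in the product rule is itself the nonlocal operator of a function,
  \<open>\<lambda>y. \<theta> y * v y - \<theta> x * v y\<close>, so \<open>NL_small\<close> applies to it at the point \<open>x\<close>.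
\<close>

lemma cutoff_barrier:
  assumes \<theta>: "regular C \<theta>" "\<And>x. 0 \<le> \<theta> x \<and> \<theta> x \<le> 1"
  shows "\<exists>D>0. \<forall>\<epsilon> v. \<epsilon> > 0 \<longrightarrow> barrier \<epsilon> v \<longrightarrow>
    barrier (D * \<epsilon>) (\<lambda>x. \<theta> x * v x) \<and> (\<forall>x. \<theta> x * NL v x - D * \<epsilon> \<le> NL (\<lambda>x. \<theta> x * v x) x)"
proof -
  have C: "C \<ge> 0" by (rule regular_nonneg[OF \<theta>(1)])
  define E where "E = max C 4 + 2 * max C 2"
  define D where "D = 1 + max 1 C + E * NL_mass"
  have E: "E \<ge> 0" using C by (simp add: E_def)
  have D: "D > 0" using E NL_mass_nonneg by (simp add: D_def add_pos_nonneg)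
  have c\<theta>: "continuous_on UNIV \<theta>" by (rule regular_continuous[OF \<theta>(1)])
  have key: "barrier (D * \<epsilon>) (\<lambda>x. \<theta> x * v x) \<and> (\<forall>x. \<theta> x * NL v x - D * \<epsilon> \<le> NL (\<lambda>x. \<theta> x * v x) x)"
    if \<epsilon>: "\<epsilon> > 0" and v: "barrier \<epsilon> v" for \<epsilon> v
  proof -
    have cv: "continuous_on UNIV v" by (rule barrier_continuous[OF v])
    have NLx: "NL_computable (\<lambda>x. \<theta> x * v x) x \<and> \<bar>NL (\<lambda>x. \<theta> x * v x) x - \<theta> x * NL v x\<bar> \<le> \<epsilon> * E * NL_mass" for x
    proof -
      define w where "w y = \<theta> y * v y - \<theta> x * v y" for y
      have cw: "continuous_on UNIV w"
        unfolding w_def by (intro continuous_intros c\<theta> cv)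
      have bd: "\<bar>second_diff w x h\<bar> \<le> \<epsilon> * E * min 1 (norm h powr (1 + s\<^sup>2))" for h
      proof -
        define q where "q = min 1 (norm h powr (1 + s\<^sup>2))"
        have cross: "\<bar>\<theta> (x + k) - \<theta> x\<bar> * \<bar>v (x + k) - v x\<bar> \<le> max C 2 * \<epsilon> * q" if k: "norm k = norm h" for k
        proof (cases "norm h \<le> 1")
          case True
          have "\<bar>\<theta> (x + k) - \<theta> x\<bar> * \<bar>v (x + k) - v x\<bar> \<le> (C * norm h) * (\<epsilon> * norm h powr s\<^sup>2)"
            using regularD(2)[OF \<theta>(1), of "x + k" x] barrierD(3)[OF v, of "x + k" x] C k
            by (intro mult_mono) (auto simp: dist_norm)
          also have "\<dots> = C * \<epsilon> * norm h powr (1 + s\<^sup>2)"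
            by (simp add: powr_add mult_ac)
          also have "\<dots> \<le> max C 2 * \<epsilon> * norm h powr (1 + s\<^sup>2)"
            using \<epsilon> by (intro mult_right_mono) auto
          also have "norm h powr (1 + s\<^sup>2) = q"
            using True by (simp add: q_def min_def powr_le1 antisym)
          finally show ?thesis .
        next
          case False
          have "\<bar>\<theta> (x + k) - \<theta> x\<bar> * \<bar>v (x + k) - v x\<bar> \<le> 1 * (2 * \<epsilon>)"
            using \<theta>(2)[of "x + k"] \<theta>(2)[of x] barrierD(2)[OF v, of "x + k"] barrierD(2)[OF v, of x]
            by (intro mult_mono) auto
          also have "\<dots> \<le> max C 2 * \<epsilon> * 1" using \<epsilon> by simp
          also have "1 = q" using False by (simp add: q_def min_def ge_one_powr_ge_zero)
          finally show ?thesis by simp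
        qed
        have "\<bar>v x * second_diff \<theta> x h\<bar> \<le> \<epsilon> * (max C 4 * q)"
          unfolding abs_mult q_def using regular_second_diff_bound[OF \<theta>(1), of 1 x h] \<theta>(2) barrierD(2)[OF v, of x] \<epsilon>
          by (intro mult_mono) (auto simp: abs_le_iff)
        moreover have "second_diff w x h = v x * second_diff \<theta> x h
            - (\<theta> (x + h) - \<theta> x) * (v (x + h) - v x) - (\<theta> (x + - h) - \<theta> x) * (v (x + - h) - v x)"
          by (simp add: second_diff_def w_def algebra_simps)
        ultimately have "\<bar>second_diff w x h\<bar> \<le> \<epsilon> * (max C 4 * q) + max C 2 * \<epsilon> * q + max C 2 * \<epsilon> * q"
          using cross[of h] cross[of "- h"] unfolding abs_mult[symmetric] norm_minus_cancel by linarith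
        then show ?thesis by (simp add: E_def q_def algebra_simps)
      qed
      note w = NL_small[OF cw bd]
      note c = NL_cmult[OF barrierD(4)[OF v], of "\<theta> x" x]
      have eq: "(\<lambda>y. w y + \<theta> x * v y) = (\<lambda>y. \<theta> y * v y)" by (simp add: w_def)
      show ?thesis
        using NL_add[OF w(1) c(1)] w(2) c(2) by (simp add: eq)
    qed
    have le: "\<epsilon> * E * NL_mass \<le> D * \<epsilon> - \<epsilon>"
      using C \<epsilon> by (simp add: D_def algebra_simps)
    have low: "\<theta> x * NL v x - D * \<epsilon> \<le> NL (\<lambda>x. \<theta> x * v x) x" for x
      using NLx[of x] le \<epsilon> by (auto simp: abs_le_iff)
    have "barrier (D * \<epsilon>) (\<lambda>x. \<theta> x * v x)"
      unfolding barrier_def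
    proof (intro conjI allI)
      show "vertical (\<lambda>x. \<theta> x * v x)"
        using barrierD(1)[OF v] regularD(1)[OF \<theta>(1)] by (simp add: vertical_def)
      have D1: "1 \<le> D" using E NL_mass_nonneg by (simp add: D_def)
      show "\<bar>\<theta> x * v x\<bar> \<le> D * \<epsilon>" for x
      proof -
        have "\<bar>\<theta> x * v x\<bar> \<le> D * \<epsilon>"
          unfolding abs_mult using \<theta>(2)[of x] barrierD(2)[OF v, of x] D1 by (intro mult_mono) auto
        then show ?thesis .
      qed
      show "NL_computable (\<lambda>x. \<theta> x * v x) x" for x using NLx by blast
      show "- (D * \<epsilon>) \<le> NL (\<lambda>x. \<theta> x * v x) x" for x
      proof -
        have "- \<epsilon> \<le> \<theta> x * NL v x"
        proof (cases "NL v x \<ge> 0")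
          case True
          then show ?thesis using \<theta>(2)[of x] \<epsilon> by (meson less_imp_le mult_nonneg_nonneg neg_le_0_iff_le order_trans)
        next
          case False
          then have "1 * NL v x \<le> \<theta> x * NL v x" using \<theta>(2)[of x] by (intro mult_right_mono_neg) auto
          then show ?thesis using barrierD(5)[OF v, of x] by linarith
        qed
        then show ?thesis using NLx[of x] le by (auto simp: abs_le_iff)
      qed
      show "\<bar>\<theta> x * v x - \<theta> y * v y\<bar> \<le> D * \<epsilon> * dist x y powr s\<^sup>2" for x y
      proof -
        define p where "p = dist x y powr s\<^sup>2"
        have t: "\<bar>\<theta> x - \<theta> y\<bar> \<le> max 1 C * p"
        proof (cases "dist x y \<le> 1")
          case True
          have "dist x y powr 1 \<le> dist x y powr s\<^sup>2"
            using powr_mono'[of "s\<^sup>2" 1 "dist x y"] True s_sq by simp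
          then have "C * dist x y \<le> max 1 C * p"
            unfolding p_def using C by (intro mult_mono) auto
          then show ?thesis using regularD(2)[OF \<theta>(1), of x y] by linarith
        next
          case False
          then have "1 \<le> p" unfolding p_def by (intro ge_one_powr_ge_zero) auto
          then have "1 * 1 \<le> max 1 C * p" by (intro mult_mono) auto
          then show ?thesis using \<theta>(2)[of x] \<theta>(2)[of y] by (simp add: abs_le_iff)
        qed
        have "\<bar>\<theta> x * v x - \<theta> y * v y\<bar> = \<bar>\<theta> x * (v x - v y) + (\<theta> x - \<theta> y) * v y\<bar>"
          by (simp add: algebra_simps)
        also have "\<dots> \<le> \<bar>\<theta> x\<bar> * \<bar>v x - v y\<bar> + \<bar>\<theta> x - \<theta> y\<bar> * \<bar>v y\<bar>"
          unfolding abs_mult[symmetric] by (rule abs_triangle_ineq)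
        also have "\<dots> \<le> 1 * (\<epsilon> * p) + max 1 C * p * \<epsilon>"
          using \<theta>(2)[of x] barrierD(3)[OF v, of x y] t barrierD(2)[OF v, of y] \<epsilon>
          unfolding p_def[symmetric] by (intro add_mono mult_mono) auto
        also have "\<dots> = (1 + max 1 C) * \<epsilon> * p" by (simp add: algebra_simps)
        also have "\<dots> \<le> D * \<epsilon> * p"
          using \<epsilon> E NL_mass_nonneg by (intro mult_right_mono) (auto simp: D_def p_def)
        finally show ?thesis by (simp add: p_def)
      qed
    qed
    then show ?thesis using low by blast
  qed
  show ?thesis using D key by blast
qed

lemma hdist_vertical_set: "vertical_set E \<Longrightarrow> x \<in> E \<Longrightarrow> hdist E x = 0"
proof -
  assume "vertical_set E" "x \<in> E"
  then have "x + (- (x \<bullet> en)) *\<^sub>R en \<in> E" unfolding vertical_set_def by blast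
  then have "proj x \<in> E" by (simp add: proj_def)
  then show ?thesis by (simp add: hdist_def)
qed

lemma dominated_localized:
  assumes E: "dominated G E" "vertical_set E" and r: "r > 0" and \<epsilon>: "\<epsilon> > 0"
  obtains v where "barrier \<epsilon> v" "\<And>x. E = {} \<or> hdist E x \<ge> r \<Longrightarrow> v x = 0" "\<And>x. x \<in> E \<Longrightarrow> G x - \<epsilon> \<le> NL v x"
proof (cases "E = {}")
  case True
  then show thesis using that[of "\<lambda>_. 0"] zero_barrier(1)[of \<epsilon>] \<epsilon> by simp
next
  case False
  obtain \<theta> C where \<theta>: "regular C \<theta>" "\<And>x. 0 \<le> \<theta> x \<and> \<theta> x \<le> 1"
    "\<And>x. hdist E x = 0 \<Longrightarrow> \<theta> x = 1" "\<And>x. hdist E x \<ge> r \<Longrightarrow> \<theta> x = 0"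
    using cutoff[OF r, of E] by metis
  obtain D where D: "D > 0" "\<And>\<epsilon> v. \<epsilon> > 0 \<Longrightarrow> barrier \<epsilon> v \<Longrightarrow> barrier (D * \<epsilon>) (\<lambda>x. \<theta> x * v x)"
    "\<And>\<epsilon> v x. \<epsilon> > 0 \<Longrightarrow> barrier \<epsilon> v \<Longrightarrow> \<theta> x * NL v x - D * \<epsilon> \<le> NL (\<lambda>x. \<theta> x * v x) x"
    using cutoff_barrier[OF \<theta>(1,2)] by blast
  define \<epsilon>' where "\<epsilon>' = \<epsilon> / (D + 1)"
  have "(D + 1) * \<epsilon>' = \<epsilon>" using D(1) by (simp add: \<epsilon>'_def)
  then have \<epsilon>': "\<epsilon>' > 0" "D * \<epsilon>' + \<epsilon>' = \<epsilon>"
    using \<epsilon> D(1) by (simp add: \<epsilon>'_def, simp only: distrib_right mult_1)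
  obtain v where v: "barrier \<epsilon>' v" "\<And>x. x \<in> E \<Longrightarrow> G x - \<epsilon>' \<le> NL v x"
    using E(1) \<epsilon>'(1) unfolding dominated_def by blast
  show thesis
  proof (rule that)
    show "barrier \<epsilon> (\<lambda>x. \<theta> x * v x)"
      using D(2)[OF \<epsilon>'(1) v(1)] by (rule barrier_mono) (use \<epsilon>' in linarith)
    show "\<theta> x * v x = 0" if "E = {} \<or> hdist E x \<ge> r" for x
      using that False \<theta>(4)[of x] by auto
    show "G x - \<epsilon> \<le> NL (\<lambda>x. \<theta> x * v x) x" if "x \<in> E" for x
      using D(3)[OF \<epsilon>'(1) v(1), of x] v(2)[OF that] \<theta>(3)[OF hdist_vertical_set[OF E(2) that]] \<epsilon>' by simp
  qed
qed

text \<open>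
  The barrier \<open>v j\<close> lives in the shell at distance about \<open>2 powr (- j)\<close> from \<open>P\<close> and is at most
  \<open>\<epsilon>\<close> times the square of that distance.  At a point of \<open>P\<close> the sum is therefore \<open>O((norm h)\<^sup>2)\<close> and its operator is small.
  At any other point, finitely many shells contribute their own operators, and the shells much
  closer to \<open>P\<close> are again \<open>O((norm h)\<^sup>2)\<close>.
\<close>

lemma sum_of_shell_barriers:
  assumes P: "P \<noteq> {}" and \<epsilon>: "\<epsilon> > 0"
    and v: "\<And>j. barrier (\<epsilon> * (1/2) ^ (j + 1) * ((1/2) ^ (j + 2))\<^sup>2) (v j)"
    and supp: "\<And>j x. v j x \<noteq> 0 \<Longrightarrow> (1/2) ^ (j + 2) < hdist P x \<and> hdist P x < 2 * (1/2) ^ j"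
  shows "\<exists>V. barrier (\<epsilon> * (1 + 2 * NL_mass)) V
    \<and> (\<forall>x j. hdist P x > 0 \<longrightarrow> NL (v j) x - \<epsilon> * (1 + 2 * NL_mass) \<le> NL V x)"
proof -
  define \<eta> where "\<eta> j = \<epsilon> * (1/2) ^ (j + 1) * ((1/2) ^ (j + 2))\<^sup>2" for j :: nat
  define c where "c j = \<epsilon> * (1/2) ^ (j + 1)" for j :: nat
  have \<eta>0: "\<eta> j > 0" for j using \<epsilon> by (simp add: \<eta>_def)
  have c0: "c j > 0" for j using \<epsilon> by (simp add: c_def)
  have q1: "((1/2) ^ (j + 2))\<^sup>2 \<le> (1::real)" for j by (intro power_le_one) auto
  have \<eta>c: "\<eta> j \<le> c j" for j
    using mult_left_mono[OF q1[of j] less_imp_le[OF c0[of j]]] by (simp add: \<eta>_def c_def)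
  have vb: "barrier (\<eta> j) (v j)" for j using v[of j] by (simp add: \<eta>_def)
  have csums: "c sums \<epsilon>"
    unfolding c_def using sums_mult[OF power_half_series, of \<epsilon>] by (simp add: One_nat_def)
  have csum: "summable c" and csuminf: "suminf c = \<epsilon>" using csums by (auto simp: sums_iff)
  have cJ: "summable (\<lambda>j. c (j + J))" for J using csum by (rule summable_ignore_initial_segment)
  have cJ_le: "(\<Sum>j. c (j + J)) \<le> \<epsilon>" for J
    using suminf_split_initial_segment[OF csum, of J] sum_nonneg[of "{..<J}" c] c0 csuminf by (simp add: less_imp_le)
  have vabs: "\<bar>v j x\<bar> \<le> c j" for j x
    using barrierD(2)[OF vb, of j x] \<eta>c[of j] by linarith
  have vsum: "summable (\<lambda>j. v (j + J) x)" for J x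
    by (rule summable_comparison_test'[OF cJ[of J]]) (use vabs in auto)
  have vdiff: "\<bar>v j x - v j y\<bar> \<le> c j * dist x y powr s\<^sup>2" for j x y
    using barrierD(3)[OF vb, of j x y] mult_right_mono[OF \<eta>c[of j], of "dist x y powr s\<^sup>2"] by simp
  define T where "T J x = (\<Sum>j. v (j + J) x)" for J x
  have THolder: "\<bar>T J x - T J y\<bar> \<le> \<epsilon> * dist x y powr s\<^sup>2" for J x y
  proof -
    have "T J x - T J y = (\<Sum>j. v (j + J) x - v (j + J) y)"
      unfolding T_def by (rule suminf_diff[OF vsum vsum])
    also have "\<bar>\<dots>\<bar> \<le> (\<Sum>j. c (j + J) * dist x y powr s\<^sup>2)"
      using norm_suminf_le[OF _ summable_mult2[OF cJ[of J]], of "\<lambda>j. v (j + J) x - v (j + J) y"] vdiff by simp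
    also have "\<dots> = (\<Sum>j. c (j + J)) * dist x y powr s\<^sup>2"
      by (rule suminf_mult2[OF cJ, symmetric])
    also have "\<dots> \<le> \<epsilon> * dist x y powr s\<^sup>2"
      using cJ_le by (rule mult_right_mono) simp
    finally show ?thesis .
  qed
  have Tcont: "continuous_on UNIV (T J)" for J
    using Holder_continuous[OF THolder] s_sq by blast
  define V where "V = T 0"
  have V: "V x = (\<Sum>j<J. v j x) + T J x" for x J
    unfolding V_def T_def using suminf_split_initial_segment[OF vsum[of 0 x], of J] by simp
  have V': "V = (\<lambda>x. (\<Sum>j<J. v j x) + T J x)" for J using V by blast
  \<comment> \<open>A shell that stays at distance \<open>(1/2) ^ (j + 2)\<close> from \<open>x\<close> has size at most \<open>c j * (norm h)\<^sup>2\<close> as seen from \<open>x\<close>.\<close>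
  have tail: "NL_computable (T J) x \<and> \<bar>NL (T J) x\<bar> \<le> 2 * \<epsilon> * NL_mass"
    if x0: "\<And>j. j \<ge> J \<Longrightarrow> v j x = 0" and xh: "\<And>j h. j \<ge> J \<Longrightarrow> v j (x + h) \<noteq> 0 \<Longrightarrow> (1/2) ^ (j + 2) \<le> norm h" for J x
  proof -
    have vh: "\<bar>v j (x + h)\<bar> \<le> c j * min 1 ((norm h)\<^sup>2)" if "j \<ge> J" for j h
    proof (cases "v j (x + h) = 0")
      case True
      then show ?thesis using c0[of j] by (simp add: min_def)
    next
      case False
      have "((1/2) ^ (j + 2))\<^sup>2 \<le> (norm h)\<^sup>2"
        using xh[OF that False] by (intro power_mono) auto
      then have "c j * ((1/2) ^ (j + 2))\<^sup>2 \<le> c j * min 1 ((norm h)\<^sup>2)"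
        using q1[of j] c0[of j] by (intro mult_left_mono) auto
      then show ?thesis
        using barrierD(2)[OF vb, of j "x + h"] by (simp add: \<eta>_def c_def)
    qed
    have Th: "\<bar>T J (x + h)\<bar> \<le> \<epsilon> * min 1 ((norm h)\<^sup>2)" for h
    proof -
      have "\<bar>T J (x + h)\<bar> \<le> (\<Sum>j. c (j + J) * min 1 ((norm h)\<^sup>2))"
        unfolding T_def using norm_suminf_le[OF _ summable_mult2[OF cJ[of J]], of "\<lambda>j. v (j + J) (x + h)"] vh by simp
      also have "\<dots> = (\<Sum>j. c (j + J)) * min 1 ((norm h)\<^sup>2)"
        by (rule suminf_mult2[OF cJ, symmetric])
      also have "\<dots> \<le> \<epsilon> * min 1 ((norm h)\<^sup>2)"
        using cJ_le by (rule mult_right_mono) simp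
      finally show ?thesis .
    qed
    have Tx: "T J x = 0" using x0 by (simp add: T_def)
    have "\<bar>second_diff (T J) x h\<bar> \<le> 2 * \<epsilon> * min 1 (norm h powr (1 + s\<^sup>2))" for h
    proof -
      have "\<bar>second_diff (T J) x h\<bar> \<le> 2 * \<epsilon> * min 1 ((norm h)\<^sup>2)"
        using Th[of h] Th[of "- h"] by (simp add: second_diff_def Tx)
      also have "\<dots> \<le> 2 * \<epsilon> * min 1 (norm h powr (1 + s\<^sup>2))"
        using \<epsilon> min_sq_le[of "norm h"] by (intro mult_left_mono) auto
      finally show ?thesis .
    qed
    from NL_small[OF Tcont this] show ?thesis by simp
  qed
  have far: "\<exists>J\<ge>J0. NL_computable (T J) x \<and> \<bar>NL (T J) x\<bar> \<le> 2 * \<epsilon> * NL_mass" if "hdist P x > 0" for x J0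
  proof -
    have "(\<lambda>J. 4 * (1/2) ^ J) \<longlonglongrightarrow> 4 * (0::real)"
      by (intro tendsto_intros LIMSEQ_realpow_zero) auto
    then have "\<forall>\<^sub>F J in sequentially. 4 * (1/2) ^ J < hdist P x"
      using that by (intro order_tendstoD(2)[of _ "4 * (0::real)"]) auto
    then obtain J where J: "\<And>J'. J' \<ge> J \<Longrightarrow> 4 * (1/2) ^ J' < hdist P x"
      by (auto simp: eventually_sequentially)
    have "NL_computable (T (max J J0)) x \<and> \<bar>NL (T (max J J0)) x\<bar> \<le> 2 * \<epsilon> * NL_mass"
    proof (rule tail)
      fix j assume j: "j \<ge> max J J0"
      have p: "4 * (1/2) ^ j < hdist P x" "(0::real) < (1/2) ^ j" using J[of j] j by auto
      show "v j x = 0" using supp[of j x] p by fastforce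
      fix h assume "v j (x + h) \<noteq> 0"
      then have "hdist P (x + h) < 2 * (1/2) ^ j" using supp by blast
      then have "2 * (1/2) ^ j \<le> norm h"
        using hdist_Lipschitz[of P x "x + h"] p by (simp add: dist_norm abs_le_iff)
      moreover have "(1/2) ^ (j + 2) \<le> 2 * (1/2 :: real) ^ j" by (simp add: power_add)
      ultimately show "(1/2) ^ (j + 2) \<le> norm h" by linarith
    qed
    then show ?thesis by (intro exI[of _ "max J J0"]) auto
  qed
  have fin: "NL_computable V x \<and> NL V x = (\<Sum>j<J. NL (v j) x) + NL (T J) x" if "NL_computable (T J) x" for J x
    using NL_add[OF _ that, of "\<lambda>x. \<Sum>j<J. v j x"] NL_sum[of "{..<J}" v x] barrierD(4)[OF vb]
    unfolding V'[of J] by auto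
  have partial: "(\<Sum>j<J. c j) \<le> \<epsilon>" for J
    using sum_le_suminf[OF csum, of "{..<J}"] c0 csuminf by (simp add: less_imp_le)
  have NLv: "- c j \<le> NL (v j) x" for j x
    using barrierD(5)[OF vb, of j x] \<eta>c[of j] by linarith
  show ?thesis
  proof (intro exI[of _ V] conjI allI impI)
    show "NL (v j) x - \<epsilon> * (1 + 2 * NL_mass) \<le> NL V x" if pos: "hdist P x > 0" for x j
    proof -
      obtain J where J: "J \<ge> Suc j" "NL_computable (T J) x" "\<bar>NL (T J) x\<bar> \<le> 2 * \<epsilon> * NL_mass"
        using far[OF pos] by blast
      have "NL (v j) x - \<epsilon> \<le> NL (v j) x - (\<Sum>i\<in>{..<J} - {j}. c i)"
        using partial[of J] sum_mono2[of "{..<J}" "{..<J} - {j}" c] c0 by (fastforce simp: less_imp_le)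
      also have "\<dots> \<le> NL (v j) x + (\<Sum>i\<in>{..<J} - {j}. NL (v i) x)"
        using sum_mono[of "{..<J} - {j}" "\<lambda>i. - c i" "\<lambda>i. NL (v i) x"] NLv by (simp add: sum_negf)
      also have "\<dots> = (\<Sum>i<J. NL (v i) x)"
        using J(1) by (subst (2) sum.remove[of _ j]) auto
      finally show ?thesis using fin[OF J(2)] J(3) by (simp add: algebra_simps abs_le_iff)
    qed
    show "barrier (\<epsilon> * (1 + 2 * NL_mass)) V"
      unfolding barrier_def
    proof (intro conjI allI)
      have le: "\<epsilon> \<le> \<epsilon> * (1 + 2 * NL_mass)" using \<epsilon> NL_mass_nonneg by simp
      show "vertical V"
        using barrierD(1)[OF vb] by (simp add: vertical_def V_def T_def)
      show "\<bar>V x\<bar> \<le> \<epsilon> * (1 + 2 * NL_mass)" for x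
      proof -
        have "\<bar>V x\<bar> \<le> (\<Sum>j. c j)"
          unfolding V_def T_def using norm_suminf_le[OF _ csum, of "\<lambda>j. v j x"] vabs by simp
        then show ?thesis using csuminf le by linarith
      qed
      show "\<bar>V x - V y\<bar> \<le> \<epsilon> * (1 + 2 * NL_mass) * dist x y powr s\<^sup>2" for x y
        unfolding V_def by (rule order_trans[OF THolder mult_right_mono[OF le]]) simp
      have "NL_computable V x \<and> - (\<epsilon> * (1 + 2 * NL_mass)) \<le> NL V x" for x
      proof (cases "hdist P x > 0")
        case True
        obtain J where J: "NL_computable (T J) x" "\<bar>NL (T J) x\<bar> \<le> 2 * \<epsilon> * NL_mass"
          using far[OF True] by blast
        have "- \<epsilon> \<le> (\<Sum>j<J. - c j)" using partial[of J] by (simp add: sum_negf)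
        also have "\<dots> \<le> (\<Sum>j<J. NL (v j) x)" using NLv by (intro sum_mono) auto
        finally show ?thesis using fin[OF J(1)] J(2) by (simp add: algebra_simps abs_le_iff)
      next
        case False
        then have h0: "hdist P x = 0" by (simp add: hdist_def infdist_nonneg antisym not_less)
        have "NL_computable (T 0) x \<and> \<bar>NL (T 0) x\<bar> \<le> 2 * \<epsilon> * NL_mass"
        proof (rule tail)
          fix j
          show "v j x = 0"
          proof (rule ccontr)
            assume "v j x \<noteq> 0"
            then have "(1/2 :: real) ^ (j + 2) < 0" using supp[of j x] h0 by simp
            moreover have "(0::real) < (1/2) ^ (j + 2)" by simp
            ultimately show False by linarith
          qed
          fix h assume "v j (x + h) \<noteq> 0"
          then have "(1/2) ^ (j + 2) < hdist P (x + h)" using supp by blast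
          then show "(1/2) ^ (j + 2) \<le> norm h"
            using hdist_Lipschitz[of P x "x + h"] h0 by (simp add: dist_norm)
        qed
        then show ?thesis using \<epsilon> unfolding V_def by (simp add: algebra_simps abs_le_iff)
      qed
      then show "NL_computable V x" "- (\<epsilon> * (1 + 2 * NL_mass)) \<le> NL V x" for x by auto
    qed
  qed
qed

lemma hdist_attained:
  assumes "E \<noteq> {}" "hdist E x < r"
  obtains y where "y \<in> E" "dist (proj x) y < r"
proof -
  have "Inf (dist (proj x) ` E) < r"
    using assms by (simp add: hdist_def infdist_def)
  then show thesis
    using that cInf_lessD[of "dist (proj x) ` E" r] assms(1) by auto
qed

lemma hdist_proj: "hdist P (proj x) = hdist P x"
  using verticalD[OF hdist_vertical, of P x "- (x \<bullet> en)"] by (simp add: proj_def)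

lemma dominated_shells:
  assumes P: "P \<noteq> {}" and E0: "vertical_set E0" "\<And>x. x \<in> E0 \<Longrightarrow> hdist P x \<le> 1"
    and sh: "\<And>j. dominated G {x \<in> E0. (1/2) ^ (j + 1) \<le> hdist P x \<and> hdist P x \<le> (1/2) ^ j}"
  shows "dominated G {x \<in> E0. hdist P x > 0}"
  unfolding dominated_def
proof (intro allI impI)
  fix \<epsilon> :: real assume \<epsilon>: "\<epsilon> > 0"
  define \<epsilon>' where "\<epsilon>' = \<epsilon> / (2 + 2 * NL_mass)"
  have \<epsilon>': "\<epsilon>' > 0" "\<epsilon>' * (1 + 2 * NL_mass) + \<epsilon>' = \<epsilon>"
    using \<epsilon> NL_mass_nonneg by (auto simp: \<epsilon>'_def field_simps add_nonneg_eq_0_iff intro!: divide_pos_pos)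
  define E where "E j = {x \<in> E0. (1/2) ^ (j + 1) \<le> hdist P x \<and> hdist P x \<le> (1/2) ^ j}" for j :: nat
  have vE: "vertical_set (E j)" for j
    using E0(1) verticalD[OF hdist_vertical] by (auto simp: vertical_set_def E_def)
  define \<eta> where "\<eta> j = \<epsilon>' * (1/2) ^ (j + 1) * ((1/2) ^ (j + 2))\<^sup>2" for j :: nat
  have \<eta>: "\<eta> j > 0" "\<eta> j \<le> \<epsilon>'" for j
  proof -
    show "\<eta> j > 0" using \<epsilon>' by (simp add: \<eta>_def)
    have "(1/2 :: real) ^ (j + 1) * ((1/2) ^ (j + 2))\<^sup>2 \<le> 1 * 1"
      by (intro mult_mono power_le_one) auto
    then show "\<eta> j \<le> \<epsilon>'" using \<epsilon>'(1) mult_left_mono[of _ 1 \<epsilon>'] by (fastforce simp: \<eta>_def mult.assoc)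
  qed
  have "\<exists>v. barrier (\<eta> j) v \<and> (\<forall>x. E j = {} \<or> hdist (E j) x \<ge> (1/2) ^ (j + 2) \<longrightarrow> v x = 0) \<and> (\<forall>x\<in>E j. G x - \<eta> j \<le> NL v x)" for j
  proof -
    have "dominated G (E j)" using sh by (simp add: E_def)
    from dominated_localized[OF this vE, of "(1/2) ^ (j + 2)" "\<eta> j"] \<eta>(1)[of j]
    show ?thesis by (metis zero_less_divide_1_iff zero_less_numeral zero_less_power)
  qed
  then obtain v where v: "\<And>j. barrier (\<eta> j) (v j)"
    "\<And>j x. E j = {} \<or> hdist (E j) x \<ge> (1/2) ^ (j + 2) \<Longrightarrow> v j x = 0"
    "\<And>j x. x \<in> E j \<Longrightarrow> G x - \<eta> j \<le> NL (v j) x"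
    by metis
  have supp: "(1/2) ^ (j + 2) < hdist P x \<and> hdist P x < 2 * (1/2) ^ j" if "v j x \<noteq> 0" for j x
  proof -
    have "E j \<noteq> {}" "hdist (E j) x < (1/2) ^ (j + 2)" using v(2)[of j x] that by force+
    then obtain y where y: "y \<in> E j" "dist (proj x) y < (1/2) ^ (j + 2)"
      by (rule hdist_attained)
    have "\<bar>hdist P x - hdist P y\<bar> < (1/2) ^ (j + 2)"
      using hdist_Lipschitz[of P "proj x" y] y(2) by (simp add: hdist_proj)
    moreover have "(1/2) ^ (j + 1) \<le> hdist P y" "hdist P y \<le> (1/2) ^ j" using y(1) by (auto simp: E_def)
    moreover have "(1/2 :: real) ^ (j + 1) = (1/2) ^ j / 2" "(1/2 :: real) ^ (j + 2) = (1/2) ^ j / 4"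
      by (simp_all add: power_add power2_eq_square)
    moreover have "(0::real) < (1/2) ^ j" by simp
    ultimately show ?thesis unfolding abs_less_iff by linarith
  qed
  have vb: "barrier (\<epsilon>' * (1/2) ^ (j + 1) * ((1/2) ^ (j + 2))\<^sup>2) (v j)" for j
    using v(1)[of j] by (simp only: \<eta>_def)
  obtain V where V: "barrier (\<epsilon>' * (1 + 2 * NL_mass)) V"
    "\<And>x j. hdist P x > 0 \<Longrightarrow> NL (v j) x - \<epsilon>' * (1 + 2 * NL_mass) \<le> NL V x"
    using sum_of_shell_barriers[OF P \<epsilon>'(1) vb supp] by blast
  have "G x - \<epsilon> \<le> NL V x" if x: "x \<in> E0" "hdist P x > 0" for x
  proof -
    define j where "j = (LEAST j. (1/2) ^ (j + 1) \<le> hdist P x)"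
    have ex: "\<exists>j. (1/2) ^ (j + 1) \<le> hdist P x"
    proof -
      obtain k where "(1/2) ^ k < hdist P x" using real_arch_pow_inv[OF x(2), of "1/2"] by auto
      moreover have "(1/2 :: real) ^ (k + 1) \<le> (1/2) ^ k" by simp
      ultimately show ?thesis by (intro exI[of _ k]) linarith
    qed
    have j1: "(1/2) ^ (j + 1) \<le> hdist P x" unfolding j_def by (rule LeastI_ex[OF ex])
    have j2: "hdist P x \<le> (1/2) ^ j"
    proof (cases j)
      case 0
      then show ?thesis using E0(2)[OF x(1)] by simp
    next
      case (Suc i)
      then have "\<not> (1/2) ^ (i + 1) \<le> hdist P x" using not_less_Least[of i "\<lambda>j. (1/2) ^ (j + 1) \<le> hdist P x"] by (simp add: j_def)
      then show ?thesis unfolding Suc by (simp only: Suc_eq_plus1 not_le less_imp_le)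
    qed
    have "x \<in> E j" using x j1 j2 by (simp add: E_def)
    then show ?thesis using v(3)[of x j] V(2)[OF x(2), of j] \<eta>(2)[of j] \<epsilon>'(2) by linarith
  qed
  moreover have "barrier \<epsilon> V" using V(1) by (rule barrier_mono) (use \<epsilon>' in linarith)
  ultimately show "\<exists>v. barrier \<epsilon> v \<and> (\<forall>x\<in>{x \<in> E0. hdist P x > 0}. G x - \<epsilon> \<le> NL v x)" by blast
qed

section \<open>The Baire category argument\<close>

definition cyl :: "'a \<Rightarrow> real \<Rightarrow> 'a set" where
  "cyl x r = {y. norm (proj (y - x)) < r}"

lemma proj_linear: "linear proj"
  by (rule linearI) (simp_all add: proj_def inner_add_left algebra_simps)

lemma continuous_proj: "continuous_on A proj"
  unfolding proj_def by (intro continuous_intros)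

lemma open_cyl: "open (cyl x r)"
  unfolding cyl_def
  by (intro open_Collect_less continuous_intros continuous_on_compose2[OF continuous_proj[of UNIV]]) auto

lemma cyl_self: "r > 0 \<Longrightarrow> x \<in> cyl x r"
  by (simp add: cyl_def proj_def)

lemma ball_subset_cyl: "ball x r \<subseteq> cyl x r"
proof
  fix y assume "y \<in> ball x r"
  then show "y \<in> cyl x r"
    using norm_proj_le[of "y - x"] by (simp add: cyl_def dist_norm norm_minus_commute)
qed

lemma cyl_subset:
  assumes "y \<in> cyl x (r / 2)"
  shows "cyl y (r / 2) \<subseteq> cyl x r"
proof
  fix z assume "z \<in> cyl y (r / 2)"
  moreover have "proj (z - x) = proj (z - y) + proj (y - x)"
    using linear_add[OF proj_linear, of "z - y" "y - x"] by simp
  ultimately show "z \<in> cyl x r"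
    using assms norm_triangle_ineq[of "proj (z - y)" "proj (y - x)"] by (simp add: cyl_def)
qed

lemma cyl_proj: "z \<in> cyl x r \<longleftrightarrow> proj z \<in> cyl x r"
proof -
  have "proj (proj z - x) = proj (z - x)"
    by (simp add: proj_def inner_diff_left en_inner algebra_simps)
  then show ?thesis by (simp add: cyl_def)
qed

lemma cyl_shift: "cyl (x + t *\<^sub>R en) r = cyl x r"
proof -
  have "proj (y - (x + t *\<^sub>R en)) = proj (y - x)" for y
    using proj_shift[of "y - x" "- t"] by (simp add: algebra_simps)
  then show ?thesis by (simp add: cyl_def)
qed

lemma vertical_set_proj: "vertical_set E \<Longrightarrow> proj x \<in> E \<longleftrightarrow> x \<in> E"
proof -
  assume v: "vertical_set E"
  have "proj x + (x \<bullet> en) *\<^sub>R en = x" "x + (- (x \<bullet> en)) *\<^sub>R en = proj x"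
    by (simp_all add: proj_def)
  then show ?thesis using v unfolding vertical_set_def by metis
qed

text \<open>
  A vertical set with bounded projection is covered by finitely many cylinders, as its projection is
  compact.
\<close>

lemma dominated_compact:
  assumes K: "closed K" "vertical_set K" "bounded (proj ` K)"
    and loc: "\<And>x. x \<in> K \<Longrightarrow> \<exists>r>0. dominated G (K \<inter> cyl x r)"
  shows "dominated G K"
proof -
  have eq: "proj ` K = K \<inter> {x. x \<bullet> en = 0}"
  proof (intro equalityI subsetI)
    fix y assume "y \<in> proj ` K"
    then show "y \<in> K \<inter> {x. x \<bullet> en = 0}"
      using vertical_set_proj[OF K(2)] by (auto simp: proj_def inner_diff_left en_inner)
  next
    fix y assume "y \<in> K \<inter> {x. x \<bullet> en = 0}"
    then have "y \<in> K" "proj y = y" by (auto simp: proj_def)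
    then show "y \<in> proj ` K" by force
  qed
  have "closed {x. x \<bullet> en = 0}" by (intro closed_Collect_eq continuous_intros)
  then have comp: "compact (proj ` K)"
    using K(1,3) unfolding compact_eq_bounded_closed eq by auto
  obtain r where r: "\<And>x. x \<in> K \<Longrightarrow> r x > 0 \<and> dominated G (K \<inter> cyl x (r x))"
    using loc by metis
  have "proj ` K \<subseteq> (\<Union>x\<in>K. cyl x (r x))"
  proof
    fix y assume "y \<in> proj ` K"
    then obtain x where "x \<in> K" "y = proj x" by auto
    then have "y \<in> cyl x (r x)" using r[of x] cyl_self[of "r x" x] cyl_proj[of x x] by simp
    then show "y \<in> (\<Union>x\<in>K. cyl x (r x))" using \<open>x \<in> K\<close> by blast
  qed
  then obtain J where J: "J \<subseteq> K" "finite J" "proj ` K \<subseteq> (\<Union>x\<in>J. cyl x (r x))"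
    using compactE_image[OF comp, of K "\<lambda>x. cyl x (r x)"] open_cyl by blast
  have "K \<subseteq> (\<Union>x\<in>J. K \<inter> cyl x (r x))"
  proof
    fix y assume "y \<in> K"
    then obtain x where "x \<in> J" "proj y \<in> cyl x (r x)" using J(3) by blast
    then show "y \<in> (\<Union>x\<in>J. K \<inter> cyl x (r x))" using \<open>y \<in> K\<close> cyl_proj[of y] by blast
  qed
  moreover have "dominated G (\<Union>x\<in>J. K \<inter> cyl x (r x))"
    using J(1,2) r by (intro dominated_UN) auto
  ultimately show ?thesis by (rule dominated_subset[rotated])
qed

text \<open>
  Let \<open>P\<close> be the set of points near which \<open>F - (M + \<eta>)\<close> is not dominated.  If it is not empty, then some
  relatively open portion of \<open>P\<close> carries almost constant values of \<open>F\<close>, because \<open>F\<close> is a limit of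
  continuous functions.  Either \<open>F \<le> M + \<eta>\<close> on this portion, and nothing has to be compensated
  there, or \<open>F > M\<close> on it, and then it is a null set on which \<open>F\<close> is bounded, so \<open>barrier_on_null_set\<close> applies.
  Off \<open>P\<close> the function is dominated on compact sets, hence on shells around \<open>P\<close>, and these are put
  together by \<open>dominated_shells\<close>.  So the points of the portion do not belong to \<open>P\<close>.
\<close>

lemma dominated_Baire_one:
  assumes C0: "closed C0" "vertical_set C0" "bounded (proj ` C0)"
    and F: "\<And>x t. x \<in> C0 \<Longrightarrow> F (x + t *\<^sub>R en) = F x"
    and Fk: "\<And>k. continuous_on C0 (Fk k)" "\<And>x. x \<in> C0 \<Longrightarrow> (\<lambda>k::nat. Fk k x) \<longlonglongrightarrow> F x"
    and Z: "{x \<in> C0. F x > M} \<subseteq> Z" "Z \<in> null_sets lborel" and \<eta>: "\<eta> > 0"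
  shows "dominated (\<lambda>x. F x - (M + \<eta>)) C0"
proof -
  define G where "G x = F x - (M + \<eta>)" for x
  define P where "P = {x \<in> C0. \<forall>r>0. \<not> dominated G (C0 \<inter> cyl x r)}"
  have PC: "P \<subseteq> C0" by (auto simp: P_def)
  have vP: "vertical_set P"
    using C0(2) by (auto simp: vertical_set_def P_def cyl_shift)
  have cP: "closed P"
    unfolding closed_def
  proof (rule openI)
    fix x assume x: "x \<in> - P"
    show "\<exists>d>0. ball x d \<subseteq> - P"
    proof (cases "x \<in> C0")
      case True
      then obtain r where r: "r > 0" "dominated G (C0 \<inter> cyl x r)" using x by (auto simp: P_def)
      have "y \<notin> P" if "y \<in> ball x (r / 2)" for y
      proof -
        have "dominated G (C0 \<inter> cyl y (r / 2))"
          using r(2) cyl_subset[of y x r] ball_subset_cyl[of x "r / 2"] that by (blast intro: dominated_subset)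
        moreover have "r / 2 > 0" using r(1) by simp
        ultimately show ?thesis unfolding P_def by blast
      qed
      then show ?thesis using r(1) by (intro exI[of _ "r / 2"]) auto
    next
      case False
      then obtain d where "d > 0" "ball x d \<subseteq> - C0"
        using C0(1) by (metis ComplI open_Compl openE)
      then show ?thesis using PC by blast
    qed
  qed
  have off: "dominated G K" if K: "closed K" "vertical_set K" "K \<subseteq> C0" "K \<inter> P = {}" for K
  proof (rule dominated_compact[OF K(1,2)])
    show "bounded (proj ` K)" using bounded_subset[OF C0(3)] K(3) by blast
    fix x assume "x \<in> K"
    then have "x \<in> C0" "x \<notin> P" using K by auto
    then obtain r where "r > 0" "dominated G (C0 \<inter> cyl x r)" by (auto simp: P_def)
    then show "\<exists>r>0. dominated G (K \<inter> cyl x r)" using K(3) by (blast intro: dominated_subset)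
  qed
  have "P = {}"
  proof (rule ccontr)
    assume P: "P \<noteq> {}"
    \<comment> \<open>On the portion \<open>F\<close> varies by at most \<open>6 * \<kappa> < \<eta>\<close>.\<close>
    define \<kappa> where "\<kappa> = \<eta> / 8"
    have \<kappa>: "\<kappa> > 0" using \<eta> by (simp add: \<kappa>_def)
    define Pk where "Pk k = {x \<in> P. \<forall>l\<ge>k. \<bar>Fk l x - Fk k x\<bar> \<le> \<kappa>}" for k
    have cPk: "closed (Pk k)" for k
    proof -
      have "Pk k = P \<inter> (\<Inter>l\<in>{k..}. {x \<in> P. \<bar>Fk l x - Fk k x\<bar> \<le> \<kappa>})" by (auto simp: Pk_def)
      moreover have "closed {x \<in> P. \<bar>Fk l x - Fk k x\<bar> \<le> \<kappa>}" for l
        using cP by (intro continuous_on_closed_Collect_le continuous_intros continuous_on_subset[OF Fk(1) PC])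
      ultimately show ?thesis using cP by (simp only:) (intro closed_Int closed_INT ballI)
    qed
    have cover: "\<exists>k. x \<in> Pk k" if "x \<in> P" for x
    proof -
      have "Cauchy (\<lambda>k. Fk k x)" using Fk(2)[of x] PC that by (blast intro: LIMSEQ_imp_Cauchy)
      then obtain k where "\<And>l l'. l \<ge> k \<Longrightarrow> l' \<ge> k \<Longrightarrow> dist (Fk l x) (Fk l' x) < \<kappa>"
        using \<kappa> unfolding Cauchy_def by blast
      then have "x \<in> Pk k" using that by (auto simp: Pk_def dist_real_def less_imp_le)
      then show ?thesis ..
    qed
    have "\<exists>k. \<not> P \<subseteq> closure (P - Pk k)"
    proof (rule ccontr)
      assume "\<nexists>k. \<not> P \<subseteq> closure (P - Pk k)"
      then have "P \<subseteq> closure (\<Inter>k. P - Pk k)"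
      proof (intro Baire[OF cP])
        fix T assume "T \<in> range (\<lambda>k. P - Pk k)"
        then obtain k where T: "T = P - Pk k" by blast
        have "openin (top_of_set P) (P - Pk k)"
          using cPk[of k] by (metis Diff_eq open_Compl openin_open_Int)
        then show "openin (top_of_set P) T \<and> P \<subseteq> closure T"
          using \<open>\<nexists>k. \<not> P \<subseteq> closure (P - Pk k)\<close> T by blast
      qed auto
      moreover have "(\<Inter>k. P - Pk k) = {}" using cover by blast
      ultimately have "P \<subseteq> closure {}" by (simp only:)
      then show False using P by simp
    qed
    then obtain k x1 where x1: "x1 \<in> P" "x1 \<notin> closure (P - Pk k)" by blast
    have "open (- closure (P - Pk k))" "x1 \<in> - closure (P - Pk k)" using x1(2) by auto
    then obtain r where r: "r > 0" and "ball x1 r \<subseteq> - closure (P - Pk k)" by (rule openE)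
    then have rP: "ball x1 r \<inter> (P - Pk k) = {}" using closure_subset[of "P - Pk k"] by blast
    have x1C: "x1 \<in> C0" using x1 PC by blast
    obtain r1 where r1: "r1 > 0" "\<And>x. x \<in> C0 \<Longrightarrow> dist x x1 < r1 \<Longrightarrow> \<bar>Fk k x - Fk k x1\<bar> < \<kappa>"
      using Fk(1)[of k] x1C \<kappa> unfolding continuous_on_iff dist_real_def by metis
    have limF: "\<bar>F x - Fk k x\<bar> \<le> \<kappa>" if "x \<in> Pk k" for x
    proof -
      have "(\<lambda>l. \<bar>Fk l x - Fk k x\<bar>) \<longlonglongrightarrow> \<bar>F x - Fk k x\<bar>"
        using Fk(2)[of x] that PC by (intro tendsto_intros) (auto simp: Pk_def)
      then show ?thesis
        by (rule tendsto_upperbound) (use that in \<open>auto simp: Pk_def eventually_sequentially\<close>)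
    qed
    define r2 where "r2 = min (min r r1 / 2) 1"
    have r2: "r2 > 0" "r2 < r" "r2 < r1" "r2 \<le> 1" using r r1(1) by (auto simp: r2_def)
    have osc: "\<bar>F x - F x1\<bar> \<le> 3 * \<kappa>" if x: "x \<in> P" "norm (proj (x - x1)) \<le> r2" for x
    proof -
      define y where "y = x + ((x1 - x) \<bullet> en) *\<^sub>R en"
      have "y - x1 = proj (x - x1)" by (simp add: y_def proj_def inner_diff_left algebra_simps)
      then have d: "dist y x1 \<le> r2" using x(2) by (simp add: dist_norm)
      have yP: "y \<in> P" using vP x(1) by (simp add: vertical_set_def y_def)
      have "y \<in> ball x1 r" "x1 \<in> ball x1 r" using r r2 d by (auto simp: dist_commute)
      then have "y \<in> Pk k" "x1 \<in> Pk k" using rP yP x1(1) by blast+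
      then have "\<bar>F y - F x1\<bar> \<le> 3 * \<kappa>"
        using limF[of y] limF[of x1] r1(2)[of y] yP PC d r2 by (force simp: abs_le_iff abs_less_iff)
      moreover have "F y = F x" using F x(1) PC by (simp add: y_def subset_iff)
      ultimately show ?thesis by simp
    qed
    define E0 where "E0 = C0 \<inter> {y. norm (proj (y - x1)) \<le> r2}"
    have vn: "proj (y + t *\<^sub>R en - x1) = proj (y - x1)" for y t
      using proj_shift[of "y - x1" t] by (simp add: algebra_simps)
    have E0: "closed E0" "vertical_set E0" "E0 \<subseteq> C0"
    proof -
      have "closed {y. norm (proj (y - x1)) \<le> r2}"
        by (intro closed_Collect_le continuous_intros continuous_on_compose2[OF continuous_proj[of UNIV]]) auto
      then show "closed E0" using C0(1) by (auto simp: E0_def)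
      show "vertical_set E0" using C0(2) by (auto simp: vertical_set_def E0_def vn)
    qed (auto simp: E0_def)
    have hE: "hdist P x \<le> 1" if "x \<in> E0" for x
    proof -
      have "proj x1 \<in> P" using vertical_set_proj[OF vP] x1(1) by simp
      then have "hdist P x \<le> dist (proj x) (proj x1)" unfolding hdist_def by (rule infdist_le)
      also have "\<dots> \<le> 1" using that r2 by (simp add: E0_def dist_norm proj_diff)
      finally show ?thesis .
    qed
    have h0: "hdist P x = 0 \<longleftrightarrow> x \<in> P" for x
      using hdist_eq_0[OF cP P] vP by (auto simp: vertical_set_def)
    have ch: "continuous_on UNIV (hdist P)"
      by (rule Lipschitz_continuous[of _ 1]) (simp add: hdist_Lipschitz)
    have shells: "dominated G {x \<in> E0. hdist P x > 0}"
    proof (rule dominated_shells[OF P E0(2) hE])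
      fix j :: nat
      let ?S = "{x \<in> E0. (1/2) ^ (j + 1) \<le> hdist P x \<and> hdist P x \<le> (1/2) ^ j}"
      show "dominated G ?S"
      proof (rule off)
        have "?S = E0 \<inter> {x. (1/2) ^ (j + 1) \<le> hdist P x} \<inter> {x. hdist P x \<le> (1/2) ^ j}" by auto
        moreover have "closed {x. (1/2) ^ (j + 1) \<le> hdist P x}" "closed {x. hdist P x \<le> (1/2) ^ j}"
          by (intro closed_Collect_le ch continuous_intros)+
        ultimately show "closed ?S" using E0(1) by auto
        show "vertical_set ?S"
          using E0(2) verticalD[OF hdist_vertical] by (auto simp: vertical_set_def)
        show "?S \<subseteq> C0" using E0(3) by auto
        have "x \<notin> P" if "x \<in> ?S" for x
        proof -
          have "(0::real) < (1/2) ^ (j + 1)" by simp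
          moreover have "(1/2) ^ (j + 1) \<le> hdist P x" using that by simp
          ultimately have "hdist P x \<noteq> 0" by linarith
          then show ?thesis using h0 by blast
        qed
        then show "?S \<inter> P = {}" by blast
      qed
    qed
    have Q: "dominated G (P \<inter> E0)"
    proof (cases "\<forall>x\<in>P \<inter> E0. F x \<le> M + \<eta>")
      case True
      then show ?thesis by (intro dominated_nonpos) (auto simp: G_def)
    next
      case False
      then obtain x2 where x2: "x2 \<in> P" "x2 \<in> E0" "F x2 > M + \<eta>" by force
      have o: "\<bar>F x - F x1\<bar> \<le> 3 * \<kappa>" if "x \<in> P \<inter> E0" for x
        using osc[of x] that by (simp add: E0_def)
      have big: "F x > M" if "x \<in> P \<inter> E0" for x
        using o[OF that] o[OF IntI[OF x2(1,2)]] x2(3) \<eta> unfolding \<kappa>_def abs_le_iff by linarith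
      have cQ: "closed (P \<inter> E0)" using cP E0(1) by auto
      have "P \<inter> E0 \<subseteq> Z" using Z(1) big PC by blast
      then have null: "P \<inter> E0 \<in> null_sets lborel"
        using null_sets_subset[OF Z(2)] borel_closed[OF cQ] by simp
      have vQ: "x + t *\<^sub>R en \<in> P \<inter> E0" if "x \<in> P \<inter> E0" for x t
        using that vP E0(2) by (auto simp: vertical_set_def)
      have bQ: "bounded (proj ` (P \<inter> E0))"
        by (rule bounded_subset[OF C0(3) image_mono]) (use PC in auto)
      define K where "K = max 0 (F x1 + 3 * \<kappa> - (M + \<eta>))"
      have GK: "G x \<le> K" if "x \<in> P \<inter> E0" for x
        using o[OF that] unfolding G_def K_def abs_le_iff by linarith
      show ?thesis
        unfolding dominated_def
      proof (intro allI impI)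
        fix \<epsilon> :: real assume \<epsilon>: "\<epsilon> > 0"
        have ne: "P \<inter> E0 \<noteq> {}" using x2 by blast
        have "K \<ge> 0" by (simp add: K_def)
        from barrier_on_null_set[OF cQ ne vQ bQ null this \<epsilon>]
        obtain v where v: "barrier \<epsilon> v" "\<And>x. x \<in> P \<inter> E0 \<Longrightarrow> K \<le> NL v x" by blast
        have "G x - \<epsilon> \<le> NL v x" if "x \<in> P \<inter> E0" for x
          using v(2)[OF that] GK[OF that] \<epsilon> by linarith
        then show "\<exists>v. barrier \<epsilon> v \<and> (\<forall>x\<in>P \<inter> E0. G x - \<epsilon> \<le> NL v x)" using v(1) by blast
      qed
    qed
    have "C0 \<inter> cyl x1 r2 \<subseteq> {x \<in> E0. hdist P x > 0} \<union> (P \<inter> E0)"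
    proof
      fix x assume "x \<in> C0 \<inter> cyl x1 r2"
      then have "x \<in> E0" by (simp add: E0_def cyl_def)
      moreover have "hdist P x \<ge> 0" by (simp add: hdist_def infdist_nonneg)
      ultimately show "x \<in> {x \<in> E0. hdist P x > 0} \<union> (P \<inter> E0)" using h0[of x] by (cases "x \<in> P") (auto simp: less_le)
    qed
    then have "dominated G (C0 \<inter> cyl x1 r2)" by (rule dominated_subset[OF dominated_Un[OF shells Q]])
    then show False using x1(1) r2(1) by (auto simp: P_def)
  qed
  then have "dominated G C0" using off[OF C0(1,2)] by blast
  then show ?thesis by (simp add: G_def[abs_def])
qed

end

lemma continuous_on_Max_atMost:
  fixes g :: "nat \<Rightarrow> 'b::topological_space \<Rightarrow> real"
  assumes "\<And>j. continuous_on A (g j)"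
  shows "continuous_on A (\<lambda>x. Max ((\<lambda>j. g j x) ` {..J}))"
  by (induction J) (auto simp: atMost_Suc intro!: continuous_intros assms)

lemma tendsto_Max_atMost:
  fixes g :: "nat \<Rightarrow> 'b \<Rightarrow> real"
  assumes "\<And>j. j \<le> J \<Longrightarrow> (g j \<longlongrightarrow> l j) F"
  shows "((\<lambda>k. Max ((\<lambda>j. g j k) ` {..J})) \<longlongrightarrow> Max (l ` {..J})) F"
  using assms by (induction J) (auto simp: atMost_Suc intro!: tendsto_max)

lemma deriv_add_const: "deriv (\<lambda>t. \<phi> t + c) x = deriv \<phi> (x::real)" for c :: real
proof -
  have "((\<lambda>t. \<phi> t + c) has_field_derivative D) (at x) \<longleftrightarrow> (\<phi> has_field_derivative D) (at x)" for D
    using DERIV_add[of "\<lambda>t. \<phi> t + c" D x UNIV "\<lambda>_. - c" 0] DERIV_add[of \<phi> D x UNIV "\<lambda>_. c" 0] by auto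
  then show ?thesis by (simp add: deriv_def)
qed

context anisotropic
begin

lemma aniso_add_vertical:
  assumes w: "vertical w" "NL_computable w x" and u: "aniso_computable_at e m N s u x"
  shows "aniso_computable_at e m N s (\<lambda>x. u x + w x) x"
    and "aniso_op e m N a b s (\<lambda>x. u x + w x) x = aniso_op e m N a b s u x + NL w x"
proof -
  have sh: "(\<lambda>t. u (z + t *\<^sub>R en) + w (z + t *\<^sub>R en)) = (\<lambda>t. u (z + t *\<^sub>R en) + w z)" for z
    using verticalD[OF w(1)] by simp
  have pd: "partial_deriv en (\<lambda>x. u x + w x) = partial_deriv en u"
    by (rule ext) (simp add: partial_deriv_def sh deriv_add_const)
  have "twice_partially_differentiable_at en (\<lambda>x. u x + w x) x"
    using u unfolding aniso_computable_iff twice_partially_differentiable_at_def pd sh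
    by (auto elim!: eventually_mono intro!: differentiable_add)
  then show "aniso_computable_at e m N s (\<lambda>x. u x + w x) x"
    using u NL_add(1) w(2) by (simp add: aniso_computable_iff)
  show "aniso_op e m N a b s (\<lambda>x. u x + w x) x = aniso_op e m N a b s u x + NL w x"
    using u NL_add(2)[of u x w] w(2) by (simp add: aniso_op_eq pd aniso_computable_iff)
qed

section \<open>The operator as a pointwise limit of continuous functions\<close>

text \<open>
  Cutting off the short jumps and replacing the derivative by a difference quotient makes the operator
  continuous in the point; so the right-hand side of the equation is of the first Baire class.
\<close>

definition trunc_op :: "('a \<Rightarrow> real) \<Rightarrow> nat \<Rightarrow> 'a \<Rightarrow> real" where
  "trunc_op u k x = (let \<delta> = 1 / real (Suc k) in
     (\<Sum>i = 1..m - 1. a i * (frac_const (N i) s * (LINT y|cm i. cut_weight \<delta> i y * second_diff u x (gv i y))))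
     - b * ((u (x + \<delta> *\<^sub>R en) + u (x - \<delta> *\<^sub>R en) - 2 * u x) / \<delta>\<^sup>2))"

lemma cut_second_diff_measurable:
  assumes "continuous_on UNIV u"
  shows "(\<lambda>y. cut_weight \<delta> i y * second_diff u x (gv i y)) \<in> borel_measurable (cm i)"
proof -
  have [measurable]: "u \<in> borel_measurable borel" using assms by (rule borel_measurable_continuous_onI)
  show ?thesis unfolding second_diff_def by measurable
qed

lemma trunc_op_continuous:
  assumes u: "continuous_on UNIV u" "\<And>x. \<bar>u x\<bar> \<le> S"
  shows "continuous_on UNIV (trunc_op u k)"
proof -
  define \<delta> where "\<delta> = 1 / real (Suc k)"
  have \<delta>: "0 < \<delta>" "\<delta> \<le> 1" by (auto simp: \<delta>_def)
  have I: "continuous_on UNIV (\<lambda>x. LINT y|cm i. cut_weight \<delta> i y * second_diff u x (gv i y))" if i: "i \<in> {1..m - 1}" for i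
    unfolding continuous_on_sequentially
  proof (intro allI ballI impI, elim conjE)
    fix x :: "nat \<Rightarrow> 'a" and z assume lim: "x \<longlonglongrightarrow> z"
    have sd: "(\<lambda>n. second_diff u (x n) h) \<longlonglongrightarrow> second_diff u z h" for h
    proof -
      have "(\<lambda>n. u (x n + k)) \<longlonglongrightarrow> u (z + k)" for k
        by (rule continuous_on_tendsto_compose[OF u(1)]) (auto intro!: tendsto_intros lim)
      from this[of 0] this[of h] this[of "- h"] show ?thesis
        unfolding second_diff_def by (intro tendsto_intros) simp_all
    qed
    have bd: "\<bar>second_diff u w h\<bar> \<le> 4 * S" for w h
      using u(2)[of w] u(2)[of "w + h"] u(2)[of "w - h"] by (simp add: second_diff_def)
    have "(\<lambda>n. LINT y|cm i. cut_weight \<delta> i y * second_diff u (x n) (gv i y))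
        \<longlonglongrightarrow> (LINT y|cm i. cut_weight \<delta> i y * second_diff u z (gv i y))"
    proof (rule integral_dominated_convergence[where w = "\<lambda>y. cut_weight \<delta> i y * (4 * S)"])
      show "integrable (cm i) (\<lambda>y. cut_weight \<delta> i y * (4 * S))"
        using cut_weight_integrable[OF \<delta> i] by simp
      show "AE y in cm i. (\<lambda>n. cut_weight \<delta> i y * second_diff u (x n) (gv i y)) \<longlonglongrightarrow> cut_weight \<delta> i y * second_diff u z (gv i y)"
        by (intro AE_I2 tendsto_intros sd)
      show "AE y in cm i. norm (cut_weight \<delta> i y * second_diff u (x n) (gv i y)) \<le> cut_weight \<delta> i y * (4 * S)" for n
        using bd cut_weight_nonneg by (intro AE_I2) (simp add: abs_mult mult_left_mono)
    qed (rule cut_second_diff_measurable[OF u(1)])+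
    then show "((\<lambda>x. LINT y|cm i. cut_weight \<delta> i y * second_diff u x (gv i y)) \<circ> x) \<longlonglongrightarrow> (LINT y|cm i. cut_weight \<delta> i y * second_diff u z (gv i y))"
      by (simp add: o_def)
  qed
  show ?thesis
    unfolding trunc_op_def Let_def \<delta>_def[symmetric]
    by (intro continuous_intros I continuous_on_compose2[OF u(1)]) (use \<delta> in auto)
qed

lemma trunc_op_tendsto:
  assumes u: "continuous_on UNIV u" and x: "aniso_computable_at e m N s u x"
  shows "(\<lambda>k. trunc_op u k x) \<longlonglongrightarrow> aniso_op e m N a b s u x"
proof -
  have I: "(\<lambda>k. LINT y|cm i. cut_weight (1 / real (Suc k)) i y * second_diff u x (gv i y)) \<longlonglongrightarrow> (LINT y|cm i. frac_integrand e N i s u x y)"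
    if i: "i \<in> {1..m - 1}" for i
  proof (rule integral_dominated_convergence[where w = "\<lambda>y. \<bar>frac_integrand e N i s u x y\<bar>"])
    have int: "integrable (cm i) (frac_integrand e N i s u x)"
      using x i by (simp add: aniso_computable_iff NL_computable_def)
    then show "frac_integrand e N i s u x \<in> borel_measurable (cm i)" "integrable (cm i) (\<lambda>y. \<bar>frac_integrand e N i s u x y\<bar>)"
      by auto
    show "(\<lambda>y. cut_weight (1 / real (Suc k)) i y * second_diff u x (gv i y)) \<in> borel_measurable (cm i)" for k
      by (rule cut_second_diff_measurable[OF u])
    show "AE y in cm i. norm (cut_weight (1 / real (Suc k)) i y * second_diff u x (gv i y)) \<le> \<bar>frac_integrand e N i s u x y\<bar>" for k
      by (intro AE_I2) (simp add: cut_weight_def frac_integrand_eq[OF i] abs_mult)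
    show "AE y in cm i. (\<lambda>k. cut_weight (1 / real (Suc k)) i y * second_diff u x (gv i y)) \<longlonglongrightarrow> frac_integrand e N i s u x y"
    proof (rule AE_I2)
      fix y
      show "(\<lambda>k. cut_weight (1 / real (Suc k)) i y * second_diff u x (gv i y)) \<longlonglongrightarrow> frac_integrand e N i s u x y"
      proof (cases "rad (N i) y = 0")
        case True
        then show ?thesis by (simp add: cut_weight_def frac_integrand_eq[OF i])
      next
        case False
        then have "rad (N i) y > 0" using L2_set_nonneg[of y "{1..N i}"] by linarith
        then have "\<forall>\<^sub>F k in sequentially. 1 / real (Suc k) < rad (N i) y"
          using LIMSEQ_inverse_real_of_nat by (intro order_tendstoD(2)[of _ 0]) (simp_all add: inverse_eq_divide)
        then have "\<forall>\<^sub>F k in sequentially. cut_weight (1 / real (Suc k)) i y * second_diff u x (gv i y) = frac_integrand e N i s u x y"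
          by eventually_elim (simp add: cut_weight_def frac_integrand_eq[OF i])
        then show ?thesis by (rule tendsto_eventually)
      qed
    qed
  qed
  have "filterlim (\<lambda>k. 1 / real (Suc k)) (at 0) sequentially"
    unfolding filterlim_at using LIMSEQ_inverse_real_of_nat by (simp add: inverse_eq_divide)
  from filterlim_compose[OF second_difference_tendsto this] x
  have D: "(\<lambda>k. (u (x + (1 / real (Suc k)) *\<^sub>R en) + u (x - (1 / real (Suc k)) *\<^sub>R en) - 2 * u x) / (1 / real (Suc k))\<^sup>2)
     \<longlonglongrightarrow> partial_deriv en (partial_deriv en u) x"
    by (auto simp: aniso_computable_iff)
  show ?thesis
    unfolding trunc_op_def Let_def aniso_op_eq NL_def frac_laplacian_def
    by (intro tendsto_diff tendsto_sum tendsto_mult tendsto_const I D)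
qed

section \<open>From almost every point to every point\<close>

lemma norm_proj_add: "(norm (proj x + t *\<^sub>R en))\<^sup>2 = (norm (proj x))\<^sup>2 + t\<^sup>2"
proof -
  have "proj x \<bullet> en = 0" by (simp add: proj_def inner_diff_left en_inner)
  then show ?thesis
    unfolding power2_norm_eq_inner by (simp add: inner_simps en_inner inner_commute power2_eq_square)
qed

text \<open>
  By Lipschitz continuity in the last variable, \<open>f\<close> is bounded up to \<open>\<eta> / 8\<close> by the maximum \<open>F\<close> of its values on
  finitely many horizontal sections, which depends on the first variables only.  For the same
  reason \<open>f > M\<close> holds on a vertical segment of length \<open>2 * h\<close> around each point of a section where
  \<open>f > M + \<eta> / 2\<close>; countably many vertical translates of the exceptional null set therefore cover all
  points of the cylinder with \<open>F > M + \<eta> / 2\<close>, and \<open>dominated_Baire_one\<close> applies to \<open>F\<close>.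

  The radius \<open>5/8\<close> leaves room for sections at height up to \<open>3/4\<close> inside the unit ball, as
  \<open>(5/8)\<^sup>2 + (3/4)\<^sup>2 < 1\<close>.
\<close>

lemma barrier_above:
  assumes g: "\<And>k. continuous_on UNIV (g k)" "\<And>x. norm x < 1 \<Longrightarrow> (\<lambda>k::nat. g k x) \<longlonglongrightarrow> f x"
    and lip: "\<And>x t. norm x < 1 \<Longrightarrow> norm (x + t *\<^sub>R en) < 1 \<Longrightarrow> \<bar>f (x + t *\<^sub>R en) - f x\<bar> \<le> L * \<bar>t\<bar>"
    and Z: "{x. f x > M} \<subseteq> Z" "Z \<in> null_sets lborel" and \<eta>: "\<eta> > 0"
  obtains v where "barrier \<eta> v" "\<And>x. norm x < 5/8 \<Longrightarrow> f x - (M + \<eta>) \<le> NL v x"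
proof -
  define L' where "L' = max L 1"
  have L': "L' \<ge> 1" by (simp add: L'_def)
  have lip': "\<bar>f (x + t *\<^sub>R en) - f x\<bar> \<le> L' * \<bar>t\<bar>" if "norm x < 1" "norm (x + t *\<^sub>R en) < 1" for x t
    using lip[OF that] mult_right_mono[of L L' "\<bar>t\<bar>"] by (simp add: L'_def)
  define C0 where "C0 = {x. norm (proj x) \<le> 5/8}"
  define h where "h = min (1/8) (\<eta> / (8 * L'))"
  have h: "0 < h" "h \<le> 1/8" "L' * h \<le> \<eta> / 8"
  proof -
    show "0 < h" "h \<le> 1/8" using \<eta> L' by (auto simp: h_def)
    have "L' * h \<le> L' * (\<eta> / (8 * L'))" using L' by (intro mult_left_mono) (auto simp: h_def)
    then show "L' * h \<le> \<eta> / 8" using L' by simp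
  qed
  define J where "J = nat \<lfloor>(5/4) / h\<rfloor>"
  define \<tau> where "\<tau> j = real j * h - 5/8" for j
  have \<tau>: "\<bar>\<tau> j\<bar> \<le> 5/8" if "j \<le> J" for j
  proof -
    have "real J \<le> (5/4) / h" unfolding J_def using h by (intro of_nat_floor) auto
    then have "real j \<le> (5/4) / h" using that by linarith
    then have "real j * h \<le> 5/4" using h by (simp add: pos_le_divide_eq)
    moreover have "0 \<le> real j * h" using h by simp
    ultimately show ?thesis unfolding \<tau>_def abs_le_iff by linarith
  qed
  have near: "\<exists>j\<le>J. \<bar>t - \<tau> j\<bar> \<le> h" if "\<bar>t\<bar> \<le> 5/8" for t
  proof (intro exI conjI)
    define j where "j = nat \<lfloor>(t + 5/8) / h\<rfloor>"
    have t: "0 \<le> (t + 5/8) / h" using that h by (simp add: abs_le_iff)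
    have "(t + 5/8) / h \<le> (5/4) / h" using that h by (intro divide_right_mono) (auto simp: abs_le_iff)
    then show "nat \<lfloor>(t + 5/8) / h\<rfloor> \<le> J" unfolding J_def by (intro nat_mono floor_mono)
    have j: "real j \<le> (t + 5/8) / h" "(t + 5/8) / h < real j + 1" using t unfolding j_def by linarith+
    then have "real j * h \<le> t + 5/8" "t + 5/8 < (real j + 1) * h" using h by (simp_all add: field_simps)
    then show "\<bar>t - \<tau> (nat \<lfloor>(t + 5/8) / h\<rfloor>)\<bar> \<le> h"
      unfolding j_def[symmetric] \<tau>_def abs_le_iff distrib_right by linarith
  qed
  have inball: "norm (proj x + t *\<^sub>R en) < 1" if "x \<in> C0" "\<bar>t\<bar> \<le> 3/4" for x t
  proof -
    have "(norm (proj x))\<^sup>2 \<le> (5/8)\<^sup>2" using that(1) by (intro power_mono) (auto simp: C0_def)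
    moreover have "\<bar>t\<bar>\<^sup>2 \<le> (3/4)\<^sup>2" using that(2) by (intro power_mono) auto
    ultimately have "(norm (proj x + t *\<^sub>R en))\<^sup>2 \<le> (5/8)\<^sup>2 + (3/4)\<^sup>2"
      unfolding norm_proj_add power2_abs by linarith
    also have "\<dots> < 1\<^sup>2" by (simp add: power2_eq_square)
    finally show ?thesis by (rule power2_less_imp_less) simp
  qed
  define F where "F x = Max ((\<lambda>j. f (proj x + \<tau> j *\<^sub>R en)) ` {..J})" for x
  define Fk where "Fk k x = Max ((\<lambda>j. g k (proj x + \<tau> j *\<^sub>R en)) ` {..J})" for k x
  define Z' where "Z' = (\<Union>i::int. (\<lambda>x. x + (of_int i * h) *\<^sub>R en) -` Z)"
  have "dominated (\<lambda>x. F x - (M + \<eta> / 2 + \<eta> / 4)) C0"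
  proof (rule dominated_Baire_one)
    have "closed {x. norm (proj x) \<le> 5/8}"
      by (intro closed_Collect_le continuous_intros continuous_proj)
    then show "closed C0" by (simp add: C0_def)
    show "vertical_set C0" by (simp add: vertical_set_def C0_def proj_shift)
    show "bounded (proj ` C0)" unfolding bounded_iff by (intro exI[of _ "5/8"]) (auto simp: C0_def)
    show "F (x + t *\<^sub>R en) = F x" for x t by (simp add: F_def proj_shift)
    show "continuous_on C0 (Fk k)" for k
      unfolding Fk_def
      by (intro continuous_on_Max_atMost continuous_on_compose2[OF g(1)] continuous_intros continuous_proj) auto
    show "(\<lambda>k. Fk k x) \<longlonglongrightarrow> F x" if "x \<in> C0" for x
      unfolding Fk_def F_def
    proof (rule tendsto_Max_atMost)
      fix j assume "j \<le> J"
      then have "norm (proj x + \<tau> j *\<^sub>R en) < 1" using \<tau>[of j] by (intro inball[OF that]) auto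
      then show "(\<lambda>k. g k (proj x + \<tau> j *\<^sub>R en)) \<longlonglongrightarrow> f (proj x + \<tau> j *\<^sub>R en)" by (rule g(2))
    qed
    show "Z' \<in> null_sets lborel"
      unfolding Z'_def by (intro null_sets_UN null_sets_lborel_shift Z(2))
    show "{x \<in> C0. F x > M + \<eta> / 2} \<subseteq> Z'"
    proof
      fix x assume "x \<in> {x \<in> C0. F x > M + \<eta> / 2}"
      then have x: "x \<in> C0" and "F x > M + \<eta> / 2" by auto
      then obtain j where j: "j \<le> J" "f (proj x + \<tau> j *\<^sub>R en) > M + \<eta> / 2"
        unfolding F_def by (subst (asm) Max_gr_iff) auto
      define i where "i = \<lfloor>(\<tau> j - x \<bullet> en) / h\<rfloor>"
      define t where "t = x \<bullet> en + of_int i * h - \<tau> j"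
      have "of_int i \<le> (\<tau> j - x \<bullet> en) / h" "(\<tau> j - x \<bullet> en) / h < of_int i + 1"
        unfolding i_def by linarith+
      then have "of_int i * h \<le> \<tau> j - x \<bullet> en" "\<tau> j - x \<bullet> en < (of_int i + 1) * h"
        using h by (simp_all add: field_simps)
      then have t: "\<bar>t\<bar> \<le> h" unfolding t_def abs_le_iff distrib_right by linarith
      have n1: "norm (proj x + \<tau> j *\<^sub>R en) < 1" using \<tau>[OF j(1)] by (intro inball[OF x]) auto
      have "norm (proj x + (\<tau> j + t) *\<^sub>R en) < 1" using \<tau>[OF j(1)] t h by (intro inball[OF x]) linarith
      then have n2: "norm (proj x + \<tau> j *\<^sub>R en + t *\<^sub>R en) < 1" by (simp add: algebra_simps)
      have "L' * \<bar>t\<bar> \<le> L' * h" using t L' by (intro mult_left_mono) auto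
      then have "f (proj x + \<tau> j *\<^sub>R en + t *\<^sub>R en) > M"
        using lip'[OF n1 n2] j(2) h(3) \<eta> by (simp add: abs_le_iff)
      moreover have "proj x + \<tau> j *\<^sub>R en + t *\<^sub>R en = x + (of_int i * h) *\<^sub>R en"
        by (simp add: proj_def t_def algebra_simps)
      ultimately have "x + (of_int i * h) *\<^sub>R en \<in> Z" using Z(1) by auto
      then show "x \<in> Z'" by (auto simp: Z'_def)
    qed
    show "\<eta> / 4 > 0" using \<eta> by simp
  qed
  then obtain v where v: "barrier (\<eta> / 8) v" "\<And>x. x \<in> C0 \<Longrightarrow> F x - (M + \<eta> / 2 + \<eta> / 4) - \<eta> / 8 \<le> NL v x"
    unfolding dominated_def using \<eta> by (metis zero_less_divide_iff zero_less_numeral)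
  show thesis
  proof (rule that)
    show "barrier \<eta> v" using v(1) by (rule barrier_mono) (use \<eta> in simp)
    fix x :: 'a assume x: "norm x < 5/8"
    have xC: "x \<in> C0" using norm_proj_le[of x] x by (simp add: C0_def)
    have "\<bar>x \<bullet> en\<bar> \<le> 5/8" using coord_le_norm[OF n_in, of x] x by linarith
    from near[OF this] obtain j where j: "j \<le> J" "\<bar>x \<bullet> en - \<tau> j\<bar> \<le> h" by blast
    have e: "x + (\<tau> j - x \<bullet> en) *\<^sub>R en = proj x + \<tau> j *\<^sub>R en" by (simp add: proj_def algebra_simps)
    have "norm (proj x + \<tau> j *\<^sub>R en) < 1" using \<tau>[OF j(1)] by (intro inball[OF xC]) auto
    then have "\<bar>f (proj x + \<tau> j *\<^sub>R en) - f x\<bar> \<le> L' * \<bar>\<tau> j - x \<bullet> en\<bar>"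
      using lip'[of x "\<tau> j - x \<bullet> en"] x unfolding e by simp
    also have "\<dots> \<le> L' * h" using j(2) L' by (intro mult_left_mono) (auto simp: abs_minus_commute)
    finally have "f x \<le> f (proj x + \<tau> j *\<^sub>R en) + \<eta> / 8" using h(3) by (simp add: abs_le_iff)
    moreover have "f (proj x + \<tau> j *\<^sub>R en) \<le> F x" unfolding F_def using j(1) by (intro Max_ge) auto
    ultimately show "f x - (M + \<eta>) \<le> NL v x" using v(2)[OF xC] by linarith
  qed
qed

lemma ball_subset_unit_cylinder: "norm x < 1 \<Longrightarrow> x \<in> unit_cylinder e"
proof -
  assume x: "norm x < 1"
  have "(\<Sum>k = 1..DIM('a) - 1. (x \<bullet> e k)\<^sup>2) \<le> (norm x)\<^sup>2"
    unfolding norm_sq_coord by (rule sum_mono2) auto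
  then have "sqrt (\<Sum>k = 1..DIM('a) - 1. (x \<bullet> e k)\<^sup>2) \<le> norm x"
    by (intro real_le_lsqrt) auto
  then show ?thesis unfolding unit_cylinder_def mem_Collect_eq using x by (rule le_less_trans)
qed

text \<open>
  The corrections \<open>u - v\<close> and \<open>u + w\<close> satisfy at every point, up to \<open>\<eta>\<close>, the one-sided bounds that \<open>f\<close>
  satisfies almost everywhere.  Points within \<open>1/8\<close> of the half ball stay in the ball of radius \<open>5/8\<close>, where
  this is known.
\<close>

lemma interior_Holder_estimate:
  assumes \<gamma>: "0 < \<gamma>" "\<gamma> < 1" "\<gamma> \<le> 2 * s"
    and u: "continuous_on UNIV u" "\<And>x. \<bar>u x\<bar> \<le> S"
    and sol: "\<And>x. norm x < 1 \<Longrightarrow> aniso_computable_at e m N s u x \<and> aniso_op e m N a b s u x = f x"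
    and lip: "\<And>x t. norm x < 1 \<Longrightarrow> norm (x + t *\<^sub>R en) < 1 \<Longrightarrow> \<bar>f (x + t *\<^sub>R en) - f x\<bar> \<le> L * \<bar>t\<bar>"
    and Z: "{x. \<bar>f x\<bar> > M} \<subseteq> Z" "Z \<in> null_sets lborel" and M: "M \<ge> 0" and x: "norm x < 1/2"
  shows "u x - u y \<le> Holder_factor DIM('a) \<gamma> * (M + S) * coord_powr \<gamma> (x - y)"
proof (rule field_le_epsilon)
  fix \<epsilon> :: real assume \<epsilon>: "\<epsilon> > 0"
  define c where "c = Holder_factor DIM('a) \<gamma> * coord_powr \<gamma> (x - y)"
  have c: "c \<ge> 0"
    using Holder_factor_pos[OF \<gamma>(1,2), of "DIM('a)"] coord_powr_nonneg by (simp add: c_def)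
  define \<eta> where "\<eta> = \<epsilon> / (2 * c + 4)"
  have \<eta>: "\<eta> > 0" "2 * \<eta> * c + 4 * \<eta> = \<epsilon>"
  proof -
    show "\<eta> > 0" using \<epsilon> c by (simp add: \<eta>_def)
    have "(2 * c + 4) * \<eta> = \<epsilon>" using c by (simp add: \<eta>_def)
    then show "2 * \<eta> * c + 4 * \<eta> = \<epsilon>" by (simp add: algebra_simps)
  qed
  have S: "S \<ge> 0" using u(2)[of 0] by linarith
  have tr: "(\<lambda>k. trunc_op u k z) \<longlonglongrightarrow> f z" if "norm z < 1" for z
    using trunc_op_tendsto[OF u(1), of z] sol[OF that] by simp
  have tc: "continuous_on UNIV (trunc_op u k)" for k by (rule trunc_op_continuous[OF u])
  obtain v where v: "barrier \<eta> v" "\<And>z. norm z < 5/8 \<Longrightarrow> f z - (M + \<eta>) \<le> NL v z"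
    by (rule barrier_above[OF tc tr lip _ Z(2) \<eta>(1), of M]) (use Z(1) in \<open>auto simp: subset_iff\<close>)
  have "\<bar>- f (x + t *\<^sub>R en) - - f x\<bar> \<le> L * \<bar>t\<bar>" if "norm x < 1" "norm (x + t *\<^sub>R en) < 1" for x t
    using lip[OF that] by (simp add: abs_minus_commute)
  moreover have "(\<lambda>k. - trunc_op u k z) \<longlonglongrightarrow> - f z" if "norm z < 1" for z
    using tr[OF that] by (rule tendsto_minus)
  moreover have "continuous_on UNIV (\<lambda>z. - trunc_op u k z)" for k
    using tc by (intro continuous_intros)
  moreover have "{x. - f x > M} \<subseteq> Z" using Z(1) by auto
  ultimately obtain w where w: "barrier \<eta> w" "\<And>z. norm z < 5/8 \<Longrightarrow> - f z - (M + \<eta>) \<le> NL w z"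
    using barrier_above[of "\<lambda>k z. - trunc_op u k z" "\<lambda>z. - f z" L M Z \<eta>] Z(2) \<eta>(1) by blast
  note nv = NL_cmult[OF barrierD(4)[OF v(1)], of "- 1"]
  have vv: "vertical (\<lambda>x. - 1 * v x)" using barrierD(1)[OF v(1)] by (simp add: vertical_def)
  define u1 u2 where "u1 z = u z + (- 1 * v z)" and "u2 z = u z + w z" for z
  have near: "norm z < 5/8" if "dist x z \<le> 1/8" for z
    using that x norm_triangle_ineq2[of z x] by (simp add: dist_norm norm_minus_commute)
  have "u1 x - u2 y \<le> Holder_factor DIM('a) \<gamma> * (M + \<eta> + (S + \<eta>)) * coord_powr \<gamma> (x - y) + 2 * \<eta>"
  proof (rule Holder_estimate[OF \<gamma>])
    show "continuous_on UNIV u1" "continuous_on UNIV u2"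
      unfolding u1_def u2_def using u(1) barrier_continuous[OF v(1)] barrier_continuous[OF w(1)]
      by (auto intro!: continuous_intros)
    show "\<bar>u1 z\<bar> \<le> S + \<eta>" "\<bar>u2 z\<bar> \<le> S + \<eta>" "u1 z - u2 z \<le> 2 * \<eta>" for z
      using u(2)[of z] barrierD(2)[OF v(1), of z] barrierD(2)[OF w(1), of z]
      by (auto simp: u1_def u2_def abs_le_iff)
    fix z assume "dist x z \<le> 1/8"
    then have z: "norm z < 5/8" by (rule near)
    then have sz: "aniso_computable_at e m N s u z" "aniso_op e m N a b s u z = f z" using sol[of z] by auto
    show "aniso_computable_at e m N s u1 z \<and> aniso_op e m N a b s u1 z \<le> M + \<eta>"
      unfolding u1_def using aniso_add_vertical[OF vv nv(1) sz(1)] sz(2) nv(2)[of z] v(2)[OF z] by simp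
    show "aniso_computable_at e m N s u2 z \<and> - (M + \<eta>) \<le> aniso_op e m N a b s u2 z"
      unfolding u2_def using aniso_add_vertical[OF barrierD(1,4)[OF w(1)] sz(1)] sz(2) w(2)[OF z] by simp
  qed (use S M \<eta> in auto)
  also have "\<dots> = Holder_factor DIM('a) \<gamma> * (M + S) * coord_powr \<gamma> (x - y) + 2 * \<eta> * c + 2 * \<eta>"
    by (simp add: c_def algebra_simps)
  finally show "u x - u y \<le> Holder_factor DIM('a) \<gamma> * (M + S) * coord_powr \<gamma> (x - y) + \<epsilon>"
    using barrierD(2)[OF v(1), of x] barrierD(2)[OF w(1), of y] \<eta>(2) by (simp add: u1_def u2_def abs_le_iff)
qed

end

section \<open>The estimate in terms of essential suprema\<close>

lemma Linfty_norm_AE: "AE x in lebesgue_on A. ennreal \<bar>g x\<bar> \<le> Linfty_norm_on A g"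
  unfolding Linfty_norm_on_def by (rule esssup_AE)

lemma continuous_bounded_by_Linfty_norm:
  fixes u :: "'a::euclidean_space \<Rightarrow> real"
  assumes u: "continuous_on UNIV u" and S: "Linfty_norm_on UNIV u = ennreal S" "S \<ge> 0"
  shows "\<bar>u x\<bar> \<le> S"
proof (rule ccontr)
  assume "\<not> ?thesis"
  then have x: "x \<in> {x. S < \<bar>u x\<bar>}" by simp
  have "open {x. S < \<bar>u x\<bar>}"
    by (intro open_Collect_less continuous_intros u)
  moreover have "AE x in lebesgue. \<bar>u x\<bar> \<le> S"
    using Linfty_norm_AE[of u UNIV] S by (simp add: AE_restrict_space_iff)
  then have "{x. S < \<bar>u x\<bar>} \<in> null_sets lebesgue"
    by (simp add: AE_iff_null_sets not_le[symmetric] completion.AE_iff_null_sets)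
  ultimately show False
    using open_not_negligible[of "{x. S < \<bar>u x\<bar>}"] x negligible_iff_null_sets by blast
qed

theorem corollary1p3:
  fixes m :: nat and N :: "nat \<Rightarrow> nat" and a :: "nat \<Rightarrow> real" and b s \<gamma> :: real
  assumes "m \<ge> 1"
    and "\<And>i. i \<in> {1..m - 1} \<Longrightarrow> N i \<ge> 1"
    and "(\<Sum>i = 1..m - 1. N i) = DIM('a::euclidean_space) - 1"
    and "0 < s" and "s < 1"
    and "\<And>i. i \<in> {1..m - 1} \<Longrightarrow> a i > 0"
    and "b > 0"
    and "(s < 1/2 \<and> \<gamma> = 2 * s) \<or> (s \<ge> 1/2 \<and> (\<exists>\<epsilon>. 0 < \<epsilon> \<and> \<epsilon> < 1 \<and> \<gamma> = 1 - \<epsilon>))"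
  shows "\<exists>C>0. \<forall>(e :: nat \<Rightarrow> 'a) (f :: 'a \<Rightarrow> real) (u :: 'a \<Rightarrow> real).
    bij_betw e {1..DIM('a)} Basis \<longrightarrow>
    in_Linfty f \<longrightarrow>
    Lipschitz_along (e DIM('a)) (ball 0 1) f \<longrightarrow>
    classical_solution e m N a b s f u (unit_cylinder e) \<longrightarrow>
    Holder_norm_on \<gamma> (ball 0 (1/2)) u
      \<le> ennreal C * (Linfty_norm_on UNIV f
          + Linfty_norm_on (ball 0 1) (partial_deriv (e DIM('a)) f)
          + Linfty_norm_on UNIV u)"
proof -
  define H where "H = anisotropic.Holder_factor m N a b s DIM('a) \<gamma>"
  define C where "C = max 0 (H * DIM('a)) + 1"
  have C: "C > 0" "C \<ge> H * DIM('a) + 1" by (auto simp: C_def)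
  have \<gamma>: "0 < \<gamma>" "\<gamma> < 1" "\<gamma> \<le> 2 * s" using assms(4,8) by auto
  have "Holder_norm_on \<gamma> (ball 0 (1/2)) u
      \<le> ennreal C * (Linfty_norm_on UNIV f
          + Linfty_norm_on (ball 0 1) (partial_deriv (e DIM('a)) f)
          + Linfty_norm_on UNIV u)"
    if e: "bij_betw e {1..DIM('a)} Basis" and f: "in_Linfty f"
      and lip: "Lipschitz_along (e DIM('a)) (ball 0 1) f"
      and sol: "classical_solution e m N a b s f u (unit_cylinder e)"
    for e :: "nat \<Rightarrow> 'a" and f u :: "'a \<Rightarrow> real"
  proof (cases "Linfty_norm_on UNIV u = top")
    case True
    then show ?thesis using C by (simp add: ennreal_mult_top)
  next
    case False
    interpret anisotropic e m N a b s
      by unfold_locales (use assms e in auto)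
    define S where "S = enn2real (Linfty_norm_on UNIV u)"
    define M where "M = enn2real (Linfty_norm_on UNIV f)"
    have S: "Linfty_norm_on UNIV u = ennreal S" "S \<ge> 0"
      using False by (auto simp: S_def less_top)
    have M: "Linfty_norm_on UNIV f = ennreal M" "M \<ge> 0"
      using f by (auto simp: M_def in_Linfty_def less_top)
    have cu: "continuous_on UNIV u" using sol by (simp add: classical_solution_def)
    have uS: "\<bar>u x\<bar> \<le> S" for x by (rule continuous_bounded_by_Linfty_norm[OF cu S])
    have "AE x in lebesgue. \<bar>f x\<bar> \<le> M"
      using Linfty_norm_AE[of f UNIV] M by (simp add: AE_restrict_space_iff)
    then obtain Z0 where Z0: "{x \<in> space lebesgue. \<not> \<bar>f x\<bar> \<le> M} \<subseteq> Z0" "emeasure lebesgue Z0 = 0" "Z0 \<in> sets lebesgue"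
      by (rule AE_E)
    then have "Z0 \<in> null_sets lebesgue" by (intro null_setsI)
    then obtain Z where Z: "Z \<in> null_sets lborel" "Z0 \<subseteq> Z"
      using null_sets_completion_iff2[of Z0 lborel] by blast
    have fZ: "{x. \<bar>f x\<bar> > M} \<subseteq> Z" using Z0(1) Z(2) by (auto simp: not_le)
    obtain L where L: "\<And>x t. x \<in> ball 0 1 \<Longrightarrow> x + t *\<^sub>R en \<in> ball 0 1 \<Longrightarrow> \<bar>f (x + t *\<^sub>R en) - f x\<bar> \<le> L * \<bar>t\<bar>"
      using lip unfolding Lipschitz_along_def by blast
    have est: "\<bar>u x - u y\<bar> \<le> H * DIM('a) * (M + S) * dist x y powr \<gamma>" if x: "norm x < 1/2" and y: "norm y < 1/2" for x y
    proof -
      have one: "u x - u y \<le> H * DIM('a) * (M + S) * dist x y powr \<gamma>" if x: "norm x < 1/2" for x y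
      proof -
        have "u x - u y \<le> Holder_factor DIM('a) \<gamma> * (M + S) * coord_powr \<gamma> (x - y)"
        proof (rule interior_Holder_estimate[OF \<gamma> cu uS _ _ fZ Z(1) M(2) x])
          show "aniso_computable_at e m N s u z \<and> aniso_op e m N a b s u z = f z" if "norm z < 1" for z
            using sol ball_subset_unit_cylinder[OF that] by (simp add: classical_solution_def)
          show "\<bar>f (z + t *\<^sub>R en) - f z\<bar> \<le> L * \<bar>t\<bar>" if "norm z < 1" "norm (z + t *\<^sub>R en) < 1" for z t
            using L[of z t] that by simp
        qed
        also have "\<dots> \<le> Holder_factor DIM('a) \<gamma> * (M + S) * (DIM('a) * norm (x - y) powr \<gamma>)"
          using coord_powr_le[OF \<gamma>(1), of "x - y"] Holder_factor_pos[OF \<gamma>(1,2), of "DIM('a)"] S(2) M(2)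
          by (intro mult_left_mono mult_nonneg_nonneg) auto
        finally show ?thesis by (simp add: H_def dist_norm mult_ac)
      qed
      show ?thesis using one[OF x, of y] one[OF y, of x] by (simp add: abs_le_iff dist_commute)
    qed
    have H0: "H > 0" unfolding H_def using Holder_factor_pos[OF \<gamma>(1,2)] .
    define B where "B = H * DIM('a) * (M + S)"
    have B: "B \<ge> 0" using H0 M(2) S(2) by (simp add: B_def)
    have sup: "(SUP x\<in>ball 0 (1/2). ennreal \<bar>u x\<bar>) \<le> ennreal S"
      using uS by (intro SUP_least ennreal_leI)
    have quot: "(SUP x\<in>ball 0 (1/2). SUP y\<in>ball 0 (1/2) - {x}. ennreal (\<bar>u x - u y\<bar> / dist x y powr \<gamma>)) \<le> ennreal B"
    proof (intro SUP_least ennreal_leI)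
      fix x y :: 'a assume "x \<in> ball 0 (1/2)" "y \<in> ball 0 (1/2) - {x}"
      then have "\<bar>u x - u y\<bar> \<le> B * dist x y powr \<gamma>" "dist x y > 0"
        using est[of x y] by (auto simp: B_def)
      then show "\<bar>u x - u y\<bar> / dist x y powr \<gamma> \<le> B" by (simp add: pos_divide_le_eq)
    qed
    have "Holder_norm_on \<gamma> (ball 0 (1/2)) u \<le> ennreal S + ennreal B"
      unfolding Holder_norm_on_def by (rule add_mono[OF sup quot])
    also have "\<dots> = ennreal (S + B)" using S(2) B by simp
    also have "\<dots> \<le> ennreal (C * (M + S))"
    proof (rule ennreal_leI)
      have "S + B \<le> (H * DIM('a) + 1) * (M + S)" using M(2) by (simp add: B_def algebra_simps)
      also have "\<dots> \<le> C * (M + S)" using C(2) M(2) S(2) by (intro mult_right_mono) auto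
      finally show "S + B \<le> C * (M + S)" .
    qed
    also have "\<dots> = ennreal C * (Linfty_norm_on UNIV f + Linfty_norm_on UNIV u)"
      using C(1) M S by (simp add: ennreal_mult)
    also have "\<dots> \<le> ennreal C * (Linfty_norm_on UNIV f
          + Linfty_norm_on (ball 0 1) (partial_deriv (e DIM('a)) f)
          + Linfty_norm_on UNIV u)"
      by (intro mult_left_mono add_right_mono) (auto simp: add_increasing2)
    finally show ?thesis .
  qed
  then show ?thesis using C(1) by blast
qed

end
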